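(* If $U$ is of type $\mathfrak B_n$ or $\mathfrak D_n$, then every irreducible $\mathbb CU$-module is a constituent of precisely one isomorphism class of main separated $U$-orbit modules in $\mathbb C\hat V$, i.e. of modules $\mathbb C\mathcal O_A$ with $[A]\in\hat V$ main separated.
   Context: Let $q$ be a power of an odd prime $p$, $n$ a positive integer. Put $N=2n+1$ in type $\mathfrak B_n$, $N=2n$ in type $\mathfrak D_n$; $\bar i=N+1-i$ for $1\le i\le N$. Let $P=\{(i,j):1\le i<j<\bar i\}$. $V$ is the space of $N\times N$-matrices over $\mathbb F_q$ whose support lies in $P$; $\pi$ is the map from $N\times N$-matrices onto $V$ replacing entries outside $P$ by zero. For $(i,j)\in P$, $\alpha\in\mathbb F_q$ define $x_{ij}(\alpha)$ ($e_{ij}$ matrix units): in type $\mathfrak D_n$, and in type $\mathfrak B_n$ if $j\ne n+1$: $1+\alpha e_{ij}-\alpha e_{\bar j\,\bar i}$; in type $\mathfrak B_n$, $j=n+1$: $1+\alpha e_{i,n+1}-\alpha e_{n+1,\bar i}-\frac12\alpha^2e_{i\bar i}$. $U$ is the group generated by all $x_{ij}(\alpha)$, $(i,j)\in P$, $\alpha\in\mathbb F_q$ (a $p$-Sylow subgroup of the finite orthogonal group of type $\mathfrak B_n$, $\mathfrak D_n$). Fix a nontrivial linear character $\theta:(\mathbb F_q,+)\to\mathbb C^*$ and put $\kappa(A,B)=\operatorname{tr}(A^tB)$. For $A\in V$ let $[A]$ be the linear character $B\mapsto\theta(\kappa(-A,B))$ of $(V,+)$; $\hat V=\{[A]:A\in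 V\}$. For $g\in U$ ($g^{-t}$ the inverse transpose) put $[A].g=[\pi(Ag^{-t})]$ and $[A]g=\theta(\kappa(-A,\pi(g^{-1})))\,[A].g$; the latter makes $\mathbb C\hat V$ a right $\mathbb CU$-module (isomorphic to the right regular module). $\mathcal O_A=\{[A].u:u\in U\}$, and the orbit module $\mathbb C\mathcal O_A$ is its $\mathbb C$-span, a $\mathbb CU$-submodule. $\operatorname{main}(A)$ is the set of $(i,j)\in P$ such that $A_{ij}$ is the rightmost nonzero entry of row $i$ of $A$. $\operatorname{Limb}(A)=\bigcup_{(i,j)\in\operatorname{main}(A)}\big(\{(\bar j,a)\in P\}\cup\{(a,j)\in P:a>i\}\big)$. $[A]$ is main separated if $\operatorname{Limb}(A)\cap\operatorname{main}(A)=\emptyset$. *)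

theory Defs
  imports
    "HOL-Computational_Algebra.Primes"
    "HOL-Library.Cardinality"
    "HOL-Algebra.Generated_Groups"
    "HOL-Library.Function_Algebras"
    "HOL-Library.FuncSet"
    "Jordan_Normal_Form.Matrix"
begin

section \<open>Right modules over a complex group algebra\<close>

text \<open>
  A right module over the group algebra of \<open>G\<close> is given in the usual way as a complex vector
  space with a linear right action of \<open>G\<close>. The vector space is a subspace \<open>rspace M\<close> of an ambient
  complex vector space, which is the whole type \<open>'v\<close> with scalar multiplication \<open>rscale M\<close>;
  outside of \<open>rspace M\<close> nothing is required of the action.
\<close>

record ('v, 'g) rmodule =
  rspace :: "'v set"
  rscale :: "complex \<Rightarrow> 'v \<Rightarrow> 'v"
  ract :: "'v \<Rightarrow> 'g \<Rightarrow> 'v"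

definition group_rmodule :: "'g monoid \<Rightarrow> ('v::ab_group_add, 'g) rmodule \<Rightarrow> bool" where
  "group_rmodule G M \<longleftrightarrow>
     group G \<and> vector_space (rscale M) \<and> module.subspace (rscale M) (rspace M) \<and>
     (\<forall>g\<in>carrier G. \<forall>v\<in>rspace M. ract M v g \<in> rspace M) \<and>
     (\<forall>g\<in>carrier G. \<forall>v\<in>rspace M. \<forall>w\<in>rspace M. ract M (v + w) g = ract M v g + ract M w g) \<and>
     (\<forall>g\<in>carrier G. \<forall>c. \<forall>v\<in>rspace M. ract M (rscale M c v) g = rscale M c (ract M v g)) \<and>
     (\<forall>v\<in>rspace M. ract M v \<one>\<^bsub>G\<^esub> = v) \<and>
     (\<forall>g\<in>carrier G. \<forall>h\<in>carrier G. \<forall>v\<in>rspace M. ract M v (g \<otimes>\<^bsub>G\<^esub> h) = ract M (ract M v g) h)"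

definition submodule_space :: "'g monoid \<Rightarrow> ('v::ab_group_add, 'g) rmodule \<Rightarrow> 'v set \<Rightarrow> bool" where
  "submodule_space G M W \<longleftrightarrow>
     W \<subseteq> rspace M \<and> module.subspace (rscale M) W \<and>
     (\<forall>g\<in>carrier G. \<forall>w\<in>W. ract M w g \<in> W)"

definition irreducible_rmodule :: "'g monoid \<Rightarrow> ('v::ab_group_add, 'g) rmodule \<Rightarrow> bool" where
  "irreducible_rmodule G M \<longleftrightarrow>
     group_rmodule G M \<and> rspace M \<noteq> {0} \<and>
     (\<forall>W. submodule_space G M W \<longrightarrow> W = {0} \<or> W = rspace M)"

definition rmodule_hom ::
  "'g monoid \<Rightarrow> ('v::ab_group_add, 'g) rmodule \<Rightarrow> ('w::ab_group_add, 'g) rmodule \<Rightarrow> ('v \<Rightarrow> 'w) set"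
  where
  "rmodule_hom G M M' = {f \<in> rspace M \<rightarrow> rspace M'.
     (\<forall>v\<in>rspace M. \<forall>w\<in>rspace M. f (v + w) = f v + f w) \<and>
     (\<forall>c. \<forall>v\<in>rspace M. f (rscale M c v) = rscale M' c (f v)) \<and>
     (\<forall>g\<in>carrier G. \<forall>v\<in>rspace M. f (ract M v g) = ract M' (f v) g)}"

definition rmodule_isomorphic ::
  "'g monoid \<Rightarrow> ('v::ab_group_add, 'g) rmodule \<Rightarrow> ('w::ab_group_add, 'g) rmodule \<Rightarrow> bool" where
  "rmodule_isomorphic G M M' \<longleftrightarrow>
     (\<exists>f\<in>rmodule_hom G M M'. bij_betw f (rspace M) (rspace M'))"

text \<open>
  An irreducible \<open>S\<close> is a constituent (composition factor) of \<open>M\<close> if it is isomorphic to \<open>W / K\<close> for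
  submodules \<open>K \<subseteq> W\<close> of \<open>M\<close>; such an isomorphism is the same as an epimorphism from \<open>W\<close>
  onto \<open>S\<close> with kernel \<open>K\<close>.
\<close>

definition constituent ::
  "'g monoid \<Rightarrow> ('w::ab_group_add, 'g) rmodule \<Rightarrow> ('v::ab_group_add, 'g) rmodule \<Rightarrow> bool" where
  "constituent G S M \<longleftrightarrow>
     (\<exists>W. submodule_space G M W \<and> (\<exists>f\<in>rmodule_hom G (M\<lparr>rspace := W\<rparr>) S. f ` W = rspace S))"


section \<open>The groups of type B and D\<close>

datatype orth_type = Type_B | Type_D

fun mat_size :: "orth_type \<Rightarrow> nat \<Rightarrow> nat" where
  "mat_size Type_B n = 2 * n + 1"
| "mat_size Type_D n = 2 * n"

text \<open>
  Rows and columns are numbered from \<open>0\<close> to \<open>N - 1\<close>, as for the matrices of the library, rather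
  than from \<open>1\<close> to \<open>N\<close>. So \<open>i \<mapsto> N + 1 - i\<close> becomes \<open>i \<mapsto> N - 1 - i\<close>, and in type B
  the middle index is \<open>n\<close> instead of \<open>n + 1\<close>.
\<close>

definition opp :: "orth_type \<Rightarrow> nat \<Rightarrow> nat \<Rightarrow> nat" where
  "opp T n i = mat_size T n - 1 - i"

definition pos_set :: "orth_type \<Rightarrow> nat \<Rightarrow> (nat \<times> nat) set" where
  "pos_set T n = {(i, j). i < j \<and> j < opp T n i}"

definition e_mat :: "nat \<Rightarrow> nat \<Rightarrow> nat \<Rightarrow> 'q::field mat" where
  "e_mat N i j = mat N N (\<lambda>(r, s). if r = i \<and> s = j then 1 else 0)"

definition root_elt :: "orth_type \<Rightarrow> nat \<Rightarrow> nat \<Rightarrow> nat \<Rightarrow> 'q::field \<Rightarrow> 'q mat" where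
  "root_elt T n i j \<alpha> =
     (let N = mat_size T n; i' = opp T n i; j' = opp T n j in
      if T = Type_B \<and> j = n
      then 1\<^sub>m N + \<alpha> \<cdot>\<^sub>m e_mat N i n - \<alpha> \<cdot>\<^sub>m e_mat N n i' - (1 / 2 * \<alpha>\<^sup>2) \<cdot>\<^sub>m e_mat N i i'
      else 1\<^sub>m N + \<alpha> \<cdot>\<^sub>m e_mat N i j - \<alpha> \<cdot>\<^sub>m e_mat N j' i')"

definition GL_mat :: "nat \<Rightarrow> 'q::field mat monoid" where
  "GL_mat N = units_of (ring_mat TYPE('q) N ())"

definition unip_group :: "orth_type \<Rightarrow> nat \<Rightarrow> 'q::field mat monoid" where
  "unip_group T n = (GL_mat (mat_size T n))
     \<lparr>carrier := generate (GL_mat (mat_size T n)) {root_elt T n i j \<alpha> | i j \<alpha>. (i, j) \<in> pos_set T n}\<rparr>"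


section \<open>The monomial module and its orbit modules\<close>

definition pos_space :: "orth_type \<Rightarrow> nat \<Rightarrow> 'q::field mat set" where
  "pos_space T n = {A \<in> carrier_mat (mat_size T n) (mat_size T n).
     \<forall>i < mat_size T n. \<forall>j < mat_size T n. (i, j) \<notin> pos_set T n \<longrightarrow> A $$ (i, j) = 0}"

definition proj_pos :: "orth_type \<Rightarrow> nat \<Rightarrow> 'q::field mat \<Rightarrow> 'q mat" where
  "proj_pos T n A = mat (mat_size T n) (mat_size T n) (\<lambda>(i, j). if (i, j) \<in> pos_set T n then A $$ (i, j) else 0)"

definition nontrivial_add_char :: "('q::field \<Rightarrow> complex) \<Rightarrow> bool" where
  "nontrivial_add_char \<theta> \<longleftrightarrow>
     (\<forall>x. \<theta> x \<noteq> 0) \<and> (\<forall>x y. \<theta> (x + y) = \<theta> x * \<theta> y) \<and> (\<exists>x. \<theta> x \<noteq> 1)"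

definition mat_tr :: "'q::field mat \<Rightarrow> 'q" where
  "mat_tr A = (\<Sum>i<dim_row A. A $$ (i, i))"

definition kappa :: "'q::field mat \<Rightarrow> 'q mat \<Rightarrow> 'q" where
  "kappa A B = mat_tr (transpose_mat A * B)"

definition lin_char ::
  "('q::field \<Rightarrow> complex) \<Rightarrow> orth_type \<Rightarrow> nat \<Rightarrow> 'q mat \<Rightarrow> ('q mat \<Rightarrow> complex)" where
  "lin_char \<theta> T n A = (\<lambda>B\<in>pos_space T n. \<theta> (kappa (- A) B))"

text \<open>The matrix \<open>\<pi>(A g\<^sup>-\<^sup>t)\<close>, so that \<open>[A].g = [mat_act T n A g]\<close>.\<close>

definition mat_act :: "orth_type \<Rightarrow> nat \<Rightarrow> 'q::field mat \<Rightarrow> 'q mat \<Rightarrow> 'q mat" where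
  "mat_act T n A g = proj_pos T n (A * transpose_mat (inv\<^bsub>unip_group T n\<^esub> g))"

text \<open>
  Formal linear combinations of characters are functions on the set of characters; \<open>basis_vec \<chi>\<close> is
  the basis element belonging to \<open>\<chi>\<close>. The monomial action is extended linearly from
  the basis, where the sum over all \<open>A \<in> pos_space T n\<close> is a sum over all characters because
  \<open>A \<mapsto> [A]\<close> is injective there.
\<close>

definition basis_vec :: "'x \<Rightarrow> 'x \<Rightarrow> complex" where
  "basis_vec \<chi> = (\<lambda>\<psi>. if \<psi> = \<chi> then 1 else 0)"

definition fun_scale :: "complex \<Rightarrow> ('x \<Rightarrow> complex) \<Rightarrow> ('x \<Rightarrow> complex)" where
  "fun_scale c f = (\<lambda>\<psi>. c * f \<psi>)"

definition char_module ::
  "('q::{field,finite} \<Rightarrow> complex) \<Rightarrow> orth_type \<Rightarrow> nat \<Rightarrow>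
   (('q mat \<Rightarrow> complex) \<Rightarrow> complex, 'q mat) rmodule" where
  "char_module \<theta> T n =
     \<lparr>rspace = module.span fun_scale (basis_vec ` lin_char \<theta> T n ` pos_space T n),
      rscale = fun_scale,
      ract = (\<lambda>f g. \<Sum>A\<in>pos_space T n.
        fun_scale (f (lin_char \<theta> T n A) * \<theta> (kappa (- A) (proj_pos T n (inv\<^bsub>unip_group T n\<^esub> g))))
          (basis_vec (lin_char \<theta> T n (mat_act T n A g))))\<rparr>"

definition char_orbit ::
  "('q::{field,finite} \<Rightarrow> complex) \<Rightarrow> orth_type \<Rightarrow> nat \<Rightarrow> 'q mat \<Rightarrow> ('q mat \<Rightarrow> complex) set" where
  "char_orbit \<theta> T n A = {lin_char \<theta> T n (mat_act T n A u) | u. u \<in> carrier (unip_group T n)}"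

definition orbit_module ::
  "('q::{field,finite} \<Rightarrow> complex) \<Rightarrow> orth_type \<Rightarrow> nat \<Rightarrow> 'q mat \<Rightarrow>
   (('q mat \<Rightarrow> complex) \<Rightarrow> complex, 'q mat) rmodule" where
  "orbit_module \<theta> T n A =
     (char_module \<theta> T n)\<lparr>rspace := module.span fun_scale (basis_vec ` char_orbit \<theta> T n A)\<rparr>"

definition main_conds :: "orth_type \<Rightarrow> nat \<Rightarrow> 'q::field mat \<Rightarrow> (nat \<times> nat) set" where
  "main_conds T n A = {(i, j) \<in> pos_set T n.
     A $$ (i, j) \<noteq> 0 \<and> (\<forall>k. j < k \<and> k < mat_size T n \<longrightarrow> A $$ (i, k) = 0)}"

definition Limb :: "orth_type \<Rightarrow> nat \<Rightarrow> 'q::field mat \<Rightarrow> (nat \<times> nat) set" where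
  "Limb T n A = (\<Union>(i, j) \<in> main_conds T n A.
     {(opp T n j, a) | a. (opp T n j, a) \<in> pos_set T n} \<union> {(a, j) | a. (a, j) \<in> pos_set T n \<and> i < a})"

definition main_separated :: "orth_type \<Rightarrow> nat \<Rightarrow> 'q::field mat \<Rightarrow> bool" where
  "main_separated T n A \<longleftrightarrow> Limb T n A \<inter> main_conds T n A = {}"

definition main_separated_orbit_modules ::
  "('q::{field,finite} \<Rightarrow> complex) \<Rightarrow> orth_type \<Rightarrow> nat \<Rightarrow>
   (('q mat \<Rightarrow> complex) \<Rightarrow> complex, 'q mat) rmodule set" where
  "main_separated_orbit_modules \<theta> T n =
     {orbit_module \<theta> T n A | A. A \<in> pos_space T n \<and> main_separated T n A}"

definition main_separated_iso_classes ::
  "('q::{field,finite} \<Rightarrow> complex) \<Rightarrow> orth_type \<Rightarrow> nat \<Rightarrow>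
   (('q mat \<Rightarrow> complex) \<Rightarrow> complex, 'q mat) rmodule set set" where
  "main_separated_iso_classes \<theta> T n =
     main_separated_orbit_modules \<theta> T n //
       {(M, M'). M \<in> main_separated_orbit_modules \<theta> T n \<and>
                 M' \<in> main_separated_orbit_modules \<theta> T n \<and> rmodule_isomorphic (unip_group T n) M M'}"

end

theory Submission
  imports Defs
begin

text \<open>
  Write \<open>A.u\<close> for \<open>mat_act T n A u\<close>, \<open>coc A u\<close> for the scalar \<open>\<theta>(\<kappa>(-A, \<pi>(u\<^sup>-\<^sup>1)))\<close>, and \<open>bar i\<close>
  for the index opposite to \<open>i\<close>. The map \<open>coc\<close> is a cocycle,
  \<open>coc A (g h) = coc A g * coc (A.g) h\<close>, so the orbit module of \<open>A\<close> is induced from the linear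
  character \<open>coc A\<close> of the stabilizer of \<open>A\<close>. Hence an irreducible \<open>S\<close> is a quotient of it as
  soon as \<open>S\<close> contains a nonzero vector \<open>s\<close> with \<open>s u = coc A u s\<close> for all \<open>u\<close> in \<open>Stab A\<close>
  (\<open>constituentI\<close>); call it an eigenvector of \<open>Stab A\<close>.

  Existence. A main separated \<open>A\<close> is built row by row, from the top. Let \<open>mid k\<close> be the normal
  subgroup of those \<open>u\<close> whose middle block, with rows and columns \<open>k, ..., bar k\<close>, is trivial.
  Suppose that the rows \<open>k, k + 1, ...\<close> of \<open>A\<close> vanish and that \<open>S\<close> has an eigenvector of
  \<open>Stab A \<inter> mid k\<close>. If \<open>bar k\<close> is the main column of an earlier row, then stabilizing that row
  already forces \<open>Stab A \<inter> mid (k + 1)\<close> into \<open>mid k\<close>, and row \<open>k\<close> can be left zero: this is why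
  main separation forbids main conditions in that row. Otherwise \<open>Stab A \<inter> mid (k + 1)\<close> modulo
  \<open>Stab A \<inter> mid k\<close> is elementary abelian, by sending \<open>u\<close> to the first row of the middle block
  of its inverse. Decomposing under this quotient yields an eigenvector for \<open>A\<close> with some new
  row \<open>k\<close> (\<open>middle_eigenvectors\<close>). Adding to the new row multiples of earlier rows with main
  column to the left of \<open>bar k\<close> does not change the linear character that it defines, so its
  main column can be kept away from the main columns in use (\<open>middle_extend\<close>). For \<open>k = n\<close> the
  condition \<open>mid n\<close> is empty.

  Uniqueness. If \<open>S\<close> has an eigenvector of \<open>Stab A\<close> and is a constituent of the orbit module of
  \<open>B\<close>, then \<open>coc A\<close> and \<open>coc (B.u)\<close> agree on \<open>Stab A \<inter> Stab (B.u)\<close> for some \<open>u\<close>, by an argument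
  as in Mackey's theorem (\<open>constituent_agree\<close>). For main separated \<open>A\<close> and \<open>B\<close> this implies
  that the orbit modules are isomorphic (\<open>agree_isomorphic\<close>). Again one proceeds row by row;
  suppose that the rows above row \<open>i\<close> coincide. Acting with an element of \<open>U\<close> on both matrices
  clears the middle block columns in the earlier rows whose main column lies to the right of
  \<open>bar i\<close> (\<open>clear_middle\<close>). Then there are enough elements in \<open>Stab A \<inter> Stab B\<close>, differing from
  1 essentially in row \<open>i\<close>, to see that the rows \<open>i\<close> of \<open>A\<close> and \<open>B\<close> differ by a combination of
  earlier rows. Adding such a combination to row \<open>i\<close> of \<open>A\<close> changes neither \<open>Stab A\<close> nor
  \<open>coc A\<close> on it, hence not the isomorphism class of the module, and makes the rows \<open>i\<close> equal
  (\<open>agree_step\<close>).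
\<close>

section \<open>The unipotent orthogonal group\<close>

text \<open>
  The transpose along the antidiagonal. On the orthogonal group of the form that pairs the
  index \<open>i\<close> with \<open>N - 1 - i\<close> it is inversion.
\<close>

definition flip_mat :: "nat \<Rightarrow> 'a mat \<Rightarrow> 'a mat" where
  "flip_mat N u = mat N N (\<lambda>(a, b). u $$ (N - 1 - b, N - 1 - a))"

lemma mult_mat_entry:
  assumes "A \<in> carrier_mat N N" "B \<in> carrier_mat N N" "i < N" "j < N"
  shows "(A * B) $$ (i, j) = (\<Sum>c<N. A $$ (i, c) * B $$ (c, j))"
  using assms by (auto simp: scalar_prod_def atLeast0LessThan intro!: sum.cong)

lemma flip_mat_carrier [simp]: "flip_mat N u \<in> carrier_mat N N"
  by (simp add: flip_mat_def)

lemma flip_mat_dim [simp]: "dim_row (flip_mat N u) = N" "dim_col (flip_mat N u) = N"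
  by (simp_all add: flip_mat_def)

lemma flip_mat_index:
  "a < N \<Longrightarrow> b < N \<Longrightarrow> flip_mat N u $$ (a, b) = u $$ (N - 1 - b, N - 1 - a)"
  by (simp add: flip_mat_def)

lemma flip_flip [simp]: "u \<in> carrier_mat N N \<Longrightarrow> flip_mat N (flip_mat N u) = u"
  by (rule eq_matI) (auto simp: flip_mat_index)

lemma flip_one: "flip_mat N (1\<^sub>m N) = 1\<^sub>m N"
  by (rule eq_matI) (auto simp: flip_mat_index)

lemma flip_mult:
  assumes "A \<in> carrier_mat N N" "B \<in> carrier_mat N N"
  shows "flip_mat N (A * B) = flip_mat N B * flip_mat N (A :: 'a::comm_semiring_0 mat)"
proof (rule eq_matI)
  fix a b assume "a < dim_row (flip_mat N B * flip_mat N A)" "b < dim_col (flip_mat N B * flip_mat N A)"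
  then have ab: "a < N" "b < N" by (auto simp: flip_mat_def)
  have "(flip_mat N B * flip_mat N A) $$ (a, b)
      = (\<Sum>c<N. B $$ (N - 1 - c, N - 1 - a) * A $$ (N - 1 - b, N - 1 - c))"
    using ab by (simp add: mult_mat_entry[where N = N] flip_mat_index del: index_mult_mat)
  also have "\<dots> = (\<Sum>c<N. B $$ (c, N - 1 - a) * A $$ (N - 1 - b, c))"
    by (rule sum.reindex_bij_witness[where i = "\<lambda>c. N - 1 - c" and j = "\<lambda>c. N - 1 - c"]) auto
  also have "\<dots> = flip_mat N (A * B) $$ (a, b)"
    using ab assms by (simp add: mult_mat_entry[where N = N] flip_mat_index mult.commute del: index_mult_mat)
  finally show "flip_mat N (A * B) $$ (a, b) = (flip_mat N B * flip_mat N A) $$ (a, b)" by simp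
qed (auto simp: flip_mat_def)

text \<open>
  The upper unitriangular orthogonal matrices. Defined by equations on the entries, this group
  contains the generators of \<open>U\<close> and hence \<open>U\<close>; its elements are inverted by a transposition.
\<close>

definition uni_orth :: "nat \<Rightarrow> 'q::field mat set" where
  "uni_orth N = {u \<in> carrier_mat N N. (\<forall>a<N. u $$ (a, a) = 1) \<and> (\<forall>a<N. \<forall>b<a. u $$ (a, b) = 0) \<and>
     u * flip_mat N u = 1\<^sub>m N \<and> flip_mat N u * u = 1\<^sub>m N}"

lemma upper_mult_entry:
  assumes "A \<in> carrier_mat N N" "B \<in> carrier_mat N N" "a < N" "b < N"
    and "\<And>a b. a < N \<Longrightarrow> b < a \<Longrightarrow> A $$ (a, b) = 0" "\<And>a b. a < N \<Longrightarrow> b < a \<Longrightarrow> B $$ (a, b) = 0"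
  shows "(A * B) $$ (a, b) = (\<Sum>c\<in>{a..b}. A $$ (a, c) * B $$ (c, b :: nat))"
proof -
  have "(A * B) $$ (a, b) = (\<Sum>c<N. A $$ (a, c) * B $$ (c, b))"
    using assms by (intro mult_mat_entry)
  also have "\<dots> = (\<Sum>c\<in>{a..b}. A $$ (a, c) * B $$ (c, b))"
    using assms(3-) by (intro sum.mono_neutral_right) (auto simp: not_le)
  finally show ?thesis .
qed

lemma uni_orth_flip: "u \<in> uni_orth N \<Longrightarrow> flip_mat N u \<in> uni_orth N"
  unfolding uni_orth_def by (auto simp: flip_mat_index)

lemma uni_orth_mult:
  assumes "u \<in> uni_orth N" "v \<in> uni_orth N"
  shows "u * v \<in> uni_orth N"
proof -
  have c: "u \<in> carrier_mat N N" "v \<in> carrier_mat N N" using assms by (auto simp: uni_orth_def)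
  have e: "(u * v) $$ (a, b) = (\<Sum>c\<in>{a..b}. u $$ (a, c) * v $$ (c, b))" if "a < N" "b < N" for a b
    using assms by (intro upper_mult_entry[OF c that]) (auto simp: uni_orth_def)
  have i: "u * flip_mat N u = 1\<^sub>m N" "flip_mat N u * u = 1\<^sub>m N"
    "v * flip_mat N v = 1\<^sub>m N" "flip_mat N v * v = 1\<^sub>m N"
    using assms by (auto simp: uni_orth_def)
  have as: "A * B * (C * D) = A * (B * C * D)" if "A \<in> carrier_mat N N" "B \<in> carrier_mat N N"
    "C \<in> carrier_mat N N" "D \<in> carrier_mat N N" for A B C D :: "'a mat"
  proof -
    have "A * B * (C * D) = A * (B * (C * D))"
      using that by (intro assoc_mult_mat[of _ N N _ N _ N]) auto
    also have "B * (C * D) = B * C * D"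
      using that by (intro assoc_mult_mat[symmetric, of _ N N _ N _ N]) auto
    finally show ?thesis .
  qed
  have "(u * v) * flip_mat N (u * v) = 1\<^sub>m N"
    using c by (simp add: flip_mult as i)
  moreover have "flip_mat N (u * v) * (u * v) = 1\<^sub>m N"
    using c by (simp add: flip_mult as i)
  ultimately show ?thesis
    using c assms e by (auto simp: uni_orth_def)
qed

lemma GL_mat_group: "group (GL_mat N :: 'q::field mat monoid)"
proof -
  interpret M: monoid "ring_mat TYPE('q) N ()"
    by (rule ring.is_monoid[OF ring_mat])
  show ?thesis unfolding GL_mat_def by (rule M.units_group)
qed

lemma GL_mat_mult [simp]: "x \<otimes>\<^bsub>GL_mat N\<^esub> y = x * y"
  by (simp add: GL_mat_def units_of_mult ring_mat_simps)

lemma GL_mat_one [simp]: "\<one>\<^bsub>GL_mat N\<^esub> = 1\<^sub>m N"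
  by (simp add: GL_mat_def units_of_one ring_mat_simps)

lemma uni_orth_subgroup: "subgroup (uni_orth N) (GL_mat N :: 'q::field mat monoid)"
  and GL_mat_inv: "(u :: 'q mat) \<in> uni_orth N \<Longrightarrow> inv\<^bsub>GL_mat N\<^esub> u = flip_mat N u"
proof -
  interpret G: group "GL_mat N :: 'q mat monoid" by (rule GL_mat_group)
  have car: "u \<in> carrier (GL_mat N)" if "u \<in> uni_orth N" for u :: "'q mat"
    using that uni_orth_flip[OF that]
    unfolding GL_mat_def units_of_def Units_def uni_orth_def by (auto simp: ring_mat_simps)
  show i: "inv\<^bsub>GL_mat N\<^esub> u = flip_mat N u" if "u \<in> uni_orth N" for u :: "'q mat"
  proof (rule G.inv_equality)
    show "flip_mat N u \<otimes>\<^bsub>GL_mat N\<^esub> u = \<one>\<^bsub>GL_mat N\<^esub>" using that by (simp add: uni_orth_def)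
  qed (use that car uni_orth_flip in auto)
  have "(1\<^sub>m N :: 'q mat) \<in> uni_orth N" by (auto simp: uni_orth_def flip_one)
  then show "subgroup (uni_orth N) (GL_mat N :: 'q mat monoid)"
    by (intro G.subgroupI) (auto simp: i car intro: uni_orth_flip uni_orth_mult)
qed

lemma sum_delta_mult:
  fixes f :: "nat \<Rightarrow> 'a::semiring_1"
  assumes "k < N"
  shows "(\<Sum>c<N. (if c = k then x else 0) * f c) = x * f k" "(\<Sum>c<N. (if k = c then x else 0) * f c) = x * f k"
proof -
  have "(\<Sum>c<N. (if c = k then x else 0) * f c) = (\<Sum>c<N. if c = k then x * f c else 0)"
    by (rule sum.cong) auto
  then show "(\<Sum>c<N. (if c = k then x else 0) * f c) = x * f k" using assms by simp
  then show "(\<Sum>c<N. (if k = c then x else 0) * f c) = x * f k" by (simp add: eq_commute)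
qed

lemma pos_set_bounds:
  assumes "(i, j) \<in> pos_set T n"
  shows "i < n" "j < mat_size T n" "i < j" "opp T n j < mat_size T n" "i < opp T n j" "j < opp T n i"
    "opp T n i < mat_size T n" "opp T n j < opp T n i"
proof -
  obtain e where e: "mat_size T n = 2 * n + e" "e \<le> 1" by (cases T) auto
  have "i < j" "j < mat_size T n - 1 - i" using assms by (auto simp: pos_set_def opp_def)
  with e show "i < n" "j < mat_size T n" "i < j" "opp T n j < mat_size T n" "i < opp T n j" "j < opp T n i"
    "opp T n i < mat_size T n" "opp T n j < opp T n i"
    unfolding opp_def by linarith+
qed

lemma root_elt_entry:
  assumes P: "(i, j) \<in> pos_set T n" and "a < mat_size T n" "b < mat_size T n"
  shows "root_elt T n i j \<alpha> $$ (a, b) =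
    (if a = b then 1 else 0) + (if b = j then if a = i then \<alpha> else 0 else 0)
     + (if b = opp T n i then if a = opp T n j then - \<alpha> else 0 else 0)
     + (if b = opp T n i then if a = i \<and> T = Type_B \<and> j = n then - (1 / 2 * \<alpha>\<^sup>2) else 0 else 0)"
proof -
  obtain i' j' where i'j': "opp T n i = i'" "opp T n j = j'" by blast
  have ne: "i \<noteq> i'" "i \<noteq> j'" "j \<noteq> i'" using pos_set_bounds[OF P] i'j' by auto
  have j: "j' = n" if "T = Type_B" "j = n" using that i'j' by (auto simp: opp_def)
  define N where "N = mat_size T n"
  have ab: "a < N" "b < N" using assms by (auto simp: N_def)
  show ?thesis
  proof (cases "T = Type_B \<and> j = n")
    case True
    then have r: "root_elt T n i j \<alpha>
      = 1\<^sub>m N + \<alpha> \<cdot>\<^sub>m e_mat N i j - \<alpha> \<cdot>\<^sub>m e_mat N j' i' - (1 / 2 * \<alpha>\<^sup>2) \<cdot>\<^sub>m e_mat N i i'"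
      unfolding root_elt_def Let_def N_def i'j' using j by simp
    show ?thesis
      unfolding r e_mat_def i'j' using ab ne True
      by (cases "a = i"; cases "a = j'"; cases "b = i'") simp_all
  next
    case False
    then have r: "root_elt T n i j \<alpha> = 1\<^sub>m N + \<alpha> \<cdot>\<^sub>m e_mat N i j - \<alpha> \<cdot>\<^sub>m e_mat N j' i'"
      unfolding root_elt_def Let_def N_def i'j' by (simp only: if_False)
    show ?thesis
      unfolding r e_mat_def i'j' using ab ne False
      by (cases "a = i"; cases "a = j'"; cases "b = i'") auto
  qed
qed

lemma root_elt_carrier: "root_elt T n i j \<alpha> \<in> carrier_mat (mat_size T n) (mat_size T n)"
  by (auto simp: root_elt_def Let_def e_mat_def)

text \<open>
  Multiplication by a root element from the left is a row operation: it adds multiples of row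
  \<open>j\<close> to row \<open>i\<close> and of row \<open>opp i\<close> to row \<open>opp j\<close>; for the short roots of type B also of row
  \<open>opp i\<close> to row \<open>i\<close>.
\<close>

lemma root_elt_mult_entry:
  assumes P: "(i, j) \<in> pos_set T n" and "a < mat_size T n" "b < mat_size T n"
    and B: "B \<in> carrier_mat (mat_size T n) (mat_size T n)"
  shows "(root_elt T n i j \<alpha> * B) $$ (a, b) =
    B $$ (a, b) + (if a = i then \<alpha> else 0) * B $$ (j, b)
     + (if a = opp T n j then - \<alpha> else 0) * B $$ (opp T n i, b)
     + (if a = i \<and> T = Type_B \<and> j = n then - (1 / 2 * \<alpha>\<^sup>2) else 0) * B $$ (opp T n i, b)"
proof -
  let ?N = "mat_size T n"
  note bd = pos_set_bounds[OF P]
  have "(root_elt T n i j \<alpha> * B) $$ (a, b) = (\<Sum>c<?N. root_elt T n i j \<alpha> $$ (a, c) * B $$ (c, b))"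
    using assms root_elt_carrier by (intro mult_mat_entry)
  also have "\<dots> = (\<Sum>c<?N. ((if a = c then 1 else 0) + (if c = j then if a = i then \<alpha> else 0 else 0)
     + (if c = opp T n i then if a = opp T n j then - \<alpha> else 0 else 0)
     + (if c = opp T n i then if a = i \<and> T = Type_B \<and> j = n then - (1 / 2 * \<alpha>\<^sup>2) else 0 else 0)) * B $$ (c, b))"
    using assms by (intro sum.cong refl) (simp only: root_elt_entry lessThan_iff)
  finally show ?thesis
    using bd assms(2) by (simp only: distrib_right sum.distrib sum_delta_mult mult_1_left)
qed

lemma root_elt_inverse:
  assumes P: "(i, j) \<in> pos_set T n" and two: "(2 :: 'q::field) \<noteq> 0"
  shows "root_elt T n i j \<alpha> * root_elt T n i j (- \<alpha>) = (1\<^sub>m (mat_size T n) :: 'q mat)"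
proof (rule eq_matI)
  let ?N = "mat_size T n"
  fix a b assume "a < dim_row (1\<^sub>m ?N :: 'q mat)" "b < dim_col (1\<^sub>m ?N :: 'q mat)"
  then have ab: "a < ?N" "b < ?N" by auto
  note bd = pos_set_bounds[OF P]
  \<comment> \<open>The column \<open>j\<close> is its own opposite exactly for the short roots of type B, where the quadratic term is needed.\<close>
  have mid: "j = opp T n j \<longleftrightarrow> T = Type_B \<and> j = n"
    using bd by (cases T) (auto simp: opp_def, presburger)
  obtain h where h1: "1 / 2 * \<alpha>\<^sup>2 = h" by blast
  then have h: "1 / 2 * \<alpha>\<^sup>2 = h" "1 / 2 * (- \<alpha>)\<^sup>2 = h" by simp_all
  have half: "\<alpha> * \<alpha> = h + h"
    using two unfolding h(1)[symmetric]
    by (simp add: power2_eq_square add_divide_distrib[symmetric] mult_2[symmetric])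
  obtain i' j' where i'j': "opp T n i = i'" "opp T n j = j'" by blast
  note E = root_elt_entry[OF P, unfolded i'j']
  have ne: "i' \<noteq> i" "i \<noteq> i'" "i' \<noteq> j" "j \<noteq> i'" "i' \<noteq> j'" "j' \<noteq> i'" "i \<noteq> j" "j \<noteq> i" "i \<noteq> j'" "j' \<noteq> i"
    and j: "j < ?N" and i': "i' < ?N"
    using bd i'j' by auto
  have "(root_elt T n i j \<alpha> * root_elt T n i j (- \<alpha>)) $$ (a, b) = (if a = b then 1 else 0)"
  proof (cases "a = i")
    case True
    show ?thesis
      unfolding root_elt_mult_entry[OF P ab root_elt_carrier] i'j' E[OF ab] E[OF j ab(2)] E[OF i' ab(2)]
        mid[unfolded i'j', symmetric] h
      using True ne half by (cases "j = j'") auto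
  next
    case False
    then show ?thesis
      unfolding root_elt_mult_entry[OF P ab root_elt_carrier] i'j' E[OF ab] E[OF i' ab(2)]
      using ne by auto
  qed
  then show "(root_elt T n i j \<alpha> * root_elt T n i j (- \<alpha>)) $$ (a, b) = (1\<^sub>m ?N :: 'q mat) $$ (a, b)"
    using ab by simp
qed (use root_elt_carrier[of T n i j \<alpha>] root_elt_carrier[of T n i j "- \<alpha>"] in auto)

lemma root_elt_uni_orth:
  assumes P: "(i, j) \<in> pos_set T n" and two: "(2 :: 'q::field) \<noteq> 0"
  shows "root_elt T n i j (\<alpha> :: 'q) \<in> uni_orth (mat_size T n)"
proof -
  let ?N = "mat_size T n"
  note bd = pos_set_bounds[OF P]
  have mid: "j = opp T n j" if "T = Type_B" "j = n" using that by (auto simp: opp_def)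
  have "flip_mat ?N (root_elt T n i j \<alpha>) = root_elt T n i j (- \<alpha>)"
  proof (rule eq_matI)
    fix a b assume "a < dim_row (root_elt T n i j (- \<alpha>))" "b < dim_col (root_elt T n i j (- \<alpha>))"
    then have ab: "a < ?N" "b < ?N" using root_elt_carrier[of T n i j "- \<alpha>"] by auto
    have ob: "opp T n b < ?N" "opp T n a < ?N" using ab by (auto simp: opp_def)
    have e: "opp T n b = opp T n a \<longleftrightarrow> a = b" "opp T n b = i \<longleftrightarrow> b = opp T n i"
      "opp T n a = j \<longleftrightarrow> a = opp T n j" "opp T n b = opp T n j \<longleftrightarrow> b = j" "opp T n a = opp T n i \<longleftrightarrow> a = i"
      using ab bd by (auto simp: opp_def)
    have "flip_mat ?N (root_elt T n i j \<alpha>) $$ (a, b) = root_elt T n i j \<alpha> $$ (opp T n b, opp T n a)"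
      using ab by (simp add: flip_mat_index opp_def)
    also have "\<dots> = root_elt T n i j (- \<alpha>) $$ (a, b)"
      using mid unfolding root_elt_entry[OF P ob] root_elt_entry[OF P ab] e by auto
    finally show "flip_mat ?N (root_elt T n i j \<alpha>) $$ (a, b) = root_elt T n i j (- \<alpha>) $$ (a, b)" .
  qed (use root_elt_carrier[of T n i j "- \<alpha>"] in \<open>auto simp: flip_mat_def\<close>)
  then show ?thesis
    using root_elt_inverse[OF P two, of \<alpha>] root_elt_inverse[OF P two, of "- \<alpha>"] root_elt_carrier[of T n i j \<alpha>] bd two
    unfolding uni_orth_def by (auto simp: root_elt_entry[OF P])
qed

lemma unip_group_generators:
  assumes "(2 :: 'q::field) \<noteq> 0"
  shows "{root_elt T n i j (\<alpha> :: 'q) | i j \<alpha>. (i, j) \<in> pos_set T n} \<subseteq> uni_orth (mat_size T n)"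
  using root_elt_uni_orth assms by blast

lemma unip_group_mult [simp]: "x \<otimes>\<^bsub>unip_group T n\<^esub> y = x * y"
  by (simp add: unip_group_def)

lemma unip_group_one [simp]: "\<one>\<^bsub>unip_group T n\<^esub> = 1\<^sub>m (mat_size T n)"
  by (simp add: unip_group_def)

lemma unip_group_facts:
  assumes two: "(2 :: 'q::field) \<noteq> 0"
  shows unip_group_group: "group (unip_group T n :: 'q mat monoid)"
    and unip_group_subset: "carrier (unip_group T n :: 'q mat monoid) \<subseteq> uni_orth (mat_size T n)"
    and unip_group_root: "(i, j) \<in> pos_set T n \<Longrightarrow> root_elt T n i j (\<alpha> :: 'q) \<in> carrier (unip_group T n)"
    and unip_group_inv: "u \<in> carrier (unip_group T n :: 'q mat monoid) \<Longrightarrow>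
      inv\<^bsub>unip_group T n\<^esub> u = flip_mat (mat_size T n) u"
proof -
  interpret G: group "GL_mat (mat_size T n) :: 'q mat monoid" by (rule GL_mat_group)
  let ?R = "{root_elt T n i j (\<alpha> :: 'q) | i j \<alpha>. (i, j) \<in> pos_set T n}"
  have R: "?R \<subseteq> carrier (GL_mat (mat_size T n))"
    by (rule order_trans[OF unip_group_generators[OF two] subgroup.subset[OF uni_orth_subgroup]])
  have s: "subgroup (generate (GL_mat (mat_size T n)) ?R) (GL_mat (mat_size T n))"
    using R by (rule G.generate_is_subgroup)
  show "group (unip_group T n :: 'q mat monoid)"
    unfolding unip_group_def by (rule subgroup.subgroup_is_group[OF s G.group_axioms])
  show sub: "carrier (unip_group T n :: 'q mat monoid) \<subseteq> uni_orth (mat_size T n)"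
    using G.generate_subgroup_incl[OF unip_group_generators[OF two] uni_orth_subgroup]
    by (simp only: unip_group_def partial_object.select_convs partial_object.surjective
      partial_object.update_convs) simp
  show "(i, j) \<in> pos_set T n \<Longrightarrow> root_elt T n i j (\<alpha> :: 'q) \<in> carrier (unip_group T n)"
    unfolding unip_group_def by (auto intro: generate.incl)
  show "inv\<^bsub>unip_group T n\<^esub> u = flip_mat (mat_size T n) u" if "u \<in> carrier (unip_group T n)" for u :: "'q mat"
  proof -
    have "inv\<^bsub>unip_group T n\<^esub> u = inv\<^bsub>GL_mat (mat_size T n)\<^esub> u"
      unfolding unip_group_def using that s by (intro G.m_inv_consistent) (auto simp: unip_group_def)
    then show ?thesis using that sub GL_mat_inv by auto
  qed
qed

section \<open>The monomial action\<close>

locale orth_char =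
  fixes T :: orth_type and n :: nat and \<theta> :: "'q::{field,finite} \<Rightarrow> complex"
  assumes two: "(2 :: 'q) \<noteq> 0" and theta: "nontrivial_add_char \<theta>"
begin

abbreviation N :: nat where "N \<equiv> mat_size T n"
abbreviation bar :: "nat \<Rightarrow> nat" where "bar \<equiv> opp T n"
abbreviation U :: "'q mat set" where "U \<equiv> carrier (unip_group T n)"
abbreviation V :: "'q mat set" where "V \<equiv> pos_space T n"
abbreviation ui :: "'q mat \<Rightarrow> 'q mat" where "ui \<equiv> flip_mat N"

lemma U_carrier: "u \<in> U \<Longrightarrow> u \<in> carrier_mat N N"
  and U_diag: "u \<in> U \<Longrightarrow> a < N \<Longrightarrow> u $$ (a, a) = 1"
  and U_lower: "u \<in> U \<Longrightarrow> a < N \<Longrightarrow> b < a \<Longrightarrow> u $$ (a, b) = 0"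
  and U_ui_right: "u \<in> U \<Longrightarrow> u * ui u = 1\<^sub>m N"
  and U_ui_left: "u \<in> U \<Longrightarrow> ui u * u = 1\<^sub>m N"
  using unip_group_subset[OF two, of T n] by (auto simp: uni_orth_def)

lemma U_group: "group (unip_group T n :: 'q mat monoid)"
  by (rule unip_group_group[OF two])

lemma U_mult: "u \<in> U \<Longrightarrow> v \<in> U \<Longrightarrow> u * v \<in> U"
  using group.is_monoid[OF U_group] monoid.m_closed by fastforce

lemma U_one: "1\<^sub>m N \<in> U"
  using group.is_monoid[OF U_group] monoid.one_closed by fastforce

lemma U_inv: "u \<in> U \<Longrightarrow> inv\<^bsub>unip_group T n\<^esub> u = ui u"
  by (rule unip_group_inv[OF two])

lemma U_ui: "u \<in> U \<Longrightarrow> ui u \<in> U"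
  using group.inv_closed[OF U_group] U_inv by metis

lemma ui_ui: "u \<in> U \<Longrightarrow> ui (ui u) = u"
  using flip_flip U_carrier by blast

lemma ui_mult: "u \<in> U \<Longrightarrow> v \<in> U \<Longrightarrow> ui (u * v) = ui v * ui u"
  using flip_mult U_carrier by blast

lemma U_assoc: "u \<in> U \<Longrightarrow> v \<in> U \<Longrightarrow> w \<in> U \<Longrightarrow> u * v * w = u * (v * w)"
  using assoc_mult_mat U_carrier by blast

lemma U_cancel: "u \<in> U \<Longrightarrow> v \<in> U \<Longrightarrow> u * v * ui v = u" "u \<in> U \<Longrightarrow> v \<in> U \<Longrightarrow> u * ui v * v = u"
  using U_carrier[of u] by (simp_all add: U_assoc U_ui U_ui_right U_ui_left right_mult_one_mat[of _ N N])

lemma finite_mats: "finite (carrier_mat N N :: 'q mat set)"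
proof -
  have "carrier_mat N N \<subseteq> (\<lambda>f. mat N N (\<lambda>x. f x)) ` (({..<N} \<times> {..<N}) \<rightarrow>\<^sub>E (UNIV :: 'q set))"
  proof
    fix A :: "'q mat" assume A: "A \<in> carrier_mat N N"
    have "A = mat N N (\<lambda>x. restrict (\<lambda>x. A $$ x) ({..<N} \<times> {..<N}) x)"
      using A by (intro eq_matI) auto
    then show "A \<in> (\<lambda>f. mat N N (\<lambda>x. f x)) ` (({..<N} \<times> {..<N}) \<rightarrow>\<^sub>E UNIV)"
      by (intro image_eqI[where x = "restrict (\<lambda>x. A $$ x) ({..<N} \<times> {..<N})"]) auto
  qed
  then show ?thesis by (rule finite_subset) (intro finite_imageI finite_PiE, auto)
qed

lemma finite_U: "finite U"
  using finite_subset[OF _ finite_mats] U_carrier by blast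

lemma finite_V: "finite V"
  using finite_subset[OF _ finite_mats] by (auto simp: pos_space_def)

lemma bar_bar: "i < N \<Longrightarrow> bar (bar i) = i"
  by (auto simp: opp_def)

lemma N_bounds: "2 * n \<le> N" "N \<le> 2 * n + 1"
  by (cases T; simp)+

lemma pos_iff: "(i, j) \<in> pos_set T n \<longleftrightarrow> i < j \<and> j < bar i"
  by (simp add: pos_set_def)

lemma V_carrier: "A \<in> V \<Longrightarrow> A \<in> carrier_mat N N"
  by (simp add: pos_space_def)

lemma V_zero: "A \<in> V \<Longrightarrow> i < N \<Longrightarrow> j < N \<Longrightarrow> \<not> (i < j \<and> j < bar i) \<Longrightarrow> A $$ (i, j) = 0"
  by (simp add: pos_space_def pos_iff)

lemma V_eqI:
  assumes "A \<in> V" "B \<in> V" "\<And>i j. i < n \<Longrightarrow> i < j \<Longrightarrow> j < bar i \<Longrightarrow> A $$ (i, j) = B $$ (i, j)"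
  shows "A = B"
proof (rule eq_matI)
  fix i j assume "i < dim_row B" "j < dim_col B"
  then have ij: "i < N" "j < N" using V_carrier[OF assms(2)] by auto
  show "A $$ (i, j) = B $$ (i, j)"
  proof (cases "i < j \<and> j < bar i")
    case True
    then have "i < n" using N_bounds by (auto simp: opp_def)
    with True assms(3) show ?thesis by blast
  next
    case False
    then show ?thesis using V_zero[OF assms(1) ij] V_zero[OF assms(2) ij] by simp
  qed
qed (use V_carrier[OF assms(1)] V_carrier[OF assms(2)] in auto)

abbreviation act :: "'q mat \<Rightarrow> 'q mat \<Rightarrow> 'q mat" where "act \<equiv> mat_act T n"

text \<open>
  The entry of \<open>A * transpose (inv g)\<close>, without the projection. For \<open>b = i\<close> it is the
  contribution of row \<open>i\<close> to the cocycle, so that both the action and the cocycle are read off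
  row by row.
\<close>

definition row_act :: "'q mat \<Rightarrow> 'q mat \<Rightarrow> nat \<Rightarrow> nat \<Rightarrow> 'q" where
  "row_act A g i b = (\<Sum>c<N. A $$ (i, c) * ui g $$ (b, c))"

lemma act_entry:
  assumes "A \<in> V" "g \<in> U" "i < N" "j < N"
  shows "act A g $$ (i, j) = (if i < j \<and> j < bar i then row_act A g i j else 0)"
proof -
  have "(A * (ui g)\<^sup>T) $$ (i, j) = (\<Sum>c<N. A $$ (i, c) * (ui g)\<^sup>T $$ (c, j))"
    using assms V_carrier[OF assms(1)] by (intro mult_mat_entry) auto
  also have "\<dots> = row_act A g i j"
    unfolding row_act_def using assms by (intro sum.cong) auto
  finally show ?thesis
    using assms by (simp add: mat_act_def proj_pos_def U_inv pos_iff del: index_mult_mat)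
qed

lemma act_V: "A \<in> V \<Longrightarrow> g \<in> U \<Longrightarrow> act A g \<in> V"
  by (auto simp: pos_space_def mat_act_def proj_pos_def)

definition coc :: "'q mat \<Rightarrow> 'q mat \<Rightarrow> complex" where
  "coc A g = \<theta> (kappa (- A) (proj_pos T n (inv\<^bsub>unip_group T n\<^esub> g)))"

lemma kappa_entry:
  assumes "A \<in> carrier_mat N N" "B \<in> carrier_mat N N"
  shows "kappa A B = (\<Sum>i<N. \<Sum>j<N. A $$ (i, j) * B $$ (i, j))"
proof -
  have "kappa A B = (\<Sum>j<N. (A\<^sup>T * B) $$ (j, j))"
    using assms by (simp add: kappa_def mat_tr_def del: index_mult_mat(1))
  also have "\<dots> = (\<Sum>j<N. \<Sum>i<N. A\<^sup>T $$ (j, i) * B $$ (i, j))"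
    using assms by (intro sum.cong refl mult_mat_entry) auto
  also have "\<dots> = (\<Sum>j<N. \<Sum>i<N. A $$ (i, j) * B $$ (i, j))"
    using assms by (intro sum.cong refl) auto
  finally show ?thesis by (subst sum.swap)
qed

lemma coc_eq:
  assumes "A \<in> V" "g \<in> U"
  shows "coc A g = \<theta> (- (\<Sum>i<N. row_act A g i i))"
proof -
  have "kappa (- A) (proj_pos T n (ui g)) = (\<Sum>i<N. \<Sum>j<N. (- A) $$ (i, j) * proj_pos T n (ui g) $$ (i, j))"
    using assms V_carrier[OF assms(1)] by (intro kappa_entry) (auto simp: proj_pos_def)
  also have "\<dots> = (\<Sum>i<N. \<Sum>j<N. - (A $$ (i, j) * ui g $$ (i, j)))"
    using V_carrier[OF assms(1)] V_zero[OF assms(1)]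
    by (intro sum.cong refl) (auto simp: proj_pos_def pos_iff)
  also have "\<dots> = - (\<Sum>i<N. row_act A g i i)"
    by (simp add: row_act_def sum_negf)
  finally show ?thesis by (simp add: coc_def U_inv assms)
qed

lemma row_act_mult:
  assumes "A \<in> V" "g \<in> U" "h \<in> U" "j < N"
  shows "row_act A (g * h) i j = (\<Sum>b<N. ui h $$ (j, b) * row_act A g i b)"
proof -
  have "row_act A (g * h) i j = (\<Sum>c<N. A $$ (i, c) * (\<Sum>b<N. ui h $$ (j, b) * ui g $$ (b, c)))"
    unfolding row_act_def using assms
    by (intro sum.cong refl arg_cong2[of _ _ _ _ "(*)"]) (auto simp: ui_mult mult_mat_entry[where N = N] simp del: index_mult_mat)
  also have "\<dots> = (\<Sum>c<N. \<Sum>b<N. ui h $$ (j, b) * (A $$ (i, c) * ui g $$ (b, c)))"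
    by (simp add: sum_distrib_left mult.left_commute)
  also have "\<dots> = (\<Sum>b<N. \<Sum>c<N. ui h $$ (j, b) * (A $$ (i, c) * ui g $$ (b, c)))"
    by (rule sum.swap)
  finally show ?thesis by (simp add: row_act_def sum_distrib_left)
qed

text \<open>
  The action adds columns of \<open>A\<close> only to columns further left, so nothing appears to the right
  of the positions in \<open>pos_set\<close>.
\<close>

lemma row_act_zero:
  assumes "A \<in> V" "g \<in> U" "i < N" "b < N" "bar i \<le> b"
  shows "row_act A g i b = 0"
  unfolding row_act_def
proof (rule sum.neutral, rule ballI)
  fix c assume "c \<in> {..<N}"
  then show "A $$ (i, c) * ui g $$ (b, c) = 0"
    using assms V_zero[OF assms(1,3), of c] U_lower[OF U_ui[OF assms(2)], of b c] by (cases "c < b") auto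
qed

text \<open>
  The entries removed by the projection lie in columns \<open>b \<le> i\<close>, and these do not contribute to
  later columns \<open>j > i\<close>.
\<close>

lemma act_act:
  assumes "A \<in> V" "g \<in> U" "h \<in> U"
  shows "act (act A g) h = act A (g * h)"
proof (rule V_eqI)
  fix i j assume ij: "i < n" "i < j" "j < bar i"
  then have N: "i < N" "j < N" using N_bounds by (auto simp: opp_def)
  have "row_act (act A g) h i j = (\<Sum>b<N. ui h $$ (j, b) * row_act A g i b)"
    unfolding row_act_def[of "act A g"]
  proof (intro sum.cong refl)
    fix b assume "b \<in> {..<N}"
    then have b: "b < N" by simp
    consider "b \<le> i" | "bar i \<le> b" | "i < b" "b < bar i" by linarith
    then show "act A g $$ (i, b) * ui h $$ (j, b) = ui h $$ (j, b) * row_act A g i b"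
    proof cases
      case 1
      then have "ui h $$ (j, b) = 0" using U_lower[OF U_ui[OF assms(3)] N(2)] ij by simp
      then show ?thesis by simp
    next
      case 2
      then show ?thesis using row_act_zero[OF assms(1,2) N(1) b] assms N b by (simp add: act_entry)
    qed (use assms N b in \<open>simp add: act_entry\<close>)
  qed
  then show "act (act A g) h $$ (i, j) = act A (g * h) $$ (i, j)"
    using assms ij N by (simp add: act_entry act_V U_mult row_act_mult)
qed (use assms act_V U_mult in auto)

lemma act_one: "A \<in> V \<Longrightarrow> act A (1\<^sub>m N) = A"
proof (rule V_eqI)
  fix i j assume A: "A \<in> V" and ij: "i < n" "i < j" "j < bar i"
  then have N: "i < N" "j < N" using N_bounds by (auto simp: opp_def)
  have "row_act A (1\<^sub>m N) i j = (\<Sum>c<N. (if j = c then 1 else 0) * A $$ (i, c))"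
    unfolding row_act_def flip_one using N by (intro sum.cong) auto
  then show "act A (1\<^sub>m N) $$ (i, j) = A $$ (i, j)"
    using A U_one ij N by (simp add: act_entry sum_delta_mult)
qed (use act_V U_one in auto)

lemma theta_add: "\<theta> (x + y) = \<theta> x * \<theta> y"
  and theta_nz: "\<theta> x \<noteq> 0"
  using theta by (auto simp: nontrivial_add_char_def)

lemma theta_0: "\<theta> 0 = 1"
  using theta_add[of 0 0] theta_nz[of 0] by simp

lemma theta_minus: "\<theta> (- x) = inverse (\<theta> x)"
  using theta_add[of x "- x"] theta_nz[of x] by (simp add: theta_0 field_simps)

text \<open>
  Of the entries removed by the projection only those on the diagonal contribute to the trace
  form, and they add up to the exponent of \<open>coc A g\<close>.
\<close>

lemma coc_mult:
  assumes "A \<in> V" "g \<in> U" "h \<in> U"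
  shows "coc A (g * h) = coc A g * coc (act A g) h"
proof -
  have "(\<Sum>i<N. row_act A (g * h) i i) = (\<Sum>i<N. \<Sum>b<N. ui h $$ (i, b) * row_act A g i b)"
    using assms by (intro sum.cong refl row_act_mult) auto
  also have "\<dots> = (\<Sum>i<N. \<Sum>b<N. (if b = i then row_act A g i i else 0) + act A g $$ (i, b) * ui h $$ (i, b))"
  proof (intro sum.cong refl)
    fix i b assume "i \<in> {..<N}" "b \<in> {..<N}"
    then have N: "i < N" "b < N" by auto
    consider "b < i" | "b = i" | "i < b" "bar i \<le> b" | "i < b" "b < bar i" by linarith
    then show "ui h $$ (i, b) * row_act A g i b = (if b = i then row_act A g i i else 0) + act A g $$ (i, b) * ui h $$ (i, b)"
    proof cases
      case 1
      then show ?thesis using U_lower[OF U_ui[OF assms(3)] N(1)] by simp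
    next
      case 2
      then show ?thesis using U_diag[OF U_ui[OF assms(3)] N(1)] assms N by (simp add: act_entry)
    next
      case 3
      then show ?thesis using row_act_zero[OF assms(1,2) N] assms N by (simp add: act_entry)
    qed (use assms N in \<open>simp add: act_entry\<close>)
  qed
  also have "\<dots> = (\<Sum>i<N. row_act A g i i) + (\<Sum>i<N. row_act (act A g) h i i)"
    by (simp add: sum.distrib row_act_def)
  finally show ?thesis
    using assms by (simp add: coc_eq act_V U_mult theta_add[symmetric])
qed

lemma coc_nz: "coc A g \<noteq> 0"
  by (simp add: coc_def theta_nz)

lemma coc_one: "A \<in> V \<Longrightarrow> coc A (1\<^sub>m N) = 1"
  using coc_mult[of A "1\<^sub>m N" "1\<^sub>m N"] coc_nz[of A "1\<^sub>m N"] by (simp add: U_one act_one)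

definition Stab :: "'q mat \<Rightarrow> 'q mat set" where
  "Stab A = {u \<in> U. act A u = A}"

lemma act_inv: "A \<in> V \<Longrightarrow> g \<in> U \<Longrightarrow> act (act A g) (ui g) = A" "A \<in> V \<Longrightarrow> g \<in> U \<Longrightarrow> act (act A (ui g)) g = A"
  by (simp_all add: act_act U_ui U_ui_right U_ui_left act_one)

lemma act_bij: "g \<in> U \<Longrightarrow> bij_betw (\<lambda>A. act A g) V V"
  by (rule bij_betwI[where g = "\<lambda>A. act A (ui g)"]) (auto simp: act_inv act_V U_ui)

lemma subgroupI_U:
  assumes "H \<subseteq> U" "1\<^sub>m N \<in> H" "\<And>u v. u \<in> H \<Longrightarrow> v \<in> H \<Longrightarrow> u * v \<in> H" "\<And>u. u \<in> H \<Longrightarrow> ui u \<in> H"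
  shows "subgroup H (unip_group T n)"
proof -
  interpret G: group "unip_group T n :: 'q mat monoid" by (rule U_group)
  show ?thesis using assms by (intro G.subgroupI) (auto simp: U_inv subset_iff)
qed

lemma Stab_mult: "A \<in> V \<Longrightarrow> u \<in> Stab A \<Longrightarrow> v \<in> Stab A \<Longrightarrow> u * v \<in> Stab A"
  by (auto simp: Stab_def U_mult act_act[symmetric])

lemma Stab_ui: "A \<in> V \<Longrightarrow> u \<in> Stab A \<Longrightarrow> ui u \<in> Stab A"
  using act_inv by (fastforce simp: Stab_def U_ui)

lemma Stab_subgroup: "A \<in> V \<Longrightarrow> subgroup (Stab A) (unip_group T n)"
  by (rule subgroupI_U) (auto simp: Stab_mult Stab_ui, auto simp: Stab_def U_one act_one)

lemma coc_Stab: "A \<in> V \<Longrightarrow> u \<in> Stab A \<Longrightarrow> v \<in> U \<Longrightarrow> coc A (u * v) = coc A u * coc A v"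
  by (auto simp: Stab_def coc_mult)

text \<open>
  A product of root elements with the common first index \<open>p\<close>. Outside of row \<open>p\<close> the product is
  the identity with column \<open>bar p\<close> prescribed arbitrarily. Row \<open>p\<close> is then determined by
  orthogonality up to the corner.
\<close>

lemma column_element:
  assumes p: "p < n"
  shows "\<exists>g\<in>U. \<forall>a<N. a \<noteq> p \<longrightarrow> (\<forall>b<N. g $$ (a, b) =
    (if a = b then 1 else 0) + (if b = bar p \<and> p < a \<and> a < bar p then w a else 0))"
proof -
  have "\<exists>g\<in>U. \<forall>a<N. a \<noteq> p \<longrightarrow> (\<forall>b<N. g $$ (a, b) =
      (if a = b then 1 else 0) + (if b = bar p \<and> a \<in> D then w a else 0))"
    if "finite D" "D \<subseteq> {p<..<bar p}" for D
    using that
  proof (induction D rule: finite_induct)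
    case empty
    show ?case by (rule bexI[OF _ U_one]) auto
  next
    case (insert a0 D)
    then obtain g where g: "g \<in> U" and ge: "\<And>a b. a < N \<Longrightarrow> a \<noteq> p \<Longrightarrow> b < N \<Longrightarrow> g $$ (a, b) =
      (if a = b then 1 else 0) + (if b = bar p \<and> a \<in> D then w a else 0)" by auto
    have a0: "p < a0" "a0 < bar p" using insert by auto
    then have P: "(p, bar a0) \<in> pos_set T n" and bb: "bar (bar a0) = a0" "a0 < N"
      using p N_bounds by (auto simp: pos_iff opp_def)
    note bd = pos_set_bounds[OF P]
    let ?x = "root_elt T n p (bar a0) (- w a0)"
    have xU: "?x \<in> U" by (rule unip_group_root[OF two P])
    have D: "bar p \<notin> D" using insert by auto
    have "(?x * g) $$ (a, b) = (if a = b then 1 else 0) + (if b = bar p \<and> a \<in> insert a0 D then w a else 0)"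
      if ab: "a < N" "a \<noteq> p" "b < N" for a b
      unfolding root_elt_mult_entry[OF P ab(1,3) U_carrier[OF g]] bb(1)
      using ab insert(2) a0 D bd by (auto simp: ge)
    then show ?case using U_mult[OF xU g] by blast
  qed
  from this[of "{p<..<bar p}"] show ?thesis by simp
qed

end

section \<open>Modules over a group algebra\<close>

locale group_rep =
  fixes G :: "'g monoid" and M :: "('v::ab_group_add, 'g) rmodule"
  assumes gm: "group_rmodule G M"
begin

sublocale vector_space "rscale M"
  using gm by (simp add: group_rmodule_def)

lemma space: "subspace (rspace M)"
  and act_closed: "g \<in> carrier G \<Longrightarrow> v \<in> rspace M \<Longrightarrow> ract M v g \<in> rspace M"
  and act_add: "g \<in> carrier G \<Longrightarrow> v \<in> rspace M \<Longrightarrow> w \<in> rspace M \<Longrightarrow> ract M (v + w) g = ract M v g + ract M w g"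
  and act_scale: "g \<in> carrier G \<Longrightarrow> v \<in> rspace M \<Longrightarrow> ract M (rscale M c v) g = rscale M c (ract M v g)"
  and act_mult: "g \<in> carrier G \<Longrightarrow> h \<in> carrier G \<Longrightarrow> v \<in> rspace M \<Longrightarrow> ract M v (g \<otimes>\<^bsub>G\<^esub> h) = ract M (ract M v g) h"
  and act_one: "v \<in> rspace M \<Longrightarrow> ract M v \<one>\<^bsub>G\<^esub> = v"
  using gm by (auto simp: group_rmodule_def)

lemma act_zero: "g \<in> carrier G \<Longrightarrow> ract M 0 g = 0"
  using act_add[of g 0 0] subspace_0[OF space] by simp

lemma act_sum:
  assumes "g \<in> carrier G" "\<And>i. i \<in> I \<Longrightarrow> f i \<in> rspace M"
  shows "ract M (\<Sum>i\<in>I. f i) g = (\<Sum>i\<in>I. ract M (f i) g)"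
  using assms(2)
proof (induction I rule: infinite_finite_induct)
  case (insert i I)
  then show ?case
    using act_add[OF assms(1), of "f i" "sum f I"] subspace_sum[OF space, of I f] by simp
qed (simp_all add: act_zero assms(1))

text \<open>
  Up to a factor this is the projection onto the \<open>\<chi>\<close>-isotypic part for a linear character \<open>\<chi>\<close>
  of \<open>H\<close>; it may vanish.
\<close>

lemma eigen_average:
  assumes H: "subgroup H G" and lm: "\<And>g h. g \<in> H \<Longrightarrow> h \<in> H \<Longrightarrow> \<chi> (g \<otimes>\<^bsub>G\<^esub> h) = \<chi> g * \<chi> h"
    and nz: "\<And>g. g \<in> H \<Longrightarrow> \<chi> g \<noteq> 0" and w: "w \<in> rspace M"
  defines "av \<equiv> \<Sum>h\<in>H. rscale M (inverse (\<chi> h)) (ract M w h)"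
  shows "av \<in> rspace M" "\<And>g. g \<in> H \<Longrightarrow> ract M av g = rscale M (\<chi> g) av"
proof -
  interpret G: group G using gm by (simp add: group_rmodule_def)
  have HG: "h \<in> carrier G" if "h \<in> H" for h using that subgroup.mem_carrier[OF H] by blast
  have t: "rscale M (inverse (\<chi> h)) (ract M w h) \<in> rspace M" if "h \<in> H" for h
    using that HG act_closed w subspace_scale[OF space] by blast
  show "av \<in> rspace M" unfolding av_def using t by (intro subspace_sum[OF space]) auto
  fix g assume g: "g \<in> H"
  have "ract M av g = (\<Sum>h\<in>H. ract M (rscale M (inverse (\<chi> h)) (ract M w h)) g)"
    unfolding av_def by (rule act_sum) (use g HG t in auto)
  also have "\<dots> = (\<Sum>h\<in>H. rscale M (\<chi> g) (rscale M (inverse (\<chi> (h \<otimes>\<^bsub>G\<^esub> g))) (ract M w (h \<otimes>\<^bsub>G\<^esub> g))))"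
    using g HG w by (intro sum.cong refl) (simp add: act_scale act_closed act_mult lm nz)
  also have "\<dots> = (\<Sum>h\<in>H. rscale M (\<chi> g) (rscale M (inverse (\<chi> h)) (ract M w h)))"
  proof (rule sum.reindex_bij_betw)
    show "bij_betw (\<lambda>h. h \<otimes>\<^bsub>G\<^esub> g) H H"
      using g HG subgroup.m_closed[OF H] subgroup.m_inv_closed[OF H]
      by (intro bij_betwI[where g = "\<lambda>h. h \<otimes>\<^bsub>G\<^esub> inv\<^bsub>G\<^esub> g"]) (auto simp: G.m_assoc)
  qed
  also have "\<dots> = rscale M (\<chi> g) av"
    by (simp add: av_def scale_sum_right)
  finally show "ract M av g = rscale M (\<chi> g) av" .
qed

lemma group_rmodule_submodule:
  "submodule_space G M W \<Longrightarrow> group_rmodule G (M\<lparr>rspace := W\<rparr>)"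
  using gm unfolding group_rmodule_def submodule_space_def by (auto simp: subset_iff)

end

lemma rmodule_hom_sum:
  assumes f: "f \<in> rmodule_hom G M M'" and M: "group_rmodule G M" and M': "group_rmodule G M'"
    and x: "\<And>i. i \<in> I \<Longrightarrow> x i \<in> rspace M"
  shows "f (\<Sum>i\<in>I. x i) = (\<Sum>i\<in>I. f (x i))"
proof -
  interpret M: group_rep G M by unfold_locales (rule M)
  have f0: "f 0 = 0"
  proof -
    have "f (0 + 0) = f 0 + f 0" using f M.subspace_0[OF M.space] unfolding rmodule_hom_def by blast
    then show ?thesis by simp
  qed
  show ?thesis using x
  proof (induction I rule: infinite_finite_induct)
    case (insert i I)
    have "f (x i + sum x I) = f (x i) + f (sum x I)"
      using f insert M.subspace_sum[OF M.space, of I x] unfolding rmodule_hom_def by blast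
    with insert show ?case by simp
  qed (simp_all add: f0)
qed

lemma rmodule_isomorphic_refl: "rmodule_isomorphic G M M"
  unfolding rmodule_isomorphic_def rmodule_hom_def
  by (intro bexI[of _ id]) auto

lemma rmodule_isomorphic_trans:
  assumes "rmodule_isomorphic G M M'" "rmodule_isomorphic G M' M''"
  shows "rmodule_isomorphic G M M''"
proof -
  obtain f g where f: "f \<in> rmodule_hom G M M'" "bij_betw f (rspace M) (rspace M')"
    and g: "g \<in> rmodule_hom G M' M''" "bij_betw g (rspace M') (rspace M'')"
    using assms unfolding rmodule_isomorphic_def by blast
  have "g \<circ> f \<in> rmodule_hom G M M''"
    using f(1) g(1) unfolding rmodule_hom_def by (auto simp: Pi_iff)
  then show ?thesis
    using bij_betw_trans[OF f(2) g(2)] unfolding rmodule_isomorphic_def by blast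
qed

lemma rmodule_isomorphic_sym:
  assumes M: "group_rmodule G M" and iso: "rmodule_isomorphic G M M'"
  shows "rmodule_isomorphic G M' M"
proof -
  interpret M: group_rep G M by unfold_locales (rule M)
  obtain f where f: "f \<in> rmodule_hom G M M'" and b: "bij_betw f (rspace M) (rspace M')"
    using iso unfolding rmodule_isomorphic_def by blast
  define g where "g = the_inv_into (rspace M) f"
  have inj: "inj_on f (rspace M)" and im: "f ` rspace M = rspace M'" using b by (auto simp: bij_betw_def)
  have gf: "g (f v) = v" if "v \<in> rspace M" for v
    using that inj by (simp add: g_def the_inv_into_f_f)
  have hom: "f (v + w) = f v + f w" "f (rscale M c v) = rscale M' c (f v)" 
    if "v \<in> rspace M" "w \<in> rspace M" for v w c
    using f that unfolding rmodule_hom_def by auto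
  have homa: "f (ract M v x) = ract M' (f v) x" if "v \<in> rspace M" "x \<in> carrier G" for v x
    using f that unfolding rmodule_hom_def by auto
  have "g \<in> rmodule_hom G M' M"
    unfolding rmodule_hom_def im[symmetric]
    using M.subspace_add[OF M.space] M.subspace_scale[OF M.space] M.act_closed
    by (auto simp: gf hom[symmetric] homa[symmetric])
  moreover have "bij_betw g (rspace M') (rspace M)"
    unfolding g_def by (rule bij_betw_the_inv_into[OF b])
  ultimately show ?thesis unfolding rmodule_isomorphic_def by blast
qed

interpretation fun_vs: vector_space "fun_scale :: complex \<Rightarrow> ('x \<Rightarrow> complex) \<Rightarrow> 'x \<Rightarrow> complex"
  by unfold_locales (auto simp: fun_scale_def fun_eq_iff algebra_simps)

lemma sum_fun_apply: "(\<Sum>i\<in>I. f i) x = (\<Sum>i\<in>I. f i x)" for f :: "'i \<Rightarrow> 'x \<Rightarrow> complex"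
  by (induction I rule: infinite_finite_induct) auto

lemma supported_subspace: "module.subspace fun_scale {\<phi> :: 'x \<Rightarrow> complex. \<forall>\<psi>. \<psi> \<notin> X \<longrightarrow> \<phi> \<psi> = 0}"
  by (rule fun_vs.subspaceI) (auto simp: fun_scale_def)

lemma span_basis_vec:
  assumes "finite (X :: 'x set)"
  shows "module.span fun_scale (basis_vec ` X) = {\<phi>. \<forall>\<psi>. \<psi> \<notin> X \<longrightarrow> \<phi> \<psi> = 0}"
proof (rule subset_antisym)
  show "module.span fun_scale (basis_vec ` X) \<subseteq> {\<phi>. \<forall>\<psi>. \<psi> \<notin> X \<longrightarrow> \<phi> \<psi> = 0}"
    by (rule fun_vs.span_minimal[OF _ supported_subspace]) (auto simp: basis_vec_def)
  show "{\<phi>. \<forall>\<psi>. \<psi> \<notin> X \<longrightarrow> \<phi> \<psi> = 0} \<subseteq> module.span fun_scale (basis_vec ` X)"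
  proof
    fix \<phi> :: "'x \<Rightarrow> complex" assume \<phi>: "\<phi> \<in> {\<phi>. \<forall>\<psi>. \<psi> \<notin> X \<longrightarrow> \<phi> \<psi> = 0}"
    have "\<phi> = (\<Sum>\<chi>\<in>X. fun_scale (\<phi> \<chi>) (basis_vec \<chi>))"
    proof
      fix \<psi>
      have "(\<Sum>\<chi>\<in>X. fun_scale (\<phi> \<chi>) (basis_vec \<chi>)) \<psi> = (\<Sum>\<chi>\<in>X. if \<psi> = \<chi> then \<phi> \<chi> else 0)"
        unfolding sum_fun_apply by (intro sum.cong) (auto simp: fun_scale_def basis_vec_def)
      then show "\<phi> \<psi> = (\<Sum>\<chi>\<in>X. fun_scale (\<phi> \<chi>) (basis_vec \<chi>)) \<psi>"
        using assms \<phi> by auto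
    qed
    also have "\<dots> \<in> module.span fun_scale (basis_vec ` X)"
      by (intro fun_vs.span_sum fun_vs.span_scale fun_vs.span_base) auto
    finally show "\<phi> \<in> module.span fun_scale (basis_vec ` X)" .
  qed
qed

section \<open>Orbit modules\<close>

context orth_char
begin

abbreviation chi :: "'q mat \<Rightarrow> 'q mat \<Rightarrow> complex" where "chi \<equiv> lin_char \<theta> T n"

text \<open>
  The multiples of a nonzero \<open>d\<close> are all elements of the field, and \<open>\<theta>\<close> is nontrivial.
\<close>

lemma theta_trivial: "d = 0" if "\<And>x. \<theta> (d * x) = 1"
proof (rule ccontr)
  assume d: "d \<noteq> 0"
  obtain x where x: "\<theta> x \<noteq> 1" using theta by (auto simp: nontrivial_add_char_def)
  with that[of "x / d"] d show False by simp
qed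

lemma chi_inj: "inj_on chi V"
proof (rule inj_onI)
  fix A B assume AB: "A \<in> V" "B \<in> V" "chi A = chi B"
  show "A = B"
  proof (rule V_eqI[OF AB(1,2)])
    fix i j assume ij: "i < n" "i < j" "j < bar i"
    then have N: "i < N" "j < N" using N_bounds by (auto simp: opp_def)
    have "A $$ (i, j) - B $$ (i, j) = 0"
    proof (rule theta_trivial)
      fix x
      define E :: "'q mat" where "E = mat N N (\<lambda>(r, s). if r = i \<and> s = j then x else 0)"
      have E: "E \<in> V" using ij by (auto simp: E_def pos_space_def pos_iff)
      have k: "kappa (- C) E = - (C $$ (i, j) * x)" if C: "C \<in> V" for C
      proof -
        have "kappa (- C) E = (\<Sum>r<N. \<Sum>s<N. (- C) $$ (r, s) * E $$ (r, s))"
          using V_carrier[OF C] by (intro kappa_entry) (auto simp: E_def)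
        also have "\<dots> = (\<Sum>r<N. \<Sum>s<N. if s = j then if r = i then - (C $$ (i, j) * x) else 0 else 0)"
          using V_carrier[OF C] by (intro sum.cong refl) (auto simp: E_def)
        finally show ?thesis using N by simp
      qed
      have "chi A E = chi B E" using AB by simp
      then have "\<theta> (- (A $$ (i, j) * x)) = \<theta> (- (B $$ (i, j) * x))"
        using E AB by (simp add: lin_char_def k)
      then have "\<theta> (A $$ (i, j) * x) = \<theta> (B $$ (i, j) * x)"
        by (simp add: theta_minus)
      then show "\<theta> ((A $$ (i, j) - B $$ (i, j)) * x) = 1"
        using theta_add[of "(A $$ (i, j) - B $$ (i, j)) * x" "B $$ (i, j) * x"] theta_nz[of "B $$ (i, j) * x"]
        by (simp add: algebra_simps)
    qed
    then show "A $$ (i, j) = B $$ (i, j)" by simp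
  qed
qed

lemma chi_eq: "A \<in> V \<Longrightarrow> B \<in> V \<Longrightarrow> chi A = chi B \<longleftrightarrow> A = B"
  using chi_inj by (auto simp: inj_on_def)

abbreviation cact :: "(('q mat \<Rightarrow> complex) \<Rightarrow> complex) \<Rightarrow> 'q mat \<Rightarrow> ('q mat \<Rightarrow> complex) \<Rightarrow> complex" where
  "cact \<equiv> ract (char_module \<theta> T n)"

abbreviation OM :: "'q mat \<Rightarrow> (('q mat \<Rightarrow> complex) \<Rightarrow> complex, 'q mat) rmodule" where
  "OM \<equiv> orbit_module \<theta> T n"

definition Orb :: "'q mat \<Rightarrow> 'q mat set" where
  "Orb A = act A ` U"

lemma cact_eq: "cact \<phi> g = (\<Sum>A\<in>V. fun_scale (\<phi> (chi A) * coc A g) (basis_vec (chi (act A g))))"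
  by (simp add: char_module_def coc_def)

lemma cact_apply:
  assumes "g \<in> U" "C \<in> V"
  shows "cact \<phi> g (chi (act C g)) = \<phi> (chi C) * coc C g"
proof -
  have "cact \<phi> g (chi (act C g)) = (\<Sum>A\<in>V. if A = C then \<phi> (chi A) * coc A g else 0)"
    unfolding cact_eq sum_fun_apply
  proof (intro sum.cong refl)
    fix A assume A: "A \<in> V"
    have "chi (act C g) = chi (act A g) \<longleftrightarrow> A = C"
      using A assms act_bij[OF assms(1)] by (auto simp: chi_eq act_V bij_betw_def inj_on_def)
    then show "fun_scale (\<phi> (chi A) * coc A g) (basis_vec (chi (act A g))) (chi (act C g))
        = (if A = C then \<phi> (chi A) * coc A g else 0)"
      by (simp add: fun_scale_def basis_vec_def)
  qed
  then show ?thesis using assms finite_V by simp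
qed

lemma cact_zero: "\<psi> \<notin> chi ` V \<Longrightarrow> g \<in> U \<Longrightarrow> cact \<phi> g \<psi> = 0"
  unfolding cact_eq sum_fun_apply
  by (intro sum.neutral) (auto simp: fun_scale_def basis_vec_def act_V)

lemma Orb_V: "A \<in> V \<Longrightarrow> C \<in> Orb A \<Longrightarrow> C \<in> V"
  by (auto simp: Orb_def act_V)

lemma Orb_act: "A \<in> V \<Longrightarrow> C \<in> Orb A \<Longrightarrow> g \<in> U \<Longrightarrow> act C g \<in> Orb A"
  by (auto simp: Orb_def act_act U_mult)

lemma Orb_self: "A \<in> V \<Longrightarrow> A \<in> Orb A"
  unfolding Orb_def by (rule image_eqI[of _ _ "1\<^sub>m N"]) (auto simp: act_one U_one)

lemma finite_Orb: "finite (Orb A)"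
  by (simp add: Orb_def finite_U)

lemma Orb_bij: "A \<in> V \<Longrightarrow> g \<in> U \<Longrightarrow> bij_betw (\<lambda>C. act C g) (Orb A) (Orb A)"
  by (rule bij_betwI[where g = "\<lambda>C. act C (ui g)"])
    (auto simp: act_inv Orb_act U_ui dest: Orb_V)

lemma char_orbit_eq: "char_orbit \<theta> T n A = chi ` Orb A"
  by (auto simp: char_orbit_def Orb_def)

lemma OM_space: "rspace (OM A) = {\<phi>. \<forall>\<psi>. \<psi> \<notin> chi ` Orb A \<longrightarrow> \<phi> \<psi> = 0}"
  by (simp add: orbit_module_def char_orbit_eq span_basis_vec finite_Orb)

lemma OM_scale [simp]: "rscale (OM A) = fun_scale"
  by (simp add: orbit_module_def char_module_def)

lemma OM_act [simp]: "ract (OM A) = cact"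
  by (simp add: orbit_module_def)

text \<open>
  Since \<open>g\<close> permutes the orbit, functions may be compared on the translates by \<open>g\<close>, where
  \<open>cact_apply\<close> evaluates the action.
\<close>

lemma OM_eqI:
  assumes "A \<in> V" "g \<in> U" "\<phi> \<in> rspace (OM A)" "\<phi>' \<in> rspace (OM A)"
    and "\<And>C. C \<in> Orb A \<Longrightarrow> \<phi> (chi (act C g)) = \<phi>' (chi (act C g))"
  shows "\<phi> = \<phi>'"
proof
  fix \<psi>
  show "\<phi> \<psi> = \<phi>' \<psi>"
  proof (cases "\<psi> \<in> chi ` Orb A")
    case True
    then obtain D where D: "D \<in> Orb A" "\<psi> = chi D" by blast
    with assms have "act (act D (ui g)) g = D" "act D (ui g) \<in> Orb A"
      by (auto simp: act_inv Orb_act U_ui dest: Orb_V)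
    then show ?thesis using assms(5) D by metis
  qed (use assms in \<open>simp add: OM_space\<close>)
qed

lemma cact_closed:
  assumes A: "A \<in> V" and g: "g \<in> U" and \<phi>: "\<phi> \<in> rspace (OM A)"
  shows "cact \<phi> g \<in> rspace (OM A)"
  unfolding OM_space
proof (intro CollectI allI impI)
  fix \<psi> assume \<psi>: "\<psi> \<notin> chi ` Orb A"
  show "cact \<phi> g \<psi> = 0"
  proof (cases "\<psi> \<in> chi ` V")
    case True
    then obtain D where D: "D \<in> V" "\<psi> = chi D" by blast
    define C where "C = act D (ui g)"
    have C: "C \<in> V" "act C g = D" using D g by (auto simp: C_def act_inv act_V U_ui)
    have "C \<notin> Orb A" using C Orb_act[OF A _ g] \<psi> D by blast
    then have "chi C \<notin> chi ` Orb A" using C Orb_V[OF A] by (auto simp: chi_eq)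
    then have "\<phi> (chi C) = 0" using \<phi> by (simp add: OM_space)
    then show ?thesis using cact_apply[OF g C(1), of \<phi>] C D by simp
  qed (use cact_zero g in auto)
qed

lemma OM_group_rmodule:
  assumes A: "A \<in> V"
  shows "group_rmodule (unip_group T n) (OM A)"
proof -
  have ss: "module.subspace fun_scale (rspace (OM A))"
    unfolding OM_space by (rule supported_subspace)
  note cl = cact_closed[OF A]
  have add: "cact (v + w) g = cact v g + cact w g" for v w g
    unfolding cact_eq by (simp add: fun_eq_iff sum_fun_apply fun_scale_def sum.distrib distrib_right)
  have scale: "cact (fun_scale c v) g = fun_scale c (cact v g)" for c v g
    unfolding cact_eq by (simp add: fun_eq_iff sum_fun_apply fun_scale_def sum_distrib_left mult.assoc)
  have one: "cact v (1\<^sub>m N) = v" if v: "v \<in> rspace (OM A)" for v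
  proof (rule OM_eqI[OF A U_one cl[OF U_one v] v])
    fix C assume "C \<in> Orb A"
    then have "C \<in> V" using Orb_V A by blast
    then show "cact v (1\<^sub>m N) (chi (act C (1\<^sub>m N))) = v (chi (act C (1\<^sub>m N)))"
      by (simp add: cact_apply U_one coc_one) (simp add: act_one)
  qed
  have mult: "cact v (g * h) = cact (cact v g) h" if v: "v \<in> rspace (OM A)" and gh: "g \<in> U" "h \<in> U" for v g h
  proof (rule OM_eqI[OF A U_mult[OF gh] cl[OF U_mult[OF gh] v] cl[OF gh(2) cl[OF gh(1) v]]])
    fix C assume "C \<in> Orb A"
    then have C: "C \<in> V" using Orb_V A by blast
    have "cact (cact v g) h (chi (act C (g * h))) = cact v g (chi (act C g)) * coc (act C g) h"
      using C gh by (simp add: act_act[symmetric] cact_apply act_V)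
    then show "cact v (g * h) (chi (act C (g * h))) = cact (cact v g) h (chi (act C (g * h)))"
      using C gh by (simp add: cact_apply U_mult coc_mult)
  qed
  show ?thesis
    unfolding group_rmodule_def using U_group fun_vs.vector_space_axioms ss cl add scale one mult by simp
qed

lemma act_eq_Stab:
  assumes "A \<in> V" "u \<in> U" "v \<in> U" "act A u = act A v"
  shows "v * ui u \<in> Stab A"
  using assms act_inv(1)[of A u] by (simp add: Stab_def U_mult U_ui act_act[symmetric])

definition eigenvector :: "('v::ab_group_add, 'q mat) rmodule \<Rightarrow> 'q mat set \<Rightarrow> 'q mat \<Rightarrow> 'v \<Rightarrow> bool" where
  "eigenvector S H A s \<longleftrightarrow> s \<in> rspace S \<and> s \<noteq> 0 \<and> (\<forall>u\<in>H. ract S s u = rscale S (coc A u) s)"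

text \<open>
  Frobenius reciprocity for the module induced from \<open>coc A\<close>: the basis element of \<open>A.u\<close> is sent
  to \<open>(coc A u)\<^sup>-\<^sup>1 s u\<close>, which depends only on \<open>A.u\<close> because \<open>s\<close> is an eigenvector of the
  stabilizer. The image is a nonzero submodule of \<open>S\<close>.
\<close>

lemma constituentI:
  fixes S :: "('v::ab_group_add, 'q mat) rmodule"
  assumes S: "irreducible_rmodule (unip_group T n) S" and A: "A \<in> V"
    and ev: "eigenvector S (Stab A) A s"
  shows "constituent (unip_group T n) S (OM A)"
proof -
  have Sg: "group_rmodule (unip_group T n) S" using S by (simp add: irreducible_rmodule_def)
  interpret S: group_rep "unip_group T n" S by unfold_locales (rule Sg)
  interpret M: group_rep "unip_group T n" "OM A" by unfold_locales (rule OM_group_rmodule[OF A])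
  have s: "s \<in> rspace S" "s \<noteq> 0" and se: "\<And>u. u \<in> Stab A \<Longrightarrow> ract S s u = rscale S (coc A u) s"
    using ev by (auto simp: eigenvector_def)
  define vec where "vec u = rscale S (inverse (coc A u)) (ract S s u)" for u
  define t where "t C = vec (SOME u. u \<in> U \<and> C = act A u)" for C
  have vec_S: "vec u \<in> rspace S" if "u \<in> U" for u
    unfolding vec_def using that s S.act_closed S.subspace_scale[OF S.space] by blast
  have vec_eq: "vec v = vec u" if uv: "u \<in> U" "v \<in> U" "act A u = act A v" for u v
  proof -
    define h where "h = v * ui u"
    have h: "h \<in> Stab A" unfolding h_def by (rule act_eq_Stab[OF A uv])
    then have hU: "h \<in> U" by (simp add: Stab_def)
    have v: "v = h * u" using uv by (simp add: h_def U_cancel)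
    have "ract S s v = rscale S (coc A h) (ract S s u)"
      using S.act_mult[of h u s] S.act_scale[of u s "coc A h"] se[OF h] s uv hU v by simp
    then show ?thesis
      using coc_Stab[OF A h uv(1)] coc_nz[of A h] by (simp add: vec_def v)
  qed
  have t: "t (act A u) = vec u" if "u \<in> U" for u
    unfolding t_def
  proof (rule someI2[of "\<lambda>v. v \<in> U \<and> act A u = act A v" u])
    fix v assume "v \<in> U \<and> act A u = act A v"
    then show "vec v = vec u" using vec_eq that by blast
  qed (use that in auto)
  have t_S: "t C \<in> rspace S" if "C \<in> Orb A" for C
    using that vec_S by (auto simp: Orb_def t)
  have t_act: "ract S (t C) g = rscale S (coc C g) (t (act C g))" if C: "C \<in> Orb A" and g: "g \<in> U" for C g
  proof -
    obtain u where u: "u \<in> U" "C = act A u" using C by (auto simp: Orb_def)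
    have "ract S (t C) g = rscale S (inverse (coc A u)) (ract S s (u * g))"
      using u g s S.act_scale[of g "ract S s u"] S.act_closed[of u s] S.act_mult[of u g s] by (simp add: t vec_def)
    moreover have "t (act C g) = vec (u * g)" using u g A by (simp add: act_act t U_mult)
    ultimately show ?thesis
      using u g A coc_nz[of A u] coc_nz[of C g] by (simp add: vec_def coc_mult)
  qed
  define f where "f \<phi> = (\<Sum>C\<in>Orb A. rscale S (\<phi> (chi C)) (t C))" for \<phi>
  have tm: "rscale S c (t C) \<in> rspace S" if "C \<in> Orb A" for c C
    using t_S[OF that] S.subspace_scale[OF S.space] by blast
  have f_S: "f \<phi> \<in> rspace S" for \<phi>
    unfolding f_def using tm by (intro S.subspace_sum[OF S.space]) auto
  have f_add: "f (\<phi> + \<phi>') = f \<phi> + f \<phi>'" for \<phi> \<phi>'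
    by (simp add: f_def S.scale_left_distrib sum.distrib)
  have f_scale: "f (fun_scale c \<phi>) = rscale S c (f \<phi>)" for c \<phi>
    by (simp add: f_def fun_scale_def S.scale_sum_right)
  have f_act: "f (cact \<phi> g) = ract S (f \<phi>) g" if g: "g \<in> U" for \<phi> g
  proof -
    have "f (cact \<phi> g) = (\<Sum>C\<in>Orb A. rscale S (cact \<phi> g (chi (act C g))) (t (act C g)))"
      unfolding f_def by (rule sum.reindex_bij_betw[OF Orb_bij[OF A g], symmetric])
    also have "\<dots> = (\<Sum>C\<in>Orb A. ract S (rscale S (\<phi> (chi C)) (t C)) g)"
      using g t_S Orb_V[OF A] by (intro sum.cong refl) (simp add: cact_apply S.act_scale t_act)
    also have "\<dots> = ract S (f \<phi>) g"
      unfolding f_def using g tm by (intro S.act_sum[symmetric]) auto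
    finally show ?thesis .
  qed
  have hom: "f \<in> rmodule_hom (unip_group T n) (OM A) S"
    unfolding rmodule_hom_def using f_S f_add f_scale f_act by simp
  have "submodule_space (unip_group T n) S (f ` rspace (OM A))"
    unfolding submodule_space_def
  proof (intro conjI ballI)
    show "S.subspace (f ` rspace (OM A))"
    proof (rule S.subspaceI)
      have "f 0 = 0" by (simp add: f_def)
      then show "0 \<in> f ` rspace (OM A)" using M.subspace_0[OF M.space] by (metis image_eqI)
    next
      fix x y assume "x \<in> f ` rspace (OM A)" "y \<in> f ` rspace (OM A)"
      then show "x + y \<in> f ` rspace (OM A)"
        using M.subspace_add[OF M.space] f_add by (auto simp: image_iff) metis
    next
      fix c x assume "x \<in> f ` rspace (OM A)"
      then show "rscale S c x \<in> f ` rspace (OM A)"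
        using M.subspace_scale[OF M.space] f_scale by (auto simp: image_iff) metis
    qed
    show "f ` rspace (OM A) \<subseteq> rspace S" using f_S by blast
    fix g w assume "g \<in> U" "w \<in> f ` rspace (OM A)"
    then show "ract S w g \<in> f ` rspace (OM A)"
      using M.act_closed f_act by (auto simp: image_iff) metis
  qed
  moreover have "f ` rspace (OM A) \<noteq> {0}"
  proof -
    have "f (basis_vec (chi A)) = (\<Sum>C\<in>Orb A. if C = A then t C else 0)"
      unfolding f_def using Orb_V[OF A] A by (intro sum.cong refl) (auto simp: basis_vec_def chi_eq)
    also have "\<dots> = t A" using Orb_self[OF A] finite_Orb by simp
    also have "\<dots> = vec (1\<^sub>m N)" using t[OF U_one] A by (simp add: act_one)
    also have "\<dots> = s" using S.act_one[OF s(1)] A by (simp add: vec_def coc_one)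
    finally have "f (basis_vec (chi A)) = s" .
    moreover have "basis_vec (chi A) \<in> rspace (OM A)"
      using Orb_self[OF A] by (auto simp: OM_space basis_vec_def)
    ultimately show ?thesis using s(2) by blast
  qed
  ultimately have "f ` rspace (OM A) = rspace S"
    using S unfolding irreducible_rmodule_def by blast
  moreover have "submodule_space (unip_group T n) (OM A) (rspace (OM A))"
    unfolding submodule_space_def using M.space M.act_closed by simp
  moreover have "OM A\<lparr>rspace := rspace (OM A)\<rparr> = OM A" by simp
  ultimately show ?thesis
    unfolding constituent_def using hom by metis
qed

definition agree :: "'q mat \<Rightarrow> 'q mat \<Rightarrow> bool" where
  "agree A B \<longleftrightarrow> (\<forall>h\<in>Stab A \<inter> Stab B. coc A h = coc B h)"

text \<open>
  A preimage of \<open>s\<close> is averaged over \<open>Stab A\<close> against \<open>coc A\<close>. The result is still nonzero,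
  since its image is a nonzero multiple of \<open>s\<close>, and it is an eigenvector inside the orbit
  module of \<open>B\<close>. At any \<open>B.u\<close> in its support, an element fixing both \<open>A\<close> and \<open>B.u\<close> multiplies
  the coefficient by \<open>coc A\<close> as well as by \<open>coc (B.u)\<close>.
\<close>

lemma constituent_agree:
  fixes S :: "('v::ab_group_add, 'q mat) rmodule"
  assumes S: "group_rmodule (unip_group T n) S" and A: "A \<in> V" and B: "B \<in> V"
    and ev: "eigenvector S (Stab A) A s" and const: "constituent (unip_group T n) S (OM B)"
  shows "\<exists>u\<in>U. agree A (act B u)"
proof -
  interpret S: group_rep "unip_group T n" S by unfold_locales (rule S)
  interpret OB: group_rep "unip_group T n" "OM B" by unfold_locales (rule OM_group_rmodule[OF B])
  have s: "s \<in> rspace S" "s \<noteq> 0" and se: "\<And>u. u \<in> Stab A \<Longrightarrow> ract S s u = rscale S (coc A u) s"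
    using ev by (auto simp: eigenvector_def)
  obtain W f where W: "submodule_space (unip_group T n) (OM B) W"
    and f: "f \<in> rmodule_hom (unip_group T n) (OM B\<lparr>rspace := W\<rparr>) S" and fW: "f ` W = rspace S"
    using const unfolding constituent_def by blast
  let ?M = "OM B\<lparr>rspace := W\<rparr>"
  have gM: "group_rmodule (unip_group T n) ?M" by (rule OB.group_rmodule_submodule[OF W])
  interpret M: group_rep "unip_group T n" ?M by unfold_locales (rule gM)
  obtain w where w: "w \<in> W" "f w = s" using fW s by (metis imageE)
  have SU: "h \<in> U" if "h \<in> Stab A" for h using that by (simp add: Stab_def)
  define av where "av = (\<Sum>h\<in>Stab A. fun_scale (inverse (coc A h)) (cact w h))"
  have e1: "coc A (g \<otimes>\<^bsub>unip_group T n\<^esub> h) = coc A g * coc A h" if "g \<in> Stab A" "h \<in> Stab A" for g h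
    using coc_Stab[OF A that(1) SU[OF that(2)]] by simp
  have e2: "w \<in> rspace ?M" using w by simp
  note average = M.eigen_average[OF Stab_subgroup[OF A] e1 coc_nz e2]
  have "av \<in> W" using average(1) by (simp add: av_def)
  have av: "cact av g = fun_scale (coc A g) av" if "g \<in> Stab A" for g
    using average(2)[OF _ _ that] by (simp add: av_def)
  have wh: "cact w h \<in> W" if "h \<in> Stab A" for h using M.act_closed[of h w] w SU that by simp
  have "f av = (\<Sum>h\<in>Stab A. f (fun_scale (inverse (coc A h)) (cact w h)))"
    unfolding av_def by (rule rmodule_hom_sum[OF f gM S]) (use wh M.subspace_scale[OF M.space] in auto)
  also have "\<dots> = (\<Sum>h\<in>Stab A. s)"
  proof (intro sum.cong refl)
    fix h assume h: "h \<in> Stab A"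
    have "f (fun_scale (inverse (coc A h)) (cact w h)) = rscale S (inverse (coc A h)) (f (cact w h))"
      using f wh[OF h] unfolding rmodule_hom_def by auto
    also have "f (cact w h) = ract S (f w) h"
      using f w SU[OF h] unfolding rmodule_hom_def by auto
    finally show "f (fun_scale (inverse (coc A h)) (cact w h)) = s"
      using se[OF h] w coc_nz by simp
  qed
  also have "\<dots> = rscale S (of_nat (card (Stab A))) s"
  proof -
    have "(\<Sum>h\<in>Stab A. s) = (\<Sum>h\<in>Stab A. rscale S 1 s)" by simp
    also have "\<dots> = rscale S (\<Sum>h\<in>Stab A. 1) s" by (rule S.scale_sum_left[symmetric])
    finally show ?thesis by simp
  qed
  finally have "f av = rscale S (of_nat (card (Stab A))) s" .
  moreover have "card (Stab A) \<noteq> 0"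
  proof -
    have "finite (Stab A)" using SU by (intro finite_subset[OF _ finite_U]) auto
    then show ?thesis using subgroup.one_closed[OF Stab_subgroup[OF A]] by auto
  qed
  ultimately have "f av \<noteq> 0" using s by simp
  moreover have "f 0 = 0" using rmodule_hom_sum[OF f gM S, of "{}"] by simp
  ultimately have "av \<noteq> 0" by (intro notI) simp
  then obtain \<psi> where \<psi>: "av \<psi> \<noteq> 0" by (auto simp: fun_eq_iff)
  moreover have "av \<in> rspace (OM B)" using W \<open>av \<in> W\<close> by (auto simp: submodule_space_def)
  ultimately have "\<psi> \<in> chi ` Orb B" by (auto simp: OM_space)
  then obtain u where u: "u \<in> U" "\<psi> = chi (act B u)" by (auto simp: Orb_def)
  have "agree A (act B u)"
    unfolding agree_def
  proof
    fix h assume h: "h \<in> Stab A \<inter> Stab (act B u)"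
    then have "cact av h \<psi> = av \<psi> * coc (act B u) h"
      using cact_apply[of h "act B u" av] u B act_V by (auto simp: Stab_def)
    moreover have "cact av h \<psi> = coc A h * av \<psi>" using av h by (simp add: fun_scale_def)
    ultimately show "coc A h = coc (act B u) h" using \<psi> by simp
  qed
  with u show ?thesis by blast
qed

text \<open>
  The isomorphism between two modules that are induced from the same linear character of the
  same stabilizer, which sends the generator \<open>[A]\<close> to \<open>[B]\<close>.
\<close>

definition transfer :: "'q mat \<Rightarrow> 'q mat \<Rightarrow> (('q mat \<Rightarrow> complex) \<Rightarrow> complex) \<Rightarrow> ('q mat \<Rightarrow> complex) \<Rightarrow> complex" where
  "transfer A B \<phi> \<psi> = (if \<psi> \<in> chi ` Orb B then
     (let u = (SOME u. u \<in> U \<and> \<psi> = chi (act B u)) in \<phi> (chi (act A u)) * coc B u / coc A u) else 0)"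

lemma orbit_module_isomorphic:
  assumes A: "A \<in> V" and B: "B \<in> V" and st: "Stab A = Stab B" and ag: "agree A B"
  shows "rmodule_isomorphic (unip_group T n) (OM A) (OM B)"
proof -
  have tr: "transfer A B \<phi> (chi (act B u)) = \<phi> (chi (act A u)) * coc B u / coc A u"
    if A: "A \<in> V" and B: "B \<in> V" and st: "Stab A = Stab B" and ag: "agree A B" and u: "u \<in> U" for A B \<phi> u
  proof -
    let ?v = "SOME v. v \<in> U \<and> chi (act B u) = chi (act B v)"
    have v: "?v \<in> U" "chi (act B u) = chi (act B ?v)"
      using someI[of "\<lambda>v. v \<in> U \<and> chi (act B u) = chi (act B v)" u] u by auto
    then have Bv: "act B u = act B ?v" using B u by (simp add: chi_eq act_V)
    define h where "h = ?v * ui u"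
    have h: "h \<in> Stab B" unfolding h_def by (rule act_eq_Stab[OF B u v(1) Bv])
    then have hA: "h \<in> Stab A" and hU: "h \<in> U" using st by (auto simp: Stab_def)
    have vh: "?v = h * u" using u v by (simp add: h_def U_cancel)
    have "act A ?v = act A u" using hA hU u A by (simp add: vh act_act[symmetric]) (simp add: Stab_def)
    moreover have "coc A h = coc B h" using ag h hA by (simp add: agree_def)
    ultimately have "\<phi> (chi (act A ?v)) * coc B ?v / coc A ?v = \<phi> (chi (act A u)) * coc B u / coc A u"
      using coc_Stab[OF A hA u] coc_Stab[OF B h u] coc_nz[of B h] by (simp add: vh)
    moreover have "chi (act B u) \<in> chi ` Orb B" using u by (auto simp: Orb_def)
    ultimately show ?thesis by (simp add: transfer_def Let_def)
  qed
  have trs: "transfer A B \<phi> \<in> rspace (OM B)" for A B \<phi>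
    by (auto simp: OM_space transfer_def)
  have ag': "agree B A" using ag by (auto simp: agree_def)
  have inv: "transfer B A (transfer A B \<phi>) = \<phi>"
    if A: "A \<in> V" and B: "B \<in> V" and st: "Stab A = Stab B" and ag: "agree A B" "agree B A"
      and \<phi>: "\<phi> \<in> rspace (OM A)" for A B \<phi>
  proof (rule OM_eqI[OF A U_one trs \<phi>])
    fix C assume "C \<in> Orb A"
    then obtain u where u: "u \<in> U" "C = act A u" by (auto simp: Orb_def)
    then show "transfer B A (transfer A B \<phi>) (chi (act C (1\<^sub>m N))) = \<phi> (chi (act C (1\<^sub>m N)))"
      using A B st ag coc_nz by (simp add: act_one act_V tr)
  qed
  have hom: "transfer A B (cact \<phi> g) = cact (transfer A B \<phi>) g" if g: "g \<in> U" for \<phi> g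
  proof (rule OM_eqI[OF B g trs cact_closed[OF B g trs]])
    fix C assume "C \<in> Orb B"
    then obtain u where u: "u \<in> U" "C = act B u" by (auto simp: Orb_def)
    have "transfer A B (cact \<phi> g) (chi (act C g)) = cact \<phi> g (chi (act (act A u) g)) * coc B (u * g) / coc A (u * g)"
      using u g A B st ag by (simp add: act_act tr U_mult)
    also have "\<dots> = \<phi> (chi (act A u)) * coc B u / coc A u * coc C g"
      using u g A B coc_nz by (simp add: cact_apply act_V coc_mult)
    also have "\<dots> = cact (transfer A B \<phi>) g (chi (act C g))"
      using u g A B st ag by (simp add: cact_apply act_V tr)
    finally show "transfer A B (cact \<phi> g) (chi (act C g)) = cact (transfer A B \<phi>) g (chi (act C g))" .
  qed
  have "transfer A B \<in> rmodule_hom (unip_group T n) (OM A) (OM B)"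
    unfolding rmodule_hom_def using hom trs
    by (auto simp: transfer_def fun_eq_iff fun_scale_def Let_def add_divide_distrib distrib_right)
  moreover have "bij_betw (transfer A B) (rspace (OM A)) (rspace (OM B))"
    by (rule bij_betwI[where g = "transfer B A"]) (use trs inv A B st ag ag' in auto)
  ultimately show ?thesis unfolding rmodule_isomorphic_def by blast
qed

lemma Orb_act_eq: "A \<in> V \<Longrightarrow> u \<in> U \<Longrightarrow> Orb (act A u) = Orb A"
proof -
  have "Orb (act A u) \<subseteq> Orb A" if "A \<in> V" "u \<in> U" for A u
    using that by (auto simp: Orb_def act_act U_mult)
  from this[of A u] this[of "act A u" "ui u"] show "A \<in> V \<Longrightarrow> u \<in> U \<Longrightarrow> Orb (act A u) = Orb A"
    by (simp add: act_inv act_V U_ui subset_antisym)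
qed

lemma OM_act_eq: "A \<in> V \<Longrightarrow> u \<in> U \<Longrightarrow> OM (act A u) = OM A"
  by (simp add: orbit_module_def char_orbit_eq Orb_act_eq)

end

section \<open>Rows in echelon form\<close>

text \<open>
  Rows \<open>a l\<close> with rightmost nonzero entries in distinct columns \<open>piv l\<close>. Main separation makes
  the relevant parts of the rows of a matrix into such a family, with the main columns as
  pivots.
\<close>

definition echelon :: "'l set \<Rightarrow> ('l \<Rightarrow> nat \<Rightarrow> 'a::field) \<Rightarrow> ('l \<Rightarrow> nat) \<Rightarrow> bool" where
  "echelon L a piv \<longleftrightarrow> finite L \<and> inj_on piv L \<and> (\<forall>l\<in>L. a l (piv l) \<noteq> 0 \<and> (\<forall>b>piv l. a l b = 0))"

text \<open>
  Elimination from the right: as long as the rightmost entry of \<open>d\<close> is in a pivot column, it is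
  cancelled by the row with this pivot.
\<close>

lemma echelon_reduce:
  assumes e: "echelon L a piv" and "\<And>b. m \<le> b \<Longrightarrow> d b = 0"
  shows "\<exists>c. \<forall>j. d j - (\<Sum>l\<in>L. c l * a l j) \<noteq> 0 \<longrightarrow> (\<forall>b>j. d b - (\<Sum>l\<in>L. c l * a l b) = 0) \<longrightarrow> j \<notin> piv ` L"
  using assms(2)
proof (induction m arbitrary: d)
  case 0
  then show ?case by (intro exI[of _ "\<lambda>_. 0"]) simp
next
  case (Suc m)
  show ?case
  proof (cases "m \<in> piv ` L")
    case True
    then obtain l where l: "l \<in> L" "m = piv l" by blast
    define x where "x = d m / a l m"
    have am: "a l m \<noteq> 0" "\<And>b. b > m \<Longrightarrow> a l b = 0" using e l by (auto simp: echelon_def)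
    have "d b - x * a l b = 0" if "m \<le> b" for b
      using Suc.prems[of b] that am by (cases "b = m") (auto simp: x_def)
    then obtain c where c: "\<forall>j. (d j - x * a l j) - (\<Sum>l\<in>L. c l * a l j) \<noteq> 0 \<longrightarrow>
        (\<forall>b>j. (d b - x * a l b) - (\<Sum>l\<in>L. c l * a l b) = 0) \<longrightarrow> j \<notin> piv ` L"
      using Suc.IH[of "\<lambda>b. d b - x * a l b"] by blast
    define c' where "c' = c(l := c l + x)"
    have "(\<Sum>i\<in>L. c' i * a i j) = x * a l j + (\<Sum>i\<in>L. c i * a i j)" for j
    proof -
      have "(\<Sum>i\<in>L. c' i * a i j) = (\<Sum>i\<in>L. (if i = l then x * a l j else 0) + c i * a i j)"
        by (intro sum.cong) (auto simp: c'_def algebra_simps)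
      then show ?thesis using e l by (simp add: sum.distrib echelon_def)
    qed
    then have eq: "d j - (\<Sum>i\<in>L. c' i * a i j) = (d j - x * a l j) - (\<Sum>i\<in>L. c i * a i j)" for j by simp
    show ?thesis by (rule exI[of _ c'], unfold eq) (rule c)
  next
    case False
    show ?thesis
    proof (cases "d m = 0")
      case True
      then have "d b = 0" if "m \<le> b" for b using Suc.prems[of b] that by (cases "b = m") auto
      then show ?thesis by (rule Suc.IH)
    next
      case dm: False
      have "j = m" if "d j \<noteq> 0" "\<forall>b>j. d b = 0" for j
        using that Suc.prems[of j] dm by (cases j m rule: linorder_cases) auto
      then show ?thesis using False by (intro exI[of _ "\<lambda>_. 0"]) auto
    qed
  qed
qed

text \<open>
  Solving for \<open>w\<close> from the left: the equation of the row \<open>l\<close> determines the coordinate at its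
  pivot, once the coordinates further left are known.
\<close>

lemma echelon_vector:
  assumes e: "echelon L a piv" and j0: "j0 \<notin> piv ` L"
  shows "\<exists>w. w j0 = 1 \<and> (\<forall>b<j0. w b = 0) \<and> (\<forall>l\<in>L. piv l < m \<longrightarrow> (\<Sum>b\<le>piv l. a l b * w b) = 0)"
proof (induction m)
  case 0
  show ?case by (intro exI[of _ "\<lambda>b. if b = j0 then 1 else 0"]) auto
next
  case (Suc m)
  then obtain w where w: "w j0 = 1" "\<forall>b<j0. w b = 0" "\<forall>l\<in>L. piv l < m \<longrightarrow> (\<Sum>b\<le>piv l. a l b * w b) = 0"
    by blast
  show ?case
  proof (cases "\<exists>l\<in>L. piv l = m \<and> j0 < m")
    case True
    then obtain l where l: "l \<in> L" "piv l = m" "j0 < m" by blast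
    have am: "a l m \<noteq> 0" using e l by (auto simp: echelon_def)
    define w' where "w' = w(m := - (\<Sum>b<m. a l b * w b) / a l m)"
    have "(\<Sum>b\<le>piv i. a i b * w' b) = 0" if i: "i \<in> L" "piv i < Suc m" for i
    proof (cases "piv i = m")
      case True
      then have "i = l" using e i l by (auto simp: echelon_def inj_on_def)
      have "(\<Sum>b\<le>m. a l b * w' b) = (\<Sum>b<m. a l b * w' b) + a l m * w' m"
        by (simp add: lessThan_Suc_atMost[symmetric])
      also have "(\<Sum>b<m. a l b * w' b) = (\<Sum>b<m. a l b * w b)"
        by (intro sum.cong) (auto simp: w'_def)
      finally show ?thesis using am True \<open>i = l\<close> by (simp add: w'_def)
    next
      case False
      have "(\<Sum>b\<le>piv i. a i b * w' b) = (\<Sum>b\<le>piv i. a i b * w b)"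
        using i False by (intro sum.cong) (auto simp: w'_def)
      then show ?thesis using w i False by simp
    qed
    moreover have "w' j0 = 1" "\<forall>b<j0. w' b = 0" using w l by (auto simp: w'_def)
    ultimately show ?thesis by blast
  next
    case False
    have "(\<Sum>b\<le>piv i. a i b * w b) = 0" if i: "i \<in> L" "piv i < Suc m" for i
    proof (cases "piv i = m")
      case True
      then have "m < j0" using False i j0 by (metis image_eqI linorder_neqE_nat)
      then show ?thesis using w True by (intro sum.neutral) auto
    qed (use w i in auto)
    then show ?thesis using w by blast
  qed
qed

text \<open>
  If the reduction of \<open>d\<close> were not zero, its rightmost column would be no pivot, and
  \<open>echelon_vector\<close> would yield a vector orthogonal to the family but not to \<open>d\<close>.
\<close>

lemma echelon_dual:
  assumes e: "echelon L a piv" and piv: "\<And>l. l \<in> L \<Longrightarrow> piv l < m" and d: "\<And>b. m \<le> b \<Longrightarrow> d b = 0"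
    and dual: "\<And>w. (\<forall>l\<in>L. (\<Sum>b<m. a l b * w b) = 0) \<Longrightarrow> (\<Sum>b<m. d b * w b) = 0"
  shows "\<exists>c. \<forall>b. d b = (\<Sum>l\<in>L. c l * a l b)"
proof -
  obtain c where c: "\<forall>j. d j - (\<Sum>l\<in>L. c l * a l j) \<noteq> 0 \<longrightarrow>
      (\<forall>b>j. d b - (\<Sum>l\<in>L. c l * a l b) = 0) \<longrightarrow> j \<notin> piv ` L"
    using echelon_reduce[of L a piv m d] e d by blast
  define d' where "d' b = d b - (\<Sum>l\<in>L. c l * a l b)" for b
  have d'0: "d' b = 0" if "m \<le> b" for b
  proof -
    have "a l b = 0" if "l \<in> L" for l using e piv[OF that] \<open>m \<le> b\<close> that by (auto simp: echelon_def)
    then show ?thesis using d[OF that] by (simp add: d'_def)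
  qed
  have "d' b = 0" for b
  proof (rule ccontr)
    assume b: "d' b \<noteq> 0"
    have fin: "finite {b. d' b \<noteq> 0}"
    proof (rule finite_subset)
      show "{b. d' b \<noteq> 0} \<subseteq> {..<m}" using d'0 by (auto simp: not_less[symmetric])
    qed simp
    define j0 where "j0 = Max {b. d' b \<noteq> 0}"
    have j0: "d' j0 \<noteq> 0" using Max_in[OF fin] b by (auto simp: j0_def)
    have j0': "d' b = 0" if "b > j0" for b using Max_ge[OF fin, of b] that by (auto simp: j0_def)
    have "j0 \<notin> piv ` L" using c j0 j0' unfolding d'_def by blast
    then obtain w where w: "w j0 = 1" "\<forall>b<j0. w b = 0" "\<forall>l\<in>L. piv l < m \<longrightarrow> (\<Sum>b\<le>piv l. a l b * w b) = 0"
      using echelon_vector[OF e] by blast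
    have aw: "(\<Sum>b<m. a l b * w b) = 0" if l: "l \<in> L" for l
    proof -
      have "(\<Sum>b<m. a l b * w b) = (\<Sum>b\<le>piv l. a l b * w b)"
        using e l piv[OF l] by (intro sum.mono_neutral_right) (auto simp: echelon_def)
      then show ?thesis using w l piv by simp
    qed
    have jm: "j0 < m" using d'0 j0 by (metis not_le)
    have "(\<Sum>b<m. d' b * w b) = (\<Sum>b<m. d b * w b) - (\<Sum>b<m. \<Sum>l\<in>L. c l * (a l b * w b))"
      by (simp add: d'_def left_diff_distrib sum_subtractf sum_distrib_right mult.assoc)
    also have "(\<Sum>b<m. \<Sum>l\<in>L. c l * (a l b * w b)) = (\<Sum>l\<in>L. c l * (\<Sum>b<m. a l b * w b))"
      by (subst sum.swap) (simp add: sum_distrib_left)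
    also have "(\<Sum>b<m. d b * w b) - \<dots> = 0"
      using dual[of w] aw by simp
    finally have "(\<Sum>b<m. d' b * w b) = 0" .
    moreover have "(\<Sum>b<m. d' b * w b) = (\<Sum>b<m. if b = j0 then d' j0 else 0)"
    proof (intro sum.cong refl)
      fix b
      show "d' b * w b = (if b = j0 then d' j0 else 0)"
        using w j0' by (cases b j0 rule: linorder_cases) auto
    qed
    ultimately show False using j0 jm by simp
  qed
  then show ?thesis by (intro exI[of _ c]) (simp add: d'_def)
qed

lemma echelon_rightmost:
  assumes e: "echelon L a piv" and x: "\<And>b. x b = (\<Sum>l\<in>L. c l * a l b)" and "x b0 \<noteq> 0"
  shows "\<exists>l\<in>L. b0 \<le> piv l \<and> x (piv l) \<noteq> 0 \<and> (\<forall>b>piv l. x b = 0)"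
proof -
  define L' where "L' = {l\<in>L. c l \<noteq> 0}"
  have fin: "finite L" "finite L'" using e by (auto simp: echelon_def L'_def)
  have x': "x b = (\<Sum>l\<in>L'. c l * a l b)" for b
    unfolding x L'_def using fin by (intro sum.mono_neutral_right) auto
  have "L' \<noteq> {}" using assms(3) x' by auto
  then have "Max (piv ` L') \<in> piv ` L'" using fin by (intro Max_in) auto
  then obtain l where l: "l \<in> L'" and "piv l = Max (piv ` L')" by auto
  then have l_max: "piv l' \<le> piv l" if "l' \<in> L'" for l'
    using Max_ge[of "piv ` L'" "piv l'"] fin that by simp
  have zero: "a l' b = 0" if "l' \<in> L'" "b > piv l" for l' b
    using e that l_max[of l'] by (auto simp: echelon_def L'_def)
  then have xz: "x b = 0" if "b > piv l" for b using that x' by simp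
  have "x (piv l) = (\<Sum>l'\<in>L'. if l' = l then c l * a l (piv l) else 0)"
    unfolding x'
  proof (intro sum.cong refl)
    fix l' assume l': "l' \<in> L'"
    show "c l' * a l' (piv l) = (if l' = l then c l * a l (piv l) else 0)"
    proof (cases "l' = l")
      case False
      then have "piv l' \<noteq> piv l" using e l l' by (auto simp: echelon_def L'_def inj_on_def)
      then have "piv l' < piv l" using l_max[OF l'] by simp
      then show ?thesis using e l' False by (auto simp: echelon_def L'_def)
    qed simp
  qed
  then have "x (piv l) \<noteq> 0" using l fin e by (auto simp: L'_def echelon_def)
  moreover have "b0 \<le> piv l" using xz assms(3) by (metis not_le)
  ultimately show ?thesis using xz l by (auto simp: L'_def)
qed

section \<open>Main conditions\<close>

context orth_char
begin

abbreviation main :: "'q mat \<Rightarrow> (nat \<times> nat) set" where "main \<equiv> main_conds T n"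
abbreviation sep :: "'q mat \<Rightarrow> bool" where "sep \<equiv> main_separated T n"

lemma mainD:
  assumes "(i, j) \<in> main A"
  shows "i < n" "i < N" "j < N" "i < j" "j < bar i" "i < bar j" "bar j < N" "A $$ (i, j) \<noteq> 0"
    "\<And>b. j < b \<Longrightarrow> b < N \<Longrightarrow> A $$ (i, b) = 0"
proof -
  have p: "(i, j) \<in> pos_set T n" using assms by (simp add: main_conds_def)
  show "i < n" "j < N" "i < j" "i < bar j" "j < bar i" "bar j < N" by (rule pos_set_bounds[OF p])+
  then show "i < N" by simp
  show "A $$ (i, j) \<noteq> 0" "\<And>b. j < b \<Longrightarrow> b < N \<Longrightarrow> A $$ (i, b) = 0"
    using assms by (auto simp: main_conds_def)
qed

lemma mainI:
  "i < j \<Longrightarrow> j < bar i \<Longrightarrow> A $$ (i, j) \<noteq> 0 \<Longrightarrow> (\<And>b. j < b \<Longrightarrow> b < N \<Longrightarrow> A $$ (i, b) = 0) \<Longrightarrow> (i, j) \<in> main A"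
  by (auto simp: main_conds_def pos_iff)

lemma main_row:
  assumes A: "A \<in> V" and "i < N" "j < N" "A $$ (i, j) \<noteq> 0"
  shows "\<exists>b. j \<le> b \<and> (i, b) \<in> main A"
proof -
  define b where "b = Max {b. b < N \<and> A $$ (i, b) \<noteq> 0}"
  have fin: "finite {b. b < N \<and> A $$ (i, b) \<noteq> 0}" by simp
  have "b \<in> {b. b < N \<and> A $$ (i, b) \<noteq> 0}"
    unfolding b_def by (rule Max_in[OF fin]) (use assms in auto)
  then have b: "b < N" "A $$ (i, b) \<noteq> 0" by auto
  have jb: "j \<le> b" using Max_ge[OF fin, of j] assms by (simp add: b_def)
  have "A $$ (i, c) = 0" if "b < c" "c < N" for c
  proof (rule ccontr)
    assume "A $$ (i, c) \<noteq> 0"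
    then have "c \<le> b" unfolding b_def using that by (intro Max_ge[OF fin]) auto
    with that show False by simp
  qed
  moreover have "i < b" "b < bar i" using V_zero[OF A assms(2) b(1)] b(2) by auto
  ultimately have "(i, b) \<in> main A" using b by (intro mainI) auto
  with jb show ?thesis by blast
qed

lemma main_finite: "finite (main A)"
proof (rule finite_subset)
  show "main A \<subseteq> {..<N} \<times> {..<N}" using mainD by auto
qed simp

text \<open>
  The limb of a main condition lies strictly below its row, in its column and in the row
  opposite to that column, so main separation is a condition on pairs of main conditions.
\<close>

lemma sep_iff: "sep A \<longleftrightarrow> (\<forall>i j a b. (i, j) \<in> main A \<longrightarrow> (a, b) \<in> main A \<longrightarrow> i < a \<longrightarrow> a \<noteq> bar j \<and> b \<noteq> j)"
proof -
  have "(a, b) \<in> Limb T n A \<longleftrightarrow> (\<exists>i j. (i, j) \<in> main A \<and> i < a \<and> (a = bar j \<or> b = j))"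
    if "(a, b) \<in> main A" for a b
  proof
    assume "(a, b) \<in> Limb T n A"
    then show "\<exists>i j. (i, j) \<in> main A \<and> i < a \<and> (a = bar j \<or> b = j)"
      using mainD(6) by (fastforce simp: Limb_def)
  next
    assume "\<exists>i j. (i, j) \<in> main A \<and> i < a \<and> (a = bar j \<or> b = j)"
    then show "(a, b) \<in> Limb T n A"
      using that by (fastforce simp: Limb_def main_conds_def)
  qed
  then show ?thesis unfolding main_separated_def by fast
qed

lemma sep_column: "sep A \<Longrightarrow> (i, j) \<in> main A \<Longrightarrow> (i', j) \<in> main A \<Longrightarrow> i = i'"
  by (meson linorder_neqE_nat sep_iff)

section \<open>Elements with trivial middle block\<close>

definition mid :: "nat \<Rightarrow> 'q mat \<Rightarrow> bool" where
  "mid k u \<longleftrightarrow> (\<forall>a b. k \<le> a \<and> a \<le> bar k \<and> a < N \<and> k \<le> b \<and> b \<le> bar k \<and> b < N \<longrightarrow> u $$ (a, b) = (if a = b then 1 else 0))"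

lemma mid_SucD:
  assumes "mid (Suc k) u" "k < a" "a < bar k" "k < b" "b < bar k"
  shows "u $$ (a, b) = (if a = b then 1 else 0)"
  by (rule assms(1)[unfolded mid_def, rule_format]) (use assms in \<open>auto simp: opp_def\<close>)

lemma mid_ui:
  assumes "mid k u"
  shows "mid k (ui u)"
  unfolding mid_def
proof (intro allI impI)
  fix a b assume ab: "k \<le> a \<and> a \<le> bar k \<and> a < N \<and> k \<le> b \<and> b \<le> bar k \<and> b < N"
  then have "u $$ (N - 1 - b, N - 1 - a) = (if N - 1 - b = N - 1 - a then 1 else 0)"
    by (intro assms[unfolded mid_def, rule_format]) (auto simp: opp_def)
  moreover have "N - 1 - b = N - 1 - a \<longleftrightarrow> a = b" using ab by auto
  ultimately show "ui u $$ (a, b) = (if a = b then 1 else 0)" using ab by (simp add: flip_mat_index)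
qed

lemma U_mult_entry:
  assumes "u \<in> U" "v \<in> U" "a < N" "b < N"
  shows "(u * v) $$ (a, b) = (\<Sum>c\<in>{a..b}. u $$ (a, c) * v $$ (c, b))"
  using assms U_lower by (intro upper_mult_entry[of _ N]) (auto intro: U_carrier)

lemma mid_mult:
  assumes "u \<in> U" "v \<in> U" "mid k u" "mid k v"
  shows "mid k (u * v)"
  unfolding mid_def
proof (intro allI impI)
  fix a b assume ab: "k \<le> a \<and> a \<le> bar k \<and> a < N \<and> k \<le> b \<and> b \<le> bar k \<and> b < N"
  then have "(u * v) $$ (a, b) = (\<Sum>c\<in>{a..b}. u $$ (a, c) * v $$ (c, b))"
    using assms by (intro U_mult_entry) auto
  also have "\<dots> = (\<Sum>c\<in>{a..b}. if c = a then if a = b then 1 else 0 else 0)"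
    using assms(3,4) ab unfolding mid_def by (intro sum.cong refl) auto
  finally show "(u * v) $$ (a, b) = (if a = b then 1 else 0)" by auto
qed

definition mid_stab :: "'q mat \<Rightarrow> nat \<Rightarrow> 'q mat set" where
  "mid_stab A k = {u \<in> Stab A. mid k u}"

lemma mid_one: "mid k (1\<^sub>m N)"
  by (auto simp: mid_def)

lemma mid_stab_subgroup:
  assumes "A \<in> V"
  shows "subgroup (mid_stab A k) (unip_group T n)"
  using assms subgroup.one_closed[OF Stab_subgroup[OF assms]]
  by (intro subgroupI_U) (auto simp: mid_stab_def Stab_mult Stab_ui mid_ui mid_one, auto simp: Stab_def mid_mult)

text \<open>
  By orthogonality the first row of the block determines its last column, and the corner is
  determined by the rest because it is added to itself in the relation \<open>u * inv u = 1\<close> and the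
  characteristic is odd.
\<close>

lemma mid_extend:
  assumes u: "u \<in> U" and k: "k < n" and m: "mid (Suc k) u"
    and row: "\<And>b. k < b \<Longrightarrow> b < bar k \<Longrightarrow> ui u $$ (k, b) = 0"
  shows "mid k u"
proof -
  have bk: "bar k < N" "k < bar k" "k < N"
    using k N_bounds by (auto simp: opp_def)
  have inner: "u $$ (a, b) = (if a = b then 1 else 0)" if "k < a" "a < bar k" "k < b" "b < bar k" for a b
    using mid_SucD[OF m] that by blast
  have inner': "ui u $$ (a, b) = (if a = b then 1 else 0)" if "k < a" "a < bar k" "k < b" "b < bar k" for a b
    using mid_SucD[OF mid_ui[OF m]] that by blast
  have col: "u $$ (a, bar k) = 0" if "k < a" "a < bar k" for a
  proof -
    have "k < bar a" "bar a < bar k" "bar a < N" using that bk by (auto simp: opp_def)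
    then have "ui u $$ (k, bar a) = 0" by (intro row)
    moreover have "ui u $$ (k, bar a) = u $$ (N - 1 - bar a, N - 1 - k)"
      using \<open>bar a < N\<close> bk by (intro flip_mat_index) auto
    moreover have "N - 1 - bar a = a" "N - 1 - k = bar k" using that bk by (auto simp: opp_def)
    ultimately show ?thesis by simp
  qed
  have uv: "(u * ui u) $$ (k, c) = (\<Sum>d\<in>{k..c}. u $$ (k, d) * ui u $$ (d, c))" if "c < N" for c
    using u k bk that by (intro U_mult_entry U_ui) auto
  have row': "u $$ (k, c) = 0" if c: "k < c" "c < bar k" for c
  proof -
    have "(\<Sum>d\<in>{k..c}. u $$ (k, d) * ui u $$ (d, c)) = (\<Sum>d\<in>{k..c}. if d = c then u $$ (k, c) else 0)"
    proof (intro sum.cong refl)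
      fix d assume "d \<in> {k..c}"
      then have "k \<le> d" "d \<le> c" by auto
      then consider "d = k" | "k < d" "d \<le> c" by linarith
      then show "u $$ (k, d) * ui u $$ (d, c) = (if d = c then u $$ (k, c) else 0)"
        using c row[of c] inner'[of d c] by cases auto
    qed
    then show ?thesis using uv[of c] c bk U_ui_right[OF u] by simp
  qed
  have corner: "u $$ (k, bar k) = 0"
  proof -
    have "(\<Sum>d\<in>{k..bar k}. u $$ (k, d) * ui u $$ (d, bar k))
        = (\<Sum>d\<in>{k..bar k}. (if d = k then ui u $$ (k, bar k) else 0) + (if d = bar k then u $$ (k, bar k) else 0))"
    proof (intro sum.cong refl)
      fix d assume "d \<in> {k..bar k}"
      then have "k \<le> d" "d \<le> bar k" by auto
      then consider "d = k" | "k < d" "d < bar k" | "d = bar k" by linarith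
      then show "u $$ (k, d) * ui u $$ (d, bar k)
          = (if d = k then ui u $$ (k, bar k) else 0) + (if d = bar k then u $$ (k, bar k) else 0)"
        using bk row'[of d] U_diag[OF u, of k] U_diag[OF U_ui[OF u], of "bar k"] by cases auto
    qed
    also have "\<dots> = ui u $$ (k, bar k) + u $$ (k, bar k)"
      using bk by (simp add: sum.distrib)
    also have "ui u $$ (k, bar k) = u $$ (k, bar k)"
    proof -
      have "ui u $$ (k, bar k) = u $$ (N - 1 - bar k, N - 1 - k)" using bk by (intro flip_mat_index) auto
      moreover have "N - 1 - bar k = k" "N - 1 - k = bar k" using bk by (auto simp: opp_def)
      ultimately show ?thesis by simp
    qed
    finally have "(u * ui u) $$ (k, bar k) = u $$ (k, bar k) + u $$ (k, bar k)"
      using uv[OF bk(1)] by (simp only:)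
    moreover have "(u * ui u) $$ (k, bar k) = 0" unfolding U_ui_right[OF u] using bk by simp
    ultimately have "2 * u $$ (k, bar k) = 0" by (simp only: mult_2)
    with two show ?thesis by simp
  qed
  show ?thesis
    unfolding mid_def
  proof (intro allI impI)
    fix a b assume ab: "k \<le> a \<and> a \<le> bar k \<and> a < N \<and> k \<le> b \<and> b \<le> bar k \<and> b < N"
    consider "b < a" | "a = b" | "a = k" "b = bar k" | "a = k" "k < b" "b < bar k"
      | "k < a" "a < b" "b = bar k" | "k < a" "a < b" "b < bar k" using ab by linarith
    then show "u $$ (a, b) = (if a = b then 1 else 0)"
      using ab corner row' col inner U_lower[OF u, of a b] U_diag[OF u, of a] bk by cases auto
  qed
qed

lemma mid_all:
  assumes "u \<in> U"
  shows "mid n u"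
  unfolding mid_def
proof (intro allI impI)
  fix a b assume ab: "n \<le> a \<and> a \<le> bar n \<and> a < N \<and> n \<le> b \<and> b \<le> bar n \<and> b < N"
  then have "a = n" "b = n" using N_bounds by (auto simp: opp_def)
  with ab show "u $$ (a, b) = (if a = b then 1 else 0)" using U_diag[OF assms] by simp
qed

lemma mid_0: "u \<in> U \<Longrightarrow> mid 0 u \<Longrightarrow> u = 1\<^sub>m N"
proof (rule eq_matI)
  assume u: "u \<in> U" "mid 0 u"
  show "dim_row u = dim_row (1\<^sub>m N :: 'q mat)" "dim_col u = dim_col (1\<^sub>m N :: 'q mat)" using U_carrier[OF u(1)] by auto
  fix i j assume "i < dim_row (1\<^sub>m N :: 'q mat)" "j < dim_col (1\<^sub>m N :: 'q mat)"
  then have ij: "i < N" "j < N" by auto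
  then have "i \<le> N - 1" "j \<le> N - 1" by linarith+
  with ij show "u $$ (i, j) = (1\<^sub>m N :: 'q mat) $$ (i, j)"
    using u(2)[unfolded mid_def, rule_format, of i j] by (simp add: opp_def)
qed

section \<open>Every irreducible module occurs in a main separated orbit module\<close>

lemma theta_sum: "finite I \<Longrightarrow> \<theta> (\<Sum>i\<in>I. f i) = (\<Prod>i\<in>I. \<theta> (f i))"
  by (induction I rule: finite_induct) (auto simp: theta_0 theta_add)

lemma theta_orthogonal:
  fixes v :: "'q" assumes "v \<noteq> 0"
  shows "(\<Sum>x\<in>UNIV. \<theta> (x * v)) = 0"
proof -
  obtain y where y: "\<theta> (v * y) \<noteq> 1" using theta_trivial assms by blast
  have "(\<Sum>x\<in>UNIV. \<theta> (x * v)) = (\<Sum>x\<in>UNIV. \<theta> ((x + y) * v))"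
    by (rule sum.reindex_bij_betw[symmetric]) (rule bij_betwI[where g = "\<lambda>x. x - y"], auto)
  also have "\<dots> = (\<Sum>x\<in>UNIV. \<theta> (v * y) * \<theta> (x * v))"
    by (intro sum.cong refl) (simp add: distrib_right theta_add mult.commute[of v y] mult.commute[of "\<theta> (y * v)"])
  also have "\<dots> = \<theta> (v * y) * (\<Sum>x\<in>UNIV. \<theta> (x * v))"
    by (rule sum_distrib_left[symmetric])
  finally show ?thesis using y by simp
qed

lemma theta_orthogonal_vector:
  fixes v :: "nat \<Rightarrow> 'q" assumes "finite I"
  shows "(\<Sum>r\<in>I \<rightarrow>\<^sub>E UNIV. \<theta> (\<Sum>i\<in>I. r i * v i))
    = (if \<forall>i\<in>I. v i = 0 then of_nat (card (I \<rightarrow>\<^sub>E (UNIV :: 'q set))) else 0)"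
proof (cases "\<forall>i\<in>I. v i = 0")
  case True
  then show ?thesis by (simp add: theta_0)
next
  case False
  then obtain i where i: "i \<in> I" "v i \<noteq> 0" by blast
  have "(\<Sum>r\<in>I \<rightarrow>\<^sub>E UNIV. \<theta> (\<Sum>i\<in>I. r i * v i)) = (\<Sum>r\<in>I \<rightarrow>\<^sub>E UNIV. \<Prod>i\<in>I. \<theta> (r i * v i))"
    using assms by (simp add: theta_sum)
  also have "\<dots> = (\<Prod>i\<in>I. \<Sum>x\<in>UNIV. \<theta> (x * v i))"
    by (rule prod_sum_PiE[symmetric]) (use assms in auto)
  also have "\<dots> = 0"
    by (rule prod_zero[OF assms]) (use i theta_orthogonal in auto)
  finally show ?thesis by (simp only: if_not_P[OF False])
qed

lemma row_act_cong:
  "(\<And>c. c < N \<Longrightarrow> A $$ (i, c) = B $$ (i', c)) \<Longrightarrow> row_act A u i j = row_act B u i' j"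
  unfolding row_act_def by (intro sum.cong) auto

lemma row_act_zero_row: "(\<And>c. c < N \<Longrightarrow> A $$ (i, c) = 0) \<Longrightarrow> row_act A u i j = 0"
  by (simp add: row_act_def)

lemma Stab_iff:
  assumes "A \<in> V"
  shows "u \<in> Stab A \<longleftrightarrow> u \<in> U \<and> (\<forall>i j. i < n \<and> i < j \<and> j < bar i \<longrightarrow> row_act A u i j = A $$ (i, j))"
proof -
  have b: "i < N" "j < N" if "i < n \<and> i < j \<and> j < bar i" for i j
    using that N_bounds by (auto simp: opp_def)
  show ?thesis
  proof
    assume u: "u \<in> Stab A"
    have "row_act A u i j = A $$ (i, j)" if "i < n \<and> i < j \<and> j < bar i" for i j
      using act_entry[OF assms _ b[OF that], of u] u that by (simp add: Stab_def)
    then show "u \<in> U \<and> (\<forall>i j. i < n \<and> i < j \<and> j < bar i \<longrightarrow> row_act A u i j = A $$ (i, j))"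
      using u by (auto simp: Stab_def)
  next
    assume u: "u \<in> U \<and> (\<forall>i j. i < n \<and> i < j \<and> j < bar i \<longrightarrow> row_act A u i j = A $$ (i, j))"
    then have "act A u = A"
      using assms b by (intro V_eqI) (auto simp: act_V act_entry)
    then show "u \<in> Stab A" using u by (simp add: Stab_def)
  qed
qed

definition set_row :: "'q mat \<Rightarrow> nat \<Rightarrow> (nat \<Rightarrow> 'q) \<Rightarrow> 'q mat" where
  "set_row A k r = mat N N (\<lambda>(i, j). if i = k then if k < j \<and> j < bar k then r j else 0 else A $$ (i, j))"

lemma set_row_entry: "i < N \<Longrightarrow> j < N \<Longrightarrow>
    set_row A k r $$ (i, j) = (if i = k then if k < j \<and> j < bar k then r j else 0 else A $$ (i, j))"
  by (simp add: set_row_def)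

lemma set_row_V: "A \<in> V \<Longrightarrow> set_row A k r \<in> V"
  using V_zero[of A] by (auto simp: pos_space_def set_row_def pos_iff)


text \<open>
  The echelon family at row \<open>k\<close>. Earlier rows with main column beyond \<open>bar k\<close> are left out: row
  \<open>k\<close> ends before \<open>bar k\<close> and cannot have the same main column.
\<close>

definition middle_main :: "'q mat \<Rightarrow> nat \<Rightarrow> (nat \<times> nat) set" where
  "middle_main A k = {(i, j) \<in> main A. i < k \<and> k < j \<and> j < bar k}"

definition middle_row :: "'q mat \<Rightarrow> nat \<Rightarrow> nat \<times> nat \<Rightarrow> nat \<Rightarrow> 'q" where
  "middle_row A k l b = (if k < b \<and> b < bar k then A $$ (fst l, b) else 0)"

lemma middle_echelon:
  assumes "sep A"
  shows "echelon (middle_main A k) (middle_row A k) snd"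
  unfolding echelon_def
proof (intro conjI ballI allI impI)
  show "finite (middle_main A k)"
    by (rule finite_subset[OF _ main_finite[of A]]) (auto simp: middle_main_def)
  show "inj_on snd (middle_main A k)"
    using sep_column[OF assms] by (auto simp: inj_on_def middle_main_def)
next
  fix l assume "l \<in> middle_main A k"
  then show "middle_row A k l (snd l) \<noteq> 0"
    using mainD(8) by (auto simp: middle_main_def middle_row_def)
next
  fix l b assume l: "l \<in> middle_main A k" "snd l < b"
  show "middle_row A k l b = 0"
  proof (cases "b < bar k")
    case True
    then have "b < N" by (simp add: opp_def)
    then show ?thesis
      using l mainD(9)[of "fst l" "snd l" A b] by (auto simp: middle_main_def middle_row_def)
  qed (simp add: middle_row_def)
qed

text \<open>
  Passing from \<open>mid k\<close> to \<open>mid (k + 1)\<close>. An element \<open>u\<close> of the larger group acts trivially on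
  any row \<open>k\<close>, and \<open>u \<mapsto> \<theta>(- \<Sum> r b * v b)\<close>, where \<open>v\<close> is row \<open>k\<close> of the inverse of \<open>u\<close>, is the
  linear character by which a new row \<open>r\<close> changes \<open>coc A\<close>. It is trivial on \<open>mid k\<close>. Some \<open>r\<close>
  gives a nonzero eigenvector, because the averages over all \<open>r\<close> add up to a nonzero multiple
  of \<open>s\<close>: by orthogonality of characters only those \<open>u\<close> with \<open>v = 0\<close> survive, that is, elements
  of \<open>mid k\<close>, and these act on \<open>s\<close> by \<open>coc A\<close>.
\<close>

lemma middle_eigenvectors:
  fixes S :: "('v::ab_group_add, 'q mat) rmodule"
  assumes S: "group_rmodule (unip_group T n) S" and A: "A \<in> V" and k: "k < n"
    and zero: "\<And>i j. k \<le> i \<Longrightarrow> i < N \<Longrightarrow> j < N \<Longrightarrow> A $$ (i, j) = 0"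
  defines "H \<equiv> mid_stab A (Suc k)"
  shows "u \<in> H \<Longrightarrow> u \<in> Stab (set_row A k r)"
    and "u \<in> H \<Longrightarrow> coc (set_row A k r) u = coc A u * \<theta> (- (\<Sum>b\<in>{k<..<bar k}. r b * ui u $$ (k, b)))"
    and "mid_stab (set_row A k r) (Suc k) \<subseteq> H"
    and "eigenvector S (mid_stab A k) A s \<Longrightarrow> \<exists>r s'. eigenvector S H (set_row A k r) s'"
proof -
  have bk: "bar k < N" "k < bar k" "bar (Suc k) = bar k - 1" "k < N"
    using k N_bounds by (auto simp: opp_def)
  have HU: "u \<in> U" if "u \<in> H" for u using that by (simp add: H_def mid_stab_def Stab_def)
  have inner: "ui u $$ (a, b) = (if a = b then 1 else 0)" if "u \<in> H" "k < a" "a < bar k" "k < b" "b < bar k" for u a b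
    using mid_SucD[OF mid_ui, of k u a b] that unfolding H_def mid_stab_def by blast
  show st: "u \<in> Stab (set_row A k r)" if u: "u \<in> H" for u r
  proof -
    have uA: "u \<in> Stab A" using u by (simp add: H_def mid_stab_def)
    have "row_act (set_row A k r) u i j = set_row A k r $$ (i, j)" if ij: "i < n \<and> i < j \<and> j < bar i" for i j
    proof -
      have b: "i < N" "j < N" using ij N_bounds by (auto simp: opp_def)
      show ?thesis
      proof (cases "i = k")
        case True
        have "row_act (set_row A k r) u k j = (\<Sum>c<N. if c = j then r j else 0)"
          unfolding row_act_def using u ij bk True by (intro sum.cong refl) (auto simp: set_row_entry inner)
        then show ?thesis using True ij b by (simp add: set_row_entry)
      next
        case False
        have "row_act (set_row A k r) u i j = row_act A u i j"
          by (rule row_act_cong) (use False b in \<open>auto simp: set_row_entry\<close>)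
        also have "\<dots> = A $$ (i, j)" using uA ij Stab_iff[OF A] by blast
        finally show ?thesis using False b by (simp add: set_row_entry)
      qed
    qed
    then show ?thesis using HU[OF u] Stab_iff[OF set_row_V[OF A]] by blast
  qed
  show co: "coc (set_row A k r) u = coc A u * \<theta> (- (\<Sum>b\<in>{k<..<bar k}. r b * ui u $$ (k, b)))"
    if u: "u \<in> H" for u r
  proof -
    have "(\<Sum>i<N. row_act (set_row A k r) u i i)
        = (\<Sum>i<N. row_act A u i i + (if i = k then row_act (set_row A k r) u k k else 0))"
    proof (intro sum.cong refl)
      fix i assume i: "i \<in> {..<N}"
      show "row_act (set_row A k r) u i i = row_act A u i i + (if i = k then row_act (set_row A k r) u k k else 0)"
      proof (cases "i = k")
        case True
        have "row_act A u i i = 0" by (rule row_act_zero_row) (use True zero bk in auto)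
        then show ?thesis using True by simp
      next
        case False
        have "row_act (set_row A k r) u i i = row_act A u i i"
          by (rule row_act_cong) (use False i in \<open>auto simp: set_row_entry\<close>)
        then show ?thesis using False by simp
      qed
    qed
    also have "\<dots> = (\<Sum>i<N. row_act A u i i) + row_act (set_row A k r) u k k"
      using bk by (simp add: sum.distrib)
    also have "row_act (set_row A k r) u k k = (\<Sum>b\<in>{k<..<bar k}. r b * ui u $$ (k, b))"
      unfolding row_act_def using bk by (intro sum.mono_neutral_cong_right) (auto simp: set_row_entry)
    finally show ?thesis
      using HU[OF u] A by (simp add: coc_eq set_row_V theta_add[symmetric])
  qed
  show "mid_stab (set_row A k r) (Suc k) \<subseteq> H" for r
  proof
    fix u assume u: "u \<in> mid_stab (set_row A k r) (Suc k)"
    have "row_act A u i j = A $$ (i, j)" if ij: "i < n \<and> i < j \<and> j < bar i" for i j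
    proof -
      have b: "i < N" "j < N" using ij N_bounds by (auto simp: opp_def)
      show ?thesis
      proof (cases "i = k")
        case True
        have "row_act A u i j = 0" by (rule row_act_zero_row) (use True zero bk in auto)
        then show ?thesis using True zero bk b by simp
      next
        case False
        have "row_act A u i j = row_act (set_row A k r) u i j"
          by (rule row_act_cong) (use False b in \<open>auto simp: set_row_entry\<close>)
        also have "\<dots> = set_row A k r $$ (i, j)"
          using u ij Stab_iff[OF set_row_V[OF A]] by (simp add: mid_stab_def)
        finally show ?thesis using False b by (simp add: set_row_entry)
      qed
    qed
    then show "u \<in> H" using u Stab_iff[OF A] Stab_iff[OF set_row_V[OF A]] by (simp add: H_def mid_stab_def)
  qed
  show "\<exists>r s'. eigenvector S H (set_row A k r) s'" if ev: "eigenvector S (mid_stab A k) A s" for s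
  proof -
    interpret S: group_rep "unip_group T n" S by unfold_locales (rule S)
    have s: "s \<in> rspace S" "s \<noteq> 0" and se: "\<And>u. u \<in> mid_stab A k \<Longrightarrow> ract S s u = rscale S (coc A u) s"
      using ev by (auto simp: eigenvector_def)
    have sub: "subgroup H (unip_group T n)" unfolding H_def by (rule mid_stab_subgroup[OF A])
    have finH: "finite H" using HU by (intro finite_subset[OF _ finite_U]) auto
    define av where "av r = (\<Sum>h\<in>H. rscale S (inverse (coc (set_row A k r) h)) (ract S s h))" for r
    have m: "coc (set_row A k r) (g \<otimes>\<^bsub>unip_group T n\<^esub> h) = coc (set_row A k r) g * coc (set_row A k r) h"
      if "g \<in> H" "h \<in> H" for g h r
      using coc_Stab[OF set_row_V[OF A] st[OF that(1)] HU[OF that(2)]] by simp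
    have av: "av r \<in> rspace S" "\<And>g. g \<in> H \<Longrightarrow> ract S (av r) g = rscale S (coc (set_row A k r) g) (av r)" for r
      unfolding av_def using S.eigen_average[OF sub m[of _ _ r] coc_nz s(1)] by blast+
    let ?I = "{k<..<bar k}"
    let ?R = "?I \<rightarrow>\<^sub>E (UNIV :: 'q set)"
    \<comment> \<open>The elements whose row \<open>k\<close> vanishes inside the block; by orthogonality they have trivial middle block.\<close>
    define H0 where "H0 = {h\<in>H. \<forall>b\<in>?I. ui h $$ (k, b) = 0}"
    have H0: "h \<in> mid_stab A k" if "h \<in> H0" for h
      using that mid_extend[OF HU k, of h] by (auto simp: H0_def H_def mid_stab_def)
    have coeff: "(\<Sum>r\<in>?R. inverse (coc (set_row A k r) h)) = inverse (coc A h) * (if h \<in> H0 then of_nat (card ?R) else 0)"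
      if h: "h \<in> H" for h
    proof -
      have "(\<Sum>r\<in>?R. inverse (coc (set_row A k r) h))
          = inverse (coc A h) * (\<Sum>r\<in>?R. \<theta> (\<Sum>b\<in>?I. r b * ui h $$ (k, b)))"
        by (simp add: co[OF h] theta_minus sum_distrib_left)
      then show ?thesis
        using h by (simp add: theta_orthogonal_vector H0_def)
    qed
    have "(\<Sum>r\<in>?R. av r) = (\<Sum>h\<in>H. rscale S (\<Sum>r\<in>?R. inverse (coc (set_row A k r) h)) (ract S s h))"
      unfolding av_def by (subst sum.swap) (simp add: S.scale_sum_left)
    also have "\<dots> = (\<Sum>h\<in>H. if h \<in> H0 then rscale S (of_nat (card ?R)) s else 0)"
      using se[OF H0] coc_nz by (intro sum.cong refl) (auto simp: coeff)
    also have "\<dots> = (\<Sum>h\<in>H0. rscale S (of_nat (card ?R)) s)"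
      using finH by (intro sum.mono_neutral_cong_right) (auto simp: H0_def)
    also have "\<dots> = rscale S (\<Sum>h\<in>H0. of_nat (card ?R)) s" by (rule S.scale_sum_left[symmetric])
    finally have sum: "(\<Sum>r\<in>?R. av r) = rscale S (\<Sum>h\<in>H0. of_nat (card ?R)) s" .
    have "1\<^sub>m N \<in> H0"
      using subgroup.one_closed[OF sub] bk by (auto simp: H0_def flip_one)
    moreover have "finite H0" using finH by (simp add: H0_def)
    ultimately have "card H0 \<noteq> 0" by auto
    moreover have "card ?R \<noteq> 0" by (simp add: card_PiE)
    ultimately have "(\<Sum>r\<in>?R. av r) \<noteq> 0" unfolding sum using s(2) by simp
    then obtain r where "av r \<noteq> 0" by (meson sum.neutral)
    then show ?thesis using av unfolding eigenvector_def by blast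
  qed
qed

text \<open>
  Row \<open>k\<close> is left zero if its opposite is the main column of an earlier row. Otherwise it is
  taken from \<open>middle_eigenvectors\<close>, reduced modulo the earlier rows with main column in the
  block. The reduction does not matter for the eigenvector, since \<open>u\<close> fixes these earlier rows
  in column \<open>k\<close>, which says that they are orthogonal to row \<open>k\<close> of the inverse of \<open>u\<close>.
\<close>

lemma middle_extend:
  fixes S :: "('v::ab_group_add, 'q mat) rmodule"
  assumes S: "group_rmodule (unip_group T n) S" and A: "A \<in> V" "sep A" and k: "k < n"
    and zero: "\<And>i j. k \<le> i \<Longrightarrow> i < N \<Longrightarrow> j < N \<Longrightarrow> A $$ (i, j) = 0"
    and ev: "eigenvector S (mid_stab A k) A s"
  shows "\<exists>A'\<in>V. sep A' \<and> (\<forall>i j. Suc k \<le> i \<and> i < N \<and> j < N \<longrightarrow> A' $$ (i, j) = 0) \<and>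
    (\<exists>s'. eigenvector S (mid_stab A' (Suc k)) A' s')"
proof -
  have bk: "bar k < N" "k < bar k" "bar (Suc k) = bar k - 1" "k < N" "bar (bar k) = k"
    using k N_bounds by (auto simp: opp_def)
  define H where "H = mid_stab A (Suc k)"
  have HU: "u \<in> U" if "u \<in> H" for u using that by (simp add: H_def mid_stab_def Stab_def)
  have mid: "u $$ (a, b) = (if a = b then 1 else 0)" if "u \<in> H" "k < a" "a < bar k" "k < b" "b < bar k" for u a b
    using mid_SucD[of k u a b] that unfolding H_def mid_stab_def by blast
  show ?thesis
  proof (cases "\<exists>i. (i, bar k) \<in> main A")
    case True
    then obtain i where i: "(i, bar k) \<in> main A" by blast
    note iD = mainD[OF i]
    \<comment> \<open>In column \<open>j\<close> of row \<open>i\<close>, stabilizing \<open>A\<close> means that the main entry times \<open>u (j, bar k)\<close> vanishes, the other terms being killed by the trivial block.\<close>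
    have "mid k u" if u: "u \<in> H" for u
    proof (rule mid_extend[OF HU[OF u] k])
      show "mid (Suc k) u" using u by (simp add: H_def mid_stab_def)
      fix b assume b: "k < b" "b < bar k"
      define j where "j = bar b"
      have j: "k < j" "j < bar k" "j < N" "i < j" "j < bar i" using b bk iD by (auto simp: j_def opp_def)
      have "ui u \<in> Stab A" using u Stab_ui[OF A(1)] by (simp add: H_def mid_stab_def)
      then have "A $$ (i, j) = row_act A (ui u) i j" using Stab_iff[OF A(1), of "ui u"] iD j by auto
      also have "\<dots> = (\<Sum>c<N. A $$ (i, c) * u $$ (j, c))"
        unfolding row_act_def using HU[OF u] by (simp add: ui_ui)
      also have "\<dots> = (\<Sum>c<N. (if c = j then A $$ (i, j) else 0) + (if c = bar k then A $$ (i, bar k) * u $$ (j, bar k) else 0))"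
      proof (intro sum.cong refl)
        fix c assume "c \<in> {..<N}"
        then have c: "c < N" by simp
        consider "c < j" | "c = j" | "j < c" "c < bar k" | "c = bar k" | "bar k < c" by linarith
        then show "A $$ (i, c) * u $$ (j, c) = (if c = j then A $$ (i, j) else 0) + (if c = bar k then A $$ (i, bar k) * u $$ (j, bar k) else 0)"
          using j bk mid[OF u, of j c] iD(9)[of c] c U_lower[OF HU[OF u], of j c] U_diag[OF HU[OF u], of j] by cases auto
      qed
      also have "\<dots> = A $$ (i, j) + A $$ (i, bar k) * u $$ (j, bar k)"
        using j bk by (simp add: sum.distrib)
      finally have "u $$ (j, bar k) = 0" using iD by simp
      moreover have "ui u $$ (k, b) = u $$ (N - 1 - b, N - 1 - k)" using b bk by (intro flip_mat_index) auto
      ultimately show "ui u $$ (k, b) = 0" by (simp add: j_def opp_def)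
    qed
    then have "mid_stab A (Suc k) \<subseteq> mid_stab A k" by (auto simp: H_def mid_stab_def)
    then have "eigenvector S (mid_stab A (Suc k)) A s" using ev by (auto simp: eigenvector_def)
    then show ?thesis using A zero by (intro bexI[of _ A]) auto
  next
    case False
    obtain r s' where rs: "eigenvector S H (set_row A k r) s'"
      using middle_eigenvectors(4)[OF S A(1) k zero ev] unfolding H_def by blast
    define L where "L = middle_main A k"
    define a where "a = middle_row A k"
    have LD: "fst l < k" if "l \<in> L" for l using that by (auto simp: L_def middle_main_def)
    have ech: "echelon L a snd" unfolding L_def a_def by (rule middle_echelon[OF A(2)])
    define d where "d b = (if k < b \<and> b < bar k then r b else 0)" for b
    obtain c where c: "\<forall>j. d j - (\<Sum>l\<in>L. c l * a l j) \<noteq> 0 \<longrightarrow>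
        (\<forall>b>j. d b - (\<Sum>l\<in>L. c l * a l b) = 0) \<longrightarrow> j \<notin> snd ` L"
      using echelon_reduce[OF ech, of "bar k" d] by (auto simp: d_def)
    define r' where "r' b = d b - (\<Sum>l\<in>L. c l * a l b)" for b
    have r'0: "r' b = 0" if "\<not> (k < b \<and> b < bar k)" for b using that by (auto simp: r'_def d_def a_def middle_row_def)
    define A' where "A' = set_row A k r'"
    have A'V: "A' \<in> V" by (simp add: A'_def set_row_V A)
    have A'e: "A' $$ (i, j) = (if i = k then r' j else A $$ (i, j))" if "i < N" "j < N" for i j
      using that r'0 by (auto simp: A'_def set_row_entry)
    have zero': "A' $$ (i, j) = 0" if "Suc k \<le> i" "i < N" "j < N" for i j
      using that zero by (simp add: A'e)
    \<comment> \<open>This is the condition that \<open>u\<close> fixes the entry of \<open>A\<close> in the row of \<open>l\<close> and column \<open>k\<close>.\<close>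
    have perp: "(\<Sum>b\<in>{k<..<bar k}. a l b * ui u $$ (k, b)) = 0" if u: "u \<in> H" and l: "l \<in> L" for u l
    proof -
      define i where "i = fst l"
      have i: "(i, snd l) \<in> main A" "snd l < bar k" "k < snd l" using l by (auto simp: i_def L_def middle_main_def)
      have ik: "i < k" using LD[OF l] by (simp add: i_def)
      then have "k < bar i" using k N_bounds by (auto simp: opp_def)
      then have "A $$ (i, k) = row_act A u i k"
        using Stab_iff[OF A(1), of u] u ik mainD[OF i(1)] by (auto simp: H_def mid_stab_def)
      also have "\<dots> = (\<Sum>b<N. (if b = k then A $$ (i, k) else 0) + (if k < b \<and> b < bar k then a l b * ui u $$ (k, b) else 0))"
        unfolding row_act_def
      proof (intro sum.cong refl)
        fix b assume "b \<in> {..<N}"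
        then have b: "b < N" by simp
        consider "b < k" | "b = k" | "k < b" "b < bar k" | "bar k \<le> b" by linarith
        then show "A $$ (i, b) * ui u $$ (k, b) = (if b = k then A $$ (i, k) else 0) + (if k < b \<and> b < bar k then a l b * ui u $$ (k, b) else 0)"
          using bk b U_lower[OF U_ui[OF HU[OF u]], of k b] U_diag[OF U_ui[OF HU[OF u]], of k] mainD(9)[OF i(1), of b] i
          by cases (auto simp: a_def i_def middle_row_def)
      qed
      also have "\<dots> = A $$ (i, k) + (\<Sum>b<N. if k < b \<and> b < bar k then a l b * ui u $$ (k, b) else 0)"
        using bk by (simp add: sum.distrib)
      also have "(\<Sum>b<N. if k < b \<and> b < bar k then a l b * ui u $$ (k, b) else 0) = (\<Sum>b\<in>{k<..<bar k}. a l b * ui u $$ (k, b))"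
        using bk by (intro sum.mono_neutral_cong_right) auto
      finally show ?thesis by simp
    qed
    have co: "coc A' u = coc (set_row A k r) u" if u: "u \<in> H" for u
    proof -
      have "(\<Sum>b\<in>{k<..<bar k}. r' b * ui u $$ (k, b))
          = (\<Sum>b\<in>{k<..<bar k}. r b * ui u $$ (k, b)) - (\<Sum>b\<in>{k<..<bar k}. \<Sum>l\<in>L. c l * (a l b * ui u $$ (k, b)))"
        unfolding sum_subtractf[symmetric]
        by (intro sum.cong refl) (simp add: r'_def d_def left_diff_distrib sum_distrib_right mult.assoc)
      also have "(\<Sum>b\<in>{k<..<bar k}. \<Sum>l\<in>L. c l * (a l b * ui u $$ (k, b))) = 0"
        by (subst sum.swap) (simp add: sum_distrib_left[symmetric] perp[OF u])
      finally show ?thesis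
        using middle_eigenvectors(2)[OF S A(1) k zero, of u] u by (simp add: A'_def H_def)
    qed
    have "mid_stab A' (Suc k) \<subseteq> H"
      unfolding A'_def H_def by (rule middle_eigenvectors(3)[OF S A(1) k zero])
    then have "eigenvector S (mid_stab A' (Suc k)) A' s'"
      using rs co by (auto simp: eigenvector_def subset_iff)
    moreover have "sep A'"
      unfolding sep_iff
    proof (intro allI impI)
      have main': "(i, j) \<in> main A" if "(i, j) \<in> main A'" "i < k" for i j
      proof -
        note D = mainD[OF that(1)]
        show ?thesis using D that(2) by (intro mainI) (auto simp: A'e)
      qed
      fix i j x y assume ij: "(i, j) \<in> main A'" and xy: "(x, y) \<in> main A'" and ix: "i < x"
      note xD = mainD[OF xy]
      have xk: "x \<le> k" using xD zero' by (metis not_less_eq_eq)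
      have ijm: "(i, j) \<in> main A" using main'[OF ij] ix xk by simp
      note iD = mainD[OF ijm]
      show "x \<noteq> bar j \<and> y \<noteq> j"
      proof (cases "x = k")
        case True
        have "k \<noteq> bar j" using False ijm iD bar_bar[of j] by metis
        moreover have "y \<noteq> j"
        proof
          assume "y = j"
          have nz: "r' y \<noteq> 0" using xD True by (auto simp: A'e)
          have "r' b = 0" if "b > y" for b
          proof (cases "b < N")
            case True
            then show ?thesis using xD(9)[OF that] \<open>x = k\<close> bk by (simp add: A'e)
          next
            case False
            then show ?thesis using r'0 bk by auto
          qed
          then have "y \<notin> snd ` L" using c nz unfolding r'_def by blast
          moreover have "k < y" "y < bar k" using r'0 nz by blast+
          then have "(i, j) \<in> L" using ijm \<open>y = j\<close> ix True by (simp add: L_def middle_main_def)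
          ultimately show False using \<open>y = j\<close> by force
        qed
        ultimately show ?thesis using True by simp
      next
        case False
        then have "(x, y) \<in> main A" using main'[OF xy] xk by simp
        then show ?thesis using A(2) ijm ix unfolding sep_iff by blast
      qed
    qed
    ultimately show ?thesis using A'V zero' by (intro bexI[of _ A']) auto
  qed
qed

text \<open>
  For \<open>k = 0\<close> the middle block is the whole matrix, so any nonzero vector serves as a start.
\<close>

lemma exists_sep_eigenvector:
  fixes S :: "('v::ab_group_add, 'q mat) rmodule"
  assumes S: "irreducible_rmodule (unip_group T n) S"
  shows "\<exists>A\<in>V. sep A \<and> (\<exists>s. eigenvector S (Stab A) A s)"
proof -
  have Sg: "group_rmodule (unip_group T n) S" using S by (simp add: irreducible_rmodule_def)
  interpret S: group_rep "unip_group T n" S by unfold_locales (rule Sg)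
  have "\<exists>A\<in>V. sep A \<and> (\<forall>i j. k \<le> i \<and> i < N \<and> j < N \<longrightarrow> A $$ (i, j) = 0) \<and>
    (\<exists>s. eigenvector S (mid_stab A k) A s)" if "k \<le> n" for k
    using that
  proof (induction k)
    case 0
    let ?A = "0\<^sub>m N N :: 'q mat"
    obtain s where s: "s \<in> rspace S" "s \<noteq> 0"
      using S S.subspace_0[OF S.space] unfolding irreducible_rmodule_def by blast
    have A: "?A \<in> V" by (simp add: pos_space_def)
    have "eigenvector S (mid_stab ?A 0) ?A s"
      unfolding eigenvector_def
    proof (intro conjI s ballI)
      fix u assume "u \<in> mid_stab ?A 0"
      then have "u = 1\<^sub>m N" using mid_0 by (simp add: mid_stab_def Stab_def)
      then show "ract S s u = rscale S (coc ?A u) s"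
        using S.act_one[OF s(1)] coc_one[OF A] by simp
    qed
    moreover have "sep ?A" unfolding sep_iff using mainD by fastforce
    ultimately show ?case using A by (intro bexI[of _ ?A]) auto
  next
    case (Suc k)
    then obtain A s where "A \<in> V" "sep A" "\<forall>i j. k \<le> i \<and> i < N \<and> j < N \<longrightarrow> A $$ (i, j) = 0"
      "eigenvector S (mid_stab A k) A s" by auto
    then show ?case using middle_extend[OF Sg, of A k s] Suc.prems by auto
  qed
  from this[of n] obtain A s where A: "A \<in> V" "sep A" "eigenvector S (mid_stab A n) A s" by auto
  moreover have "mid_stab A n = Stab A" using mid_all by (auto simp: mid_stab_def Stab_def)
  ultimately show ?thesis by auto
qed


section \<open>Main separated orbit modules with a common constituent are isomorphic\<close>

lemma act_main_entries:
  assumes A: "A \<in> V" and u: "u \<in> U" and ij: "(i, j) \<in> main A"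
  shows "act A u $$ (i, j) = A $$ (i, j)" "j < b \<Longrightarrow> b < N \<Longrightarrow> act A u $$ (i, b) = 0"
proof -
  note D = mainD[OF ij]
  have "row_act A u i c = A $$ (i, c)" if c: "j \<le> c" "c < N" for c
  proof -
    have "row_act A u i c = (\<Sum>b<N. if b = c then A $$ (i, c) else 0)"
      unfolding row_act_def
    proof (intro sum.cong refl)
      fix b assume "b \<in> {..<N}"
      then show "A $$ (i, b) * ui u $$ (c, b) = (if b = c then A $$ (i, c) else 0)"
        using c D(9)[of b] U_lower[OF U_ui[OF u], of c b] U_diag[OF U_ui[OF u], of c]
        by (cases b c rule: linorder_cases) auto
    qed
    then show ?thesis using c by simp
  qed
  then show "act A u $$ (i, j) = A $$ (i, j)" "j < b \<Longrightarrow> b < N \<Longrightarrow> act A u $$ (i, b) = 0"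
    using D A u by (auto simp: act_entry)
qed

lemma main_act:
  assumes "A \<in> V" "u \<in> U"
  shows "main (act A u) = main A"
proof -
  have sub: "main A \<subseteq> main (act A u)" if "A \<in> V" "u \<in> U" for A u
  proof
    fix x assume "x \<in> main A"
    then obtain i j where ij: "x = (i, j)" "(i, j) \<in> main A" by (cases x) auto
    show "x \<in> main (act A u)"
      using act_main_entries[OF that ij(2)] mainD[OF ij(2)] unfolding ij(1) by (intro mainI) auto
  qed
  have "main (act A u) \<subseteq> main (act (act A u) (ui u))"
    using assms by (intro sub act_V U_ui)
  then show ?thesis using sub[OF assms] assms by (simp add: act_inv subset_antisym)
qed

lemma sep_act: "A \<in> V \<Longrightarrow> u \<in> U \<Longrightarrow> sep (act A u) \<longleftrightarrow> sep A"
  by (simp add: sep_iff main_act)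

lemma main_cong:
  assumes "\<And>b. b < N \<Longrightarrow> A $$ (i, b) = B $$ (i, b)"
  shows "(i, j) \<in> main A \<longleftrightarrow> (i, j) \<in> main B"
proof -
  have "(i, j) \<in> main B" if "(i, j) \<in> main A" "\<And>b. b < N \<Longrightarrow> A $$ (i, b) = B $$ (i, b)" for A B
    using mainD[OF that(1)] that(2) by (intro mainI) auto
  from this[of A B] this[of B A] assms show ?thesis by auto
qed

lemma act_row_cong:
  assumes "A \<in> V" "B \<in> V" "u \<in> U" "i < N" "\<And>b. b < N \<Longrightarrow> A $$ (i, b) = B $$ (i, b)" "j < N"
  shows "act A u $$ (i, j) = act B u $$ (i, j)"
  using assms row_act_cong[of A i B i u j] by (simp add: act_entry)

lemma agree_act:
  assumes A: "A \<in> V" and B: "B \<in> V" and u: "u \<in> U" and ag: "agree A B"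
  shows "agree (act A u) (act B u)"
  unfolding agree_def
proof
  fix h assume h: "h \<in> Stab (act A u) \<inter> Stab (act B u)"
  define g where "g = u * h * ui u"
  have hU: "h \<in> U" using h by (simp add: Stab_def)
  then have gU: "g \<in> U" and gu: "g * u = u * h" using u by (simp_all add: g_def U_mult U_ui U_cancel)
  have *: "g \<in> Stab C \<and> coc (act C u) h = coc C g" if C: "C \<in> V" and hC: "h \<in> Stab (act C u)" for C
  proof -
    have "act C g = act (act (act C u) h) (ui u)" using C u hU by (simp add: g_def act_act U_mult U_ui)
    also have "\<dots> = C" using C u hC act_inv by (simp add: Stab_def)
    finally have g: "g \<in> Stab C" using gU by (simp add: Stab_def)
    have "coc C g * coc C u = coc C (g * u)" using coc_Stab[OF C g u] by simp
    also have "\<dots> = coc C u * coc (act C u) h" unfolding gu by (rule coc_mult[OF C u hU])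
    finally show ?thesis using g coc_nz[of C u] by simp
  qed
  show "coc (act A u) h = coc (act B u) h"
    using *[OF A] *[OF B] h ag by (auto simp: agree_def)
qed

text \<open>
  The column \<open>t > bar i\<close>, as a main column, is used as a pivot: \<open>column_element\<close> with
  \<open>p = bar t < i\<close> adds arbitrary multiples of column \<open>t\<close> to the columns \<open>i, ..., bar i\<close>. This
  affects only rows whose main column is not to the left of \<open>t\<close>, so the main columns are
  processed from left to right.
\<close>

lemma clear_middle:
  assumes A: "A \<in> V" "sep A" and i: "i < n"
  shows "\<exists>u\<in>U. \<forall>l j c. (l, j) \<in> main A \<and> l < i \<and> bar i < j \<and> i \<le> c \<and> c \<le> bar i \<longrightarrow> act A u $$ (l, c) = 0"
proof -
  have bi: "bar i < N" "i < bar i" "i < N" using i N_bounds by (auto simp: opp_def)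
  have "\<exists>u\<in>U. \<forall>l j c. (l, j) \<in> main A \<and> l < i \<and> bar i < j \<and> i \<le> c \<and> c \<le> bar i \<and> j < t \<longrightarrow> act A u $$ (l, c) = 0" for t
  proof (induction t)
    case 0
    show ?case using U_one by auto
  next
    case (Suc t)
    then obtain u where u: "u \<in> U" and cl: "\<And>l j c. (l, j) \<in> main A \<Longrightarrow> l < i \<Longrightarrow> bar i < j \<Longrightarrow>
      i \<le> c \<Longrightarrow> c \<le> bar i \<Longrightarrow> j < t \<Longrightarrow> act A u $$ (l, c) = 0" by blast
    show ?case
    proof (cases "\<exists>l. (l, t) \<in> main A \<and> l < i \<and> bar i < t")
      case False
      then show ?thesis using u cl by (intro bexI[OF _ u]) (metis less_antisym)
    next
      case True
      then obtain l where l: "(l, t) \<in> main A" "l < i" "bar i < t" by blast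
      note lD = mainD[OF l(1)]
      define B where "B = act A u"
      have B: "B \<in> V" "main B = main A" using A u by (auto simp: B_def act_V main_act)
      define p where "p = bar t"
      have p: "p < i" "bar p = t" "p < n" using l i lD bi by (auto simp: p_def opp_def)
      \<comment> \<open>The multiple of the main entry \<open>B (l, t)\<close> that cancels the entry in column \<open>c\<close>.\<close>
      define w where "w c = - B $$ (l, c) / B $$ (l, t)" for c
      obtain g where g: "g \<in> U" and ge: "\<And>a b. a < N \<Longrightarrow> a \<noteq> p \<Longrightarrow> b < N \<Longrightarrow> g $$ (a, b) =
          (if a = b then 1 else 0) + (if b = bar p \<and> p < a \<and> a < bar p then w a else 0)"
        using column_element[OF p(3), of w] by blast
      have e: "act A (u * ui g) $$ (a, c) = B $$ (a, c) + B $$ (a, t) * w c" if ac: "a < i" "i \<le> c" "c \<le> bar i" for a c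
      proof -
        have b: "a < c" "c < bar a" "a < N" "c < N" "c \<noteq> p" "p < c" "c < t"
          using ac bi p l by (auto simp: opp_def)
        have "act A (u * ui g) $$ (a, c) = row_act B (ui g) a c"
          using A u g b B by (simp add: act_act[symmetric] U_ui B_def[symmetric] act_entry)
        also have "\<dots> = (\<Sum>d<N. (if d = c then B $$ (a, c) else 0) + (if d = t then B $$ (a, t) * w c else 0))"
          unfolding row_act_def ui_ui[OF g] using b p by (intro sum.cong refl) (auto simp: ge)
        also have "\<dots> = B $$ (a, c) + B $$ (a, t) * w c"
          using b lD by (simp add: sum.distrib)
        finally show ?thesis .
      qed
      have "act A (u * ui g) $$ (a, c) = 0"
        if "(a, j) \<in> main A" "a < i" "bar i < j" "i \<le> c" "c \<le> bar i" "j < Suc t" for a j c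
      proof (cases "j = t")
        case True
        then have "a = l" using sep_column[OF A(2)] that l by blast
        moreover have "B $$ (l, t) \<noteq> 0" using l B mainD(8) by blast
        ultimately show ?thesis using e[OF that(2,4,5)] by (simp add: w_def)
      next
        case False
        then have "B $$ (a, c) = 0" using cl that by (simp add: B_def)
        moreover have "B $$ (a, t) = 0" using mainD(9)[of a j B t] that B lD False by simp
        ultimately show ?thesis using e[OF that(2,4,5)] by simp
      qed
      then show ?thesis using U_mult[OF u U_ui[OF g]] by blast
    qed
  qed
  from this[of N] show ?thesis using mainD(3) by blast
qed

text \<open>
  The inverse of the element of \<open>column_element\<close> is its antidiagonal transpose: it has a
  prescribed row \<open>i\<close> and, up to column \<open>bar i\<close>, no other entries off the diagonal.
\<close>

lemma row_element:
  assumes i: "i < n"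
  shows "\<exists>g\<in>U. \<forall>a<N. \<forall>b<N. b \<noteq> bar i \<longrightarrow>
    ui g $$ (a, b) = (if a = b then 1 else 0) + (if a = i \<and> i < b \<and> b < bar i then v b else 0)"
proof -
  obtain g where g: "g \<in> U" and ge: "\<And>a b. a < N \<Longrightarrow> a \<noteq> i \<Longrightarrow> b < N \<Longrightarrow> g $$ (a, b) =
      (if a = b then 1 else 0) + (if b = bar i \<and> i < a \<and> a < bar i then v (bar a) else 0)"
    using column_element[OF i, of "\<lambda>a. v (bar a)"] by blast
  have "ui g $$ (a, b) = (if a = b then 1 else 0) + (if a = i \<and> i < b \<and> b < bar i then v b else 0)"
    if ab: "a < N" "b < N" "b \<noteq> bar i" for a b
  proof -
    have bb: "bar a < N" "bar b < N" "bar b \<noteq> i" "bar b = bar a \<longleftrightarrow> a = b" "bar a = bar i \<longleftrightarrow> a = i"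
      "i < bar b \<and> bar b < bar i \<longleftrightarrow> i < b \<and> b < bar i" "bar (bar b) = b"
      using ab i N_bounds by (auto simp: opp_def)
    have "ui g $$ (a, b) = g $$ (bar b, bar a)" using ab by (simp add: flip_mat_index opp_def)
    then show ?thesis using bb by (auto simp: ge)
  qed
  then show ?thesis using g by blast
qed

text \<open>
  Right multiplication changes only column \<open>i\<close>, by the sums in \<open>perp\<close>, as long as column
  \<open>bar i\<close> is zero. Row \<open>i\<close> itself contributes its scalar product with \<open>v\<close> to the cocycle.
\<close>

lemma row_element_Stab:
  assumes C: "C \<in> V" and i: "i < n" and g: "g \<in> U"
    and ge: "\<And>a b. a < N \<Longrightarrow> b < N \<Longrightarrow> b \<noteq> bar i \<Longrightarrow>
      ui g $$ (a, b) = (if a = b then 1 else 0) + (if a = i \<and> i < b \<and> b < bar i then v b else 0)"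
    and col: "\<And>a. a < i \<Longrightarrow> C $$ (a, bar i) = 0"
    and perp: "\<And>a. a < i \<Longrightarrow> (\<Sum>c\<in>{i<..<bar i}. C $$ (a, c) * v c) = 0"
  shows "g \<in> Stab C" and "coc C g = \<theta> (- (\<Sum>c\<in>{i<..<bar i}. C $$ (i, c) * v c))"
proof -
  have bi: "bar i < N" "i < bar i" "i < N" using i N_bounds by (auto simp: opp_def)
  have col': "C $$ (a, bar i) = 0" if "a < N" for a
  proof (cases "a < i")
    case False
    then have "bar a \<le> bar i" by (simp add: opp_def diff_le_mono2)
    then show ?thesis using V_zero[OF C that bi(1)] by simp
  qed (rule col)
  have r: "row_act C g a j = C $$ (a, j) + (if j = i then (\<Sum>c\<in>{i<..<bar i}. C $$ (a, c) * v c) else 0)"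
    if aj: "a < N" "j < N" for a j
  proof -
    have "row_act C g a j = (\<Sum>c<N. (if c = j then C $$ (a, j) else 0)
        + (if j = i \<and> i < c \<and> c < bar i then C $$ (a, c) * v c else 0))"
      unfolding row_act_def
    proof (intro sum.cong refl)
      fix c assume "c \<in> {..<N}"
      then show "C $$ (a, c) * ui g $$ (j, c) = (if c = j then C $$ (a, j) else 0)
          + (if j = i \<and> i < c \<and> c < bar i then C $$ (a, c) * v c else 0)"
        using aj col'[of a] ge[of j c] by (cases "c = bar i") auto
    qed
    also have "\<dots> = C $$ (a, j) + (\<Sum>c<N. if j = i \<and> i < c \<and> c < bar i then C $$ (a, c) * v c else 0)"
      using aj by (simp add: sum.distrib)
    also have "(\<Sum>c<N. if j = i \<and> i < c \<and> c < bar i then C $$ (a, c) * v c else 0)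
        = (if j = i then (\<Sum>c\<in>{i<..<bar i}. C $$ (a, c) * v c) else 0)"
      using bi by (auto intro!: sum.mono_neutral_cong_right)
    finally show ?thesis .
  qed
  have "row_act C g a j = C $$ (a, j)" if "a < n \<and> a < j \<and> j < bar a" for a j
  proof -
    have "a < N" "j < N" using that N_bounds by (auto simp: opp_def)
    then show ?thesis using r[of a j] perp[of a] that by auto
  qed
  then show "g \<in> Stab C" using Stab_iff[OF C] g by blast
  have "(\<Sum>a<N. row_act C g a a) = (\<Sum>a<N. if a = i then (\<Sum>c\<in>{i<..<bar i}. C $$ (i, c) * v c) else 0)"
  proof (intro sum.cong refl)
    fix a assume "a \<in> {..<N}"
    then show "row_act C g a a = (if a = i then (\<Sum>c\<in>{i<..<bar i}. C $$ (i, c) * v c) else 0)"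
      using r[of a a] V_zero[OF C, of a a] by auto
  qed
  then show "coc C g = \<theta> (- (\<Sum>c\<in>{i<..<bar i}. C $$ (i, c) * v c))"
    using C g bi by (simp add: coc_eq)
qed

text \<open>
  The stabilizer condition and the cocycle for row \<open>i\<close> involve row \<open>i\<close> only in the columns
  beyond \<open>i\<close>, where the new row is a linear combination of rows of \<open>A\<close> that \<open>u\<close> fixes. The
  diagonal term, which gives the cocycle, is unchanged because \<open>u\<close> fixes the earlier rows in
  column \<open>i\<close> as well.
\<close>

lemma add_rows_Stab:
  assumes A: "A \<in> V" and A': "A' \<in> V" and i: "i < n"
    and other: "\<And>a b. a < N \<Longrightarrow> b < N \<Longrightarrow> a \<noteq> i \<Longrightarrow> A' $$ (a, b) = A $$ (a, b)"
    and row: "\<And>b. i < b \<Longrightarrow> b < bar i \<Longrightarrow> A' $$ (i, b) = A $$ (i, b) + (\<Sum>l\<in>L. c l * A $$ (\<rho> l, b))"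
    and L: "\<And>l. l \<in> L \<Longrightarrow> \<rho> l < i" "\<And>l b. l \<in> L \<Longrightarrow> bar i \<le> b \<Longrightarrow> b < N \<Longrightarrow> A $$ (\<rho> l, b) = 0"
    and u: "u \<in> Stab A"
  shows "u \<in> Stab A'" and "coc A' u = coc A u"
proof -
  have bi: "bar i < N" "i < bar i" "i < N" using i N_bounds by (auto simp: opp_def)
  have uU: "u \<in> U" using u by (simp add: Stab_def)
  have rA: "row_act A u a j = A $$ (a, j)" if "a < n" "a < j" "j < bar a" for a j
    using u that Stab_iff[OF A] by blast
  have L': "\<rho> l < n" "\<rho> l < j" "j < bar (\<rho> l)" if "l \<in> L" "i \<le> j" "j < bar i" for l j
    using L(1)[OF that(1)] that i by (auto simp: opp_def)
  have r: "row_act A' u i j = row_act A u i j + (if j = i then 0 else \<Sum>l\<in>L. c l * A $$ (\<rho> l, j))"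
    if j: "i \<le> j" "j < bar i" for j
  proof -
    have "row_act A' u i j = (\<Sum>b<N. A $$ (i, b) * ui u $$ (j, b)
        + (\<Sum>l\<in>L. c l * (A $$ (\<rho> l, b) * ui u $$ (j, b))) - (if b = i then (if j = i then \<Sum>l\<in>L. c l * A $$ (\<rho> l, i) else 0) else 0))"
      unfolding row_act_def
    proof (intro sum.cong refl)
      fix b assume "b \<in> {..<N}"
      then have b: "b < N" by simp
      consider "b < j" | "b = i" "j = i" | "j \<le> b" "i < b" "b < bar i" | "bar i \<le> b" using j by linarith
      then show "A' $$ (i, b) * ui u $$ (j, b) = A $$ (i, b) * ui u $$ (j, b)
        + (\<Sum>l\<in>L. c l * (A $$ (\<rho> l, b) * ui u $$ (j, b))) - (if b = i then (if j = i then \<Sum>l\<in>L. c l * A $$ (\<rho> l, i) else 0) else 0)"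
      proof cases
        case 1
        then show ?thesis using U_lower[OF U_ui[OF uU], of j b] j bi by auto
      next
        case 2
        then show ?thesis
          using V_zero[OF A bi(3,3)] V_zero[OF A' bi(3,3)] U_diag[OF U_ui[OF uU] bi(3)] by simp
      next
        case 3
        then show ?thesis by (simp add: row distrib_right sum_distrib_right mult.assoc)
      next
        case 4
        then show ?thesis
          using V_zero[OF A bi(3) b] V_zero[OF A' bi(3) b] L(2)[of _ b] b bi by auto
      qed
    qed
    also have "\<dots> = row_act A u i j + (\<Sum>b<N. \<Sum>l\<in>L. c l * (A $$ (\<rho> l, b) * ui u $$ (j, b)))
        - (if j = i then \<Sum>l\<in>L. c l * A $$ (\<rho> l, i) else 0)"
      using bi by (simp add: row_act_def sum.distrib sum_subtractf)
    also have "(\<Sum>b<N. \<Sum>l\<in>L. c l * (A $$ (\<rho> l, b) * ui u $$ (j, b))) = (\<Sum>l\<in>L. c l * row_act A u (\<rho> l) j)"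
      by (subst sum.swap) (simp add: sum_distrib_left row_act_def)
    also have "\<dots> = (\<Sum>l\<in>L. c l * A $$ (\<rho> l, j))"
      using L' j by (intro sum.cong refl) (simp add: rA)
    finally show ?thesis by auto
  qed
  have same: "row_act A' u a j = row_act A u a j" if "a \<noteq> i" "a < N" for a j
    by (rule row_act_cong) (use other that in auto)
  have "row_act A' u a j = A' $$ (a, j)" if aj: "a < n \<and> a < j \<and> j < bar a" for a j
  proof -
    have b: "a < N" "j < N" using aj N_bounds by (auto simp: opp_def)
    show ?thesis
    proof (cases "a = i")
      case True
      then show ?thesis using r[of j] rA[of i j] row[of j] aj by simp
    next
      case False
      then show ?thesis using same[OF False b(1)] rA[of a j] other[OF b False] aj by simp
    qed
  qed
  then show "u \<in> Stab A'" using Stab_iff[OF A'] uU by blast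
  have "row_act A' u a a = row_act A u a a" if "a < N" for a
    using same[of a a] r[of i] bi that by (cases "a = i") auto
  then show "coc A' u = coc A u" using A A' uU by (simp add: coc_eq)
qed

text \<open>
  If \<open>bar i\<close> is the main column of an earlier row, main separation makes row \<open>i\<close> vanish in both
  matrices. Otherwise the elements of \<open>row_element\<close> whose prescribed row is orthogonal to the
  earlier rows fix both matrices, once \<open>clear_middle\<close> has been applied. Equality of the
  cocycles on them shows that the difference of the rows \<open>i\<close> is a combination of earlier rows.
\<close>

lemma agree_step:
  assumes A: "A \<in> V" "sep A" and B: "B \<in> V" "sep B" and ag: "agree A B" and i: "i < n"
    and rows: "\<And>l b. l < i \<Longrightarrow> b < N \<Longrightarrow> A $$ (l, b) = B $$ (l, b)"
  shows "\<exists>A'\<in>V. \<exists>B'\<in>V. sep A' \<and> sep B' \<and> agree A' B' \<and>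
    rmodule_isomorphic (unip_group T n) (OM A) (OM A') \<and> OM B' = OM B \<and>
    (\<forall>l b. l < Suc i \<and> b < N \<longrightarrow> A' $$ (l, b) = B' $$ (l, b))"
proof -
  have bi: "bar i < N" "i < bar i" "i < N" "bar (bar i) = i" using i N_bounds by (auto simp: opp_def)
  have main_rows: "(l, j) \<in> main A \<longleftrightarrow> (l, j) \<in> main B" if "l < i" for l j
    by (rule main_cong) (use rows that in auto)
  show ?thesis
  proof (cases "\<exists>l<i. (l, bar i) \<in> main A")
    case True
    then obtain l where l: "l < i" "(l, bar i) \<in> main A" "(l, bar i) \<in> main B" using main_rows by blast
    have zero: "C $$ (i, b) = 0" if C: "C \<in> V" "sep C" "(l, bar i) \<in> main C" "b < N" for C b
    proof (rule ccontr)
      assume "C $$ (i, b) \<noteq> 0"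
      then obtain j where "(i, j) \<in> main C" using main_row[OF C(1) bi(3) C(4)] by blast
      then show False using C l bi unfolding sep_iff by metis
    qed
    have "A $$ (a, b) = B $$ (a, b)" if "a < Suc i \<and> b < N" for a b
      using that rows zero[OF A l(2)] zero[OF B l(3)] by (cases "a = i") auto
    then show ?thesis
      using A B ag rmodule_isomorphic_refl by (intro bexI[of _ A] bexI[of _ B]) auto
  next
    case False
    obtain u where u: "u \<in> U" and cl: "\<And>l j c. (l, j) \<in> main A \<Longrightarrow> l < i \<Longrightarrow> bar i < j \<Longrightarrow>
        i \<le> c \<Longrightarrow> c \<le> bar i \<Longrightarrow> act A u $$ (l, c) = 0"
      using clear_middle[OF A i] by blast
    define A1 where "A1 = act A u"
    define B1 where "B1 = act B u"
    have A1: "A1 \<in> V" "sep A1" "main A1 = main A" and B1: "B1 \<in> V" "sep B1"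
      using A B u by (auto simp: A1_def B1_def act_V sep_act main_act)
    have ag1: "agree A1 B1" unfolding A1_def B1_def by (rule agree_act[OF A(1) B(1) u ag])
    have rows1: "A1 $$ (l, b) = B1 $$ (l, b)" if "l < i" "b < N" for l b
      unfolding A1_def B1_def by (rule act_row_cong) (use A B u rows that bi in auto)
    have main_rows1: "(l, j) \<in> main A1 \<longleftrightarrow> (l, j) \<in> main B1" if "l < i" for l j
      by (rule main_cong) (use rows1 that in auto)
    \<comment> \<open>After clearing, a row above \<open>i\<close> that meets the block has its main column strictly inside the block.\<close>
    have row_end: "(a, b) \<in> middle_main A1 i" if ab: "(a, b) \<in> main A1" "a < i" and c: "i < c" "c \<le> bar i" "c \<le> b" "A1 $$ (a, c) \<noteq> 0" for a b c
    proof -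
      have "\<not> bar i < b" using cl[of a b c] ab c A1 by (auto simp: A1_def)
      moreover have "b \<noteq> bar i" using False ab A1 by blast
      ultimately show ?thesis using ab c by (simp add: middle_main_def)
    qed
    have col1: "A1 $$ (a, bar i) = 0" if a: "a < i" for a
    proof (rule ccontr)
      assume nz: "A1 $$ (a, bar i) \<noteq> 0"
      have "a < N" using a bi by simp
      then obtain b where b: "bar i \<le> b" "(a, b) \<in> main A1" using main_row[OF A1(1) _ bi(1) nz] by blast
      then have "(a, b) \<in> middle_main A1 i" using row_end[OF b(2) a bi(2) _ b(1) nz] by simp
      with b show False by (simp add: middle_main_def)
    qed
    let ?L = "middle_main A1 i"
    let ?a = "middle_row A1 i"
    have ech: "echelon ?L ?a snd" by (rule middle_echelon[OF A1(2)])
    define d where "d b = (if i < b \<and> b < bar i then A1 $$ (i, b) - B1 $$ (i, b) else 0)" for b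
    have "\<exists>c. \<forall>b. d b = (\<Sum>l\<in>?L. c l * ?a l b)"
    proof (rule echelon_dual[OF ech, of "bar i"])
      show "snd l < bar i" if "l \<in> ?L" for l using that by (auto simp: middle_main_def)
      show "d b = 0" if "bar i \<le> b" for b using that by (simp add: d_def)
      fix w assume w: "\<forall>l\<in>?L. (\<Sum>b<bar i. ?a l b * w b) = 0"
      have restrict: "(\<Sum>b<bar i. (if i < b \<and> b < bar i then f b else 0) * w b) = (\<Sum>b\<in>{i<..<bar i}. f b * w b)" for f
        by (intro sum.mono_neutral_cong_right) auto
      show "(\<Sum>b<bar i. d b * w b) = 0"
      proof (rule theta_trivial)
        fix x
        \<comment> \<open>Scaling by \<open>x\<close> upgrades equality of values of \<open>\<theta>\<close> to equality in the field.\<close>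
        define v where "v b = w b * x" for b
        have perp: "(\<Sum>c\<in>{i<..<bar i}. A1 $$ (a, c) * v c) = 0" if a: "a < i" for a
        proof (cases "\<forall>c\<in>{i<..<bar i}. A1 $$ (a, c) = 0")
          case True
          then show ?thesis by (intro sum.neutral) auto
        next
          case False
          then obtain c where c: "i < c" "c < bar i" "A1 $$ (a, c) \<noteq> 0" by auto
          have aN: "a < N" "c < N" using a bi c by auto
          obtain b where b: "c \<le> b" "(a, b) \<in> main A1" using main_row[OF A1(1) aN c(3)] by blast
          then have "(a, b) \<in> ?L" using row_end[OF b(2) a c(1) _ b(1) c(3)] c by simp
          then have "(\<Sum>b'<bar i. ?a (a, b) b' * w b') = 0" using w by blast
          then have "(\<Sum>c\<in>{i<..<bar i}. A1 $$ (a, c) * w c) = 0"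
            unfolding middle_row_def restrict by simp
          then show ?thesis by (simp add: v_def mult.assoc[symmetric] sum_distrib_right[symmetric])
        qed
        obtain g where g: "g \<in> U" and ge: "\<And>a b. a < N \<Longrightarrow> b < N \<Longrightarrow> b \<noteq> bar i \<Longrightarrow>
          ui g $$ (a, b) = (if a = b then 1 else 0) + (if a = i \<and> i < b \<and> b < bar i then v b else 0)"
          using row_element[OF i, of v] by blast
        note eA = row_element_Stab[OF A1(1) i g ge col1 perp]
        have colB: "B1 $$ (a, bar i) = 0" if "a < i" for a using col1[OF that] rows1[OF that bi(1)] by simp
        have perpB: "(\<Sum>c\<in>{i<..<bar i}. B1 $$ (a, c) * v c) = 0" if "a < i" for a
          using perp[OF that] rows1[OF that] bi by simp
        note eB = row_element_Stab[OF B1(1) i g ge colB perpB]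
        have "coc A1 g = coc B1 g" using ag1 eA(1) eB(1) by (simp add: agree_def)
        then have "\<theta> (\<Sum>c\<in>{i<..<bar i}. A1 $$ (i, c) * v c) = \<theta> (\<Sum>c\<in>{i<..<bar i}. B1 $$ (i, c) * v c)"
          using eA(2) eB(2) by (simp add: theta_minus)
        moreover have "(\<Sum>b<bar i. d b * w b) * x
            = (\<Sum>c\<in>{i<..<bar i}. A1 $$ (i, c) * v c) - (\<Sum>c\<in>{i<..<bar i}. B1 $$ (i, c) * v c)"
          unfolding d_def restrict
          by (simp add: v_def sum_distrib_right left_diff_distrib sum_subtractf mult.assoc)
        ultimately show "\<theta> ((\<Sum>b<bar i. d b * w b) * x) = 1"
          by (simp only: diff_conv_add_uminus theta_add theta_minus) (simp add: theta_nz)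
      qed
    qed
    then obtain c where c: "\<And>b. d b = (\<Sum>l\<in>?L. c l * ?a l b)" by blast
    \<comment> \<open>Row \<open>i\<close> is replaced by that of \<open>B1\<close>, which differs by a combination of earlier rows.\<close>
    define A' where "A' = set_row A1 i (\<lambda>b. B1 $$ (i, b))"
    have A'V: "A' \<in> V" unfolding A'_def by (rule set_row_V[OF A1(1)])
    have A'e: "A' $$ (a, b) = (if a = i then B1 $$ (i, b) else A1 $$ (a, b))" if "a < N" "b < N" for a b
      using that V_zero[OF B1(1) bi(3) that(2)] by (auto simp: A'_def set_row_entry)
    have L: "fst l < i" "b < N \<Longrightarrow> bar i \<le> b \<Longrightarrow> A1 $$ (fst l, b) = 0" if "l \<in> ?L" for l b
      using that mainD(9)[of "fst l" "snd l" A1 b] by (auto simp: middle_main_def)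
    have dsum: "A1 $$ (i, b) = B1 $$ (i, b) + (\<Sum>l\<in>?L. c l * A1 $$ (fst l, b))" if "i < b" "b < bar i" for b
    proof -
      have "A1 $$ (i, b) - B1 $$ (i, b) = d b" using that by (simp add: d_def)
      also have "\<dots> = (\<Sum>l\<in>?L. c l * A1 $$ (fst l, b))" using that by (simp add: c middle_row_def)
      finally show ?thesis by (simp add: algebra_simps)
    qed
    have to_A': "h \<in> Stab A'" "coc A' h = coc A1 h" if h: "h \<in> Stab A1" for h
    proof -
      have row: "A' $$ (i, b) = A1 $$ (i, b) + (\<Sum>l\<in>?L. - c l * A1 $$ (fst l, b))" if "i < b" "b < bar i" for b
        using dsum[OF that] that bi by (simp add: A'e sum_negf)
      show "h \<in> Stab A'" "coc A' h = coc A1 h"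
        using add_rows_Stab[OF A1(1) A'V i _ row L(1) L(2) h] A'e by auto
    qed
    have from_A': "h \<in> Stab A1" if h: "h \<in> Stab A'" for h
    proof (rule add_rows_Stab(1)[OF A'V A1(1) i _ _ _ _ h])
      show "A1 $$ (a, b) = A' $$ (a, b)" if "a < N" "b < N" "a \<noteq> i" for a b using that by (simp add: A'e)
      show "A1 $$ (i, b) = A' $$ (i, b) + (\<Sum>l\<in>?L. c l * A' $$ (fst l, b))" if b: "i < b" "b < bar i" for b
      proof -
        have "(\<Sum>l\<in>?L. c l * A' $$ (fst l, b)) = (\<Sum>l\<in>?L. c l * A1 $$ (fst l, b))"
        proof (intro sum.cong refl)
          fix l assume "l \<in> ?L"
          then have "fst l < N" "fst l \<noteq> i" using L(1)[of l] bi by auto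
          then show "c l * A' $$ (fst l, b) = c l * A1 $$ (fst l, b)" using b bi by (simp add: A'e)
        qed
        then show ?thesis using dsum[OF b] b bi by (simp add: A'e)
      qed
      show "fst l < i" if "l \<in> ?L" for l by (rule L(1)[OF that])
      show "A' $$ (fst l, b) = 0" if "l \<in> ?L" "bar i \<le> b" "b < N" for l b
        using L[OF that(1)] that bi by (simp add: A'e)
    qed
    have stab: "Stab A1 = Stab A'" using to_A' from_A' by blast
    have "agree A1 A'" using to_A'(2) by (simp add: agree_def)
    then have "rmodule_isomorphic (unip_group T n) (OM A1) (OM A')"
      by (rule orbit_module_isomorphic[OF A1(1) A'V stab])
    moreover have "OM A1 = OM A" "OM B1 = OM B" using A B u by (simp_all add: A1_def B1_def OM_act_eq)
    moreover have "agree A' B1"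
      using ag1 to_A'(2) from_A' by (auto simp: agree_def)
    moreover have "A' $$ (l, b) = B1 $$ (l, b)" if "l < Suc i \<and> b < N" for l b
      using that rows1[of l b] bi by (cases "l = i") (auto simp: A'e)
    moreover have "sep A'"
      unfolding sep_iff
    proof (intro allI impI)
      fix l j x y assume lj: "(l, j) \<in> main A'" and xy: "(x, y) \<in> main A'" and lx: "l < x"
      have mB: "(a, b) \<in> main B1" if "(a, b) \<in> main A'" "a \<le> i" for a b
      proof -
        have "A' $$ (a, b') = B1 $$ (a, b')" if "b' < N" for b'
          using that \<open>a \<le> i\<close> rows1[of a b'] bi by (cases "a = i") (auto simp: A'e)
        then show ?thesis using main_cong[of A' a B1 b] that by blast
      qed
      have mA: "(a, b) \<in> main A1" if "(a, b) \<in> main A'" "a \<noteq> i" for a b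
      proof -
        have "a < N" using mainD(2)[OF that(1)] .
        then have "A' $$ (a, b') = A1 $$ (a, b')" if "b' < N" for b'
          using that \<open>a \<noteq> i\<close> by (simp add: A'e)
        then show ?thesis using main_cong[of A' a A1 b] that by blast
      qed
      \<comment> \<open>If the main column of row \<open>i\<close> were different in \<open>A1\<close> and \<open>B1\<close>, then in one of the two matrices it would coincide with the main column of an earlier row.\<close>
      have mi: "(i, j) \<in> main A1" if ij: "(i, j) \<in> main B1" for j
      proof -
        note D = mainD[OF ij]
        have sum: "A1 $$ (i, b) = B1 $$ (i, b) + d b" if "b < N" for b
          using V_zero[OF A1(1) bi(3) that] V_zero[OF B1(1) bi(3) that] by (auto simp: d_def)
        show ?thesis
        proof (cases "\<forall>b\<ge>j. d b = 0")
          case True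
          then show ?thesis using D by (intro mainI) (auto simp: sum)
        next
          case False
          then obtain b0 where b0: "j \<le> b0" "d b0 \<noteq> 0" by blast
          then obtain l0 where l0: "l0 \<in> ?L" "b0 \<le> snd l0" "d (snd l0) \<noteq> 0" "\<forall>b>snd l0. d b = 0"
            using echelon_rightmost[OF ech c] by blast
          define q where "q = snd l0"
          have q: "(fst l0, q) \<in> main A1" "fst l0 < i" "i < q" "q < bar i"
            using l0 by (auto simp: middle_main_def q_def)
          then have "(fst l0, q) \<in> main B1" using main_rows1 by blast
          then have "j \<noteq> q" using B1(2) ij q unfolding sep_iff by blast
          then have jq: "j < q" using b0 l0 by (simp add: q_def)
          have qN: "q < N" using q bi by simp
          have "(i, q) \<in> main A1"
          proof (rule mainI[OF q(3,4)])
            show "A1 $$ (i, q) \<noteq> 0" using sum[OF qN] D(9)[OF jq qN] l0 by (simp add: q_def)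
            show "A1 $$ (i, b) = 0" if "q < b" "b < N" for b
              using sum[OF that(2)] D(9)[of b] jq that l0 by (simp add: q_def)
          qed
          then show ?thesis using A1(2) q unfolding sep_iff by blast
        qed
      qed
      show "x \<noteq> bar j \<and> y \<noteq> j"
      proof (cases "x \<le> i")
        case True
        then show ?thesis using mB[OF lj] mB[OF xy] lx B1(2) unfolding sep_iff by simp
      next
        case False
        then have "(x, y) \<in> main A1" using mA[OF xy] by simp
        moreover have "(l, j) \<in> main A1" using mA[OF lj] mi mB[OF lj] by (cases "l = i") auto
        ultimately show ?thesis using lx A1(2) unfolding sep_iff by blast
      qed
    qed
    ultimately show ?thesis using A'V B1 by (intro bexI[of _ A'] bexI[of _ B1]) auto
  qed
qed

lemma agree_isomorphic:
  assumes "A \<in> V" "sep A" "B \<in> V" "sep B" "agree A B"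
  shows "rmodule_isomorphic (unip_group T n) (OM A) (OM B)"
proof -
  have "\<exists>A'\<in>V. \<exists>B'\<in>V. sep A' \<and> sep B' \<and> agree A' B' \<and>
    rmodule_isomorphic (unip_group T n) (OM A) (OM A') \<and> OM B' = OM B \<and>
    (\<forall>l b. l < i \<and> b < N \<longrightarrow> A' $$ (l, b) = B' $$ (l, b))" if "i \<le> n" for i
    using that
  proof (induction i)
    case 0
    then show ?case using assms rmodule_isomorphic_refl by (intro bexI[of _ A] bexI[of _ B]) auto
  next
    case (Suc i)
    then obtain A' B' where A': "A' \<in> V" "sep A'" and B': "B' \<in> V" "sep B'" and ag: "agree A' B'"
      and iso: "rmodule_isomorphic (unip_group T n) (OM A) (OM A')" "OM B' = OM B"
      and rows: "\<And>l b. l < i \<Longrightarrow> b < N \<Longrightarrow> A' $$ (l, b) = B' $$ (l, b)" by fastforce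
    obtain A'' B'' where s: "A'' \<in> V" "B'' \<in> V" "sep A''" "sep B''" "agree A'' B''"
      "rmodule_isomorphic (unip_group T n) (OM A') (OM A'')" "OM B'' = OM B'"
      "\<forall>l b. l < Suc i \<and> b < N \<longrightarrow> A'' $$ (l, b) = B'' $$ (l, b)"
      using agree_step[OF A' B' ag _ rows] Suc.prems by (metis Suc_le_eq)
    have "rmodule_isomorphic (unip_group T n) (OM A) (OM A'')"
      by (rule rmodule_isomorphic_trans[OF iso(1) s(6)])
    with s iso(2) show ?case by (intro bexI[of _ A''] bexI[of _ B'']) auto
  qed
  from this[of n] obtain A' B' where A': "A' \<in> V" "B' \<in> V"
    "rmodule_isomorphic (unip_group T n) (OM A) (OM A')" "OM B' = OM B"
    "\<forall>l b. l < n \<and> b < N \<longrightarrow> A' $$ (l, b) = B' $$ (l, b)" by auto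
  have "A' = B'"
    by (rule V_eqI[OF A'(1,2)]) (use A'(5) in \<open>auto simp: opp_def\<close>)
  with A' show ?thesis by simp
qed

end

text \<open>
  Translating the sum of all elements by 1 shows that the cardinality vanishes in the field.
\<close>

lemma two_nonzero:
  assumes "prime (p :: nat)" "odd p" "CARD('q::{field,finite}) = p ^ k"
  shows "(2 :: 'q) \<noteq> 0"
proof
  assume two: "(2 :: 'q) = 0"
  have "(\<Sum>x\<in>UNIV. x :: 'q) = (\<Sum>x\<in>UNIV. x + 1)"
    by (rule sum.reindex_bij_betw[symmetric]) (rule bij_betwI[where g = "\<lambda>x. x - 1"], auto)
  then have "of_nat (CARD('q)) = (0 :: 'q)" by (simp add: sum.distrib)
  moreover have "odd (CARD('q))" using assms by simp
  then obtain m where "CARD('q) = 2 * m + 1" by (rule oddE)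
  ultimately have "(2 :: 'q) * of_nat m + 1 = 0" by (simp add: add.commute)
  with two show False by simp
qed

theorem corollary6p19:
  fixes p k n :: nat
    and T :: orth_type
    and \<theta> :: "'q::{field,finite} \<Rightarrow> complex"
    and S :: "('v::ab_group_add, 'q mat) rmodule"
  assumes "prime p" and "odd p" and "CARD('q) = p ^ k"
    and "n \<ge> 1"
    and "nontrivial_add_char \<theta>"
    and "irreducible_rmodule (unip_group T n) S"
  shows "\<exists>!C. C \<in> main_separated_iso_classes \<theta> T n \<and> (\<exists>M\<in>C. constituent (unip_group T n) S M)"
proof -
  interpret orth_char T n \<theta>
    using two_nonzero assms by unfold_locales blast+
  let ?Q = "main_separated_orbit_modules \<theta> T n"
  let ?r = "{(M, M'). M \<in> ?Q \<and> M' \<in> ?Q \<and> rmodule_isomorphic (unip_group T n) M M'}"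
  have classes: "main_separated_iso_classes \<theta> T n = ?Q // ?r"
    by (simp add: main_separated_iso_classes_def)
  have Q: "M \<in> ?Q \<longleftrightarrow> (\<exists>A\<in>V. sep A \<and> M = OM A)" for M
    by (auto simp: main_separated_orbit_modules_def)
  have equiv: "equiv ?Q ?r"
  proof (rule equivI)
    show "?r \<subseteq> ?Q \<times> ?Q" by auto
    show "refl_on ?Q ?r" by (auto simp: refl_on_def rmodule_isomorphic_refl)
    show "sym ?r"
      unfolding sym_def using OM_group_rmodule rmodule_isomorphic_sym by (auto simp: Q)
    show "trans ?r"
      unfolding trans_def using rmodule_isomorphic_trans by blast
  qed
  have Sg: "group_rmodule (unip_group T n) S" using assms(6) by (simp add: irreducible_rmodule_def)
  obtain A s where A: "A \<in> V" "sep A" and ev: "eigenvector S (Stab A) A s"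
    using exists_sep_eigenvector[OF assms(6)] by blast
  have AQ: "OM A \<in> ?Q" using A Q by blast
  show ?thesis
  proof (rule ex1I[of _ "?r `` {OM A}"])
    have "?r `` {OM A} \<in> ?Q // ?r" using AQ by (rule quotientI)
    moreover have "OM A \<in> ?r `` {OM A}" using AQ by (simp add: rmodule_isomorphic_refl)
    ultimately show "?r `` {OM A} \<in> main_separated_iso_classes \<theta> T n \<and>
        (\<exists>M\<in>?r `` {OM A}. constituent (unip_group T n) S M)"
      using constituentI[OF assms(6) A(1) ev] unfolding classes by blast
  next
    fix C assume C: "C \<in> main_separated_iso_classes \<theta> T n \<and> (\<exists>M\<in>C. constituent (unip_group T n) S M)"
    then obtain M where M: "M \<in> C" "constituent (unip_group T n) S M" by blast
    have CQ: "C \<in> ?Q // ?r" using C classes by simp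
    then have MQ: "M \<in> ?Q" using M(1) in_quotient_imp_subset[OF equiv] by blast
    then obtain B where B: "B \<in> V" "sep B" "M = OM B" using Q by blast
    obtain u where u: "u \<in> U" "agree A (act B u)"
      using constituent_agree[OF Sg A(1) B(1) ev] M B by blast
    have "rmodule_isomorphic (unip_group T n) (OM A) (OM (act B u))"
      using A B u by (intro agree_isomorphic) (auto simp: act_V sep_act)
    then have "(OM A, M) \<in> ?r" using AQ MQ B u by (simp add: OM_act_eq)
    moreover obtain M' where "C = ?r `` {M'}" "M' \<in> ?Q" using CQ by (rule quotientE)
    ultimately show "C = ?r `` {OM A}"
      using M(1) equiv_class_eq[OF equiv] by fastforce
  qed
qed

end
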